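(* The chromatic number $\chi(G_{[1,b]}[A_{b}])$ satisfies the following, depending on the real number $b$: - if $b\in\Big(1,\sqrt{2 - 2 \sin(\frac{\pi}{18})}\Big]$ $(\approx(1,1.28558])$, then $\chi(G_{[1,b]}[A_{b}])=3$; - if $b\in\Big(\sqrt{2 - 2 \sin(\frac{\pi}{18})}, \sqrt{2-2 \sin(\frac{18 \pi}{325})}\Big]$ $(\approx(1.28558,1.28599])$, then $\chi(G_{[1,b]}[A_{b}])\in\{3,4\}$; - if $b\in\Big(\sqrt{2-2 \sin(\frac{18 \pi}{325})}, \sqrt{2} \Big]$ $(\approx(1.28599,1.41421])$, then $\chi(G_{[1,b]}[A_{b}])=4$; - if $b\in\Big(\sqrt{2}, \sqrt{2+2\sin(\frac{\pi}{38})} \Big]$ $(\approx(1.41421,1.47145])$, then $\chi(G_{[1,b]}[A_{b}])\in\{4,5\}$; - if $b\in\Big(\sqrt{2+2\sin(\frac{\pi}{38})}, \sqrt{\frac{3}{2} + \frac{\sqrt{5}}{2}} \Big]$ $(\approx(1.47145,1.61803])$, then $\chi(G_{[1,b]}[A_{b}])=5$; - if $b\in\Big(\sqrt{\frac{3}{2} + \frac{\sqrt{5}}{2}} , \sqrt{2+2\sin(\frac{7\pi}{45})} \Big]$ $(\approx(1.61803,1.71433])$, then $\chi(G_{[1,b]}[A_{b}])\in\{5,6\}$; - if $b\in\Big(\sqrt{2+2\sin(\frac{7\pi}{45})}, \sqrt{3} \Big]$ $(\approx(1.71433,1.73205])$, then $\chi(G_{[1,b]}[A_{b}])=6$; - if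 $b\in\Big(\sqrt{3}, 2 \cos(\frac{\pi}{7}) \Big]$ $(\approx(1.73205,1.80194])$, then $\chi(G_{[1,b]}[A_{b}])\in\{6,7\}$; - if $b\in\Big(2 \cos(\frac{\pi}{7}),2\sqrt{2}-1 \Big]$ $(\approx(1.80194,1.82843])$, then $\chi(G_{[1,b]}[A_{b}])\in\{6,7,8\}$; - if $b\in\Big(2\sqrt{2}-1, \sqrt{2+\sqrt{2}} \Big]$ $(\approx(1.82843,1.84776])$, then $\chi(G_{[1,b]}[A_{b}])\in\{7,8\}$.
   Context: For real $b>1$, $G_{[1,b]}$ is the graph with vertex set $\mathbb{R}^2$ in which two points $x,y$ are adjacent if and only if their Euclidean distance satisfies $1\le \mathrm{dist}(x,y)\le b$. The closed annulus $A_b$ is $A_{b}=\{p\in \mathbb{R}^2: 1 \le \mathrm{dist}(p,(0,0)) \le b\}$, and $G_{[1,b]}[A_b]$ denotes the subgraph of $G_{[1,b]}$ induced by the vertex set $A_b$. $\chi(G)$ denotes the chromatic number, i.e. the minimal cardinality of a set of colors for which there is a function from the vertices to colors (no measurability or regularity required) giving different colors to adjacent vertices. *)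

theory Defs
  imports "HOL-Analysis.Analysis" "HOL-Library.Extended_Nat"
begin

(* A graph is a vertex set together with its adjacency relation; the graphs below are
   symmetric and loopless. *)
record 'a graph =
  verts :: "'a set"
  adj :: "('a \<times> 'a) set"

definition induced_subgraph :: "'a graph \<Rightarrow> 'a set \<Rightarrow> 'a graph" where
  "induced_subgraph G S =
     \<lparr>verts = verts G \<inter> S, adj = adj G \<inter> (verts G \<inter> S) \<times> (verts G \<inter> S)\<rparr>"

definition proper_coloring :: "'a graph \<Rightarrow> 'c set \<Rightarrow> ('a \<Rightarrow> 'c) \<Rightarrow> bool" where
  "proper_coloring G C c \<longleftrightarrow>
     c \<in> verts G \<rightarrow> C \<and> (\<forall>(x, y) \<in> adj G. c x \<noteq> c y)"

(* Up to renaming, every finite set of colors is a set of natural numbers.  The infimum is over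
   finite sets of colors and is attained if one suffices; otherwise it is \<infinity>, so infinite
   chromatic numbers are not distinguished from each other. *)
definition chromatic_number :: "'a graph \<Rightarrow> enat" where
  "chromatic_number G =
     Inf {enat (card C) | C :: nat set. finite C \<and> (\<exists>c. proper_coloring G C c)}"

definition interval_distance_graph :: "real \<Rightarrow> (real ^ 2) graph" where
  "interval_distance_graph b =
     \<lparr>verts = UNIV, adj = {(x, y). 1 \<le> dist x y \<and> dist x y \<le> b}\<rparr>"

definition closed_annulus :: "real \<Rightarrow> (real ^ 2) set" where
  "closed_annulus b = {p. 1 \<le> dist p 0 \<and> dist p 0 \<le> b}"

end

(*
  Upper bounds: cut the annulus into M equal half-open sectors and color them cyclically with k
  colors.  A sector has diameter less than 1, and two sectors of the same color are more than b
  apart.  The values M = 9, 12 give k = 3, 4; for k = 5, ..., 8 take M = 2 k, so that opposite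
  sectors share a color.

  Two or three colors do not suffice: with two colors the coloring of the unit circle is locally
  constant.  With three colors every edge turns the color by +1 or -1 (mod 3), and since 4-cycles
  have winding number 0, the winding number of a closed walk on the circle depends only on
  its number of steps and its total angle.

  Four, five or six colors do not suffice: a coloring of the annulus induces a coloring of a finite
  graph whose vertices are n equally spaced points on each of a few concentric circles.  If assuming
  one pair of points to have equal colors is refuted by a finite case distinction, then by
  rotation and reflection all pairs in the same position have different colors and may be
  treated as edges from then on.  After some such steps there is no coloring at all.
*)

theory Submission
  imports Defs "HOL-Library.Multiset"
begin

section \<open>Colorings by sectors\<close>

text \<open>The widest pairs in a sector of angle \<alpha> between radii 1 and b lie along its
  diagonal or its outer chord, and the diagonal is at most 1 exactly if b \<le> 2 cos \<alpha>. For
  2 k sectors this condition implies all others and yields the thresholds 2 cos (\<pi> / k): the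
  golden ratio for k = 5, sqrt 3 for k = 6, sqrt (2 + sqrt 2) for k = 8. For k = 3 and k = 4 the
  decisive condition is instead the gap between sectors of the same color, 80 and 90 degrees on the
  unit circle. The thresholds with a sine in the lower bounds are chords of the unit circle too: of
  289 \<pi> / 650, slightly more than 80 degrees, of 50 among 190 equal steps, and of 59 among 180.
  Color classes may be arbitrary sets, so neither measure nor continuity is available. Local
  constancy has to be derived from the coloring rule, by letting two nearby points share neighbors;
  otherwise only finite subgraphs are used. Where the best lower and upper bounds do not meet,
  several values remain.\<close>

definition pt :: "real \<Rightarrow> real \<Rightarrow> real ^ 2" where
  "pt r t = vector [r * cos t, r * sin t]"

lemma dist_pt: "(dist (pt r t) (pt s u))\<^sup>2 = r\<^sup>2 + s\<^sup>2 - 2 * r * s * cos (t - u)"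
proof -
  have "(dist (pt r t) (pt s u))\<^sup>2 = (r * cos t - s * cos u)\<^sup>2 + (r * sin t - s * sin u)\<^sup>2"
    by (simp add: dist_vec_def L2_set_def sum_2 pt_def dist_real_def)
  also have "\<dots> = r\<^sup>2 * ((cos t)\<^sup>2 + (sin t)\<^sup>2) + s\<^sup>2 * ((cos u)\<^sup>2 + (sin u)\<^sup>2) - 2 * r * s * cos (t - u)"
    unfolding cos_diff by algebra
  finally show ?thesis by simp
qed

lemma dist_pt_0: "dist (pt r t) 0 = \<bar>r\<bar>"
proof -
  have "pt 0 t = 0"
    by (simp add: pt_def vec_eq_iff forall_2)
  then have "(dist (pt r t) 0)\<^sup>2 = \<bar>r\<bar>\<^sup>2"
    using dist_pt[of r t 0 t] by simp
  then show ?thesis by (rule power2_eq_imp_eq) auto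
qed

lemma norm_pt: "norm (pt r t) = \<bar>r\<bar>"
  using dist_pt_0[of r t] by simp

lemma pt_periodic: "pt r (t + 2 * pi * of_int k) = pt r t"
  by (simp only: pt_def cos_add sin_add cos_int_2pin sin_int_2pin) simp

lemma polar_form: "\<exists>t. 0 \<le> t \<and> t < 2 * pi \<and> p = pt (dist p 0) t"
proof -
  define z where "z = Complex (p $ 1) (p $ 2)"
  have n: "cmod z = dist p 0"
    by (simp add: z_def cmod_def dist_vec_def L2_set_def sum_2)
  have "p = pt (dist p 0) (Arg2pi z)"
    using cos_Arg2pi[of z] sin_Arg2pi[of z] n
    by (simp add: pt_def vec_eq_iff forall_2 z_def)
  then show ?thesis
    using Arg2pi[of z] by blast
qed

section \<open>Colorings of the annulus with k colors and the chromatic number\<close>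

definition annulus_coloring :: "real \<Rightarrow> nat \<Rightarrow> (real ^ 2 \<Rightarrow> nat) \<Rightarrow> bool" where
  "annulus_coloring b k c \<longleftrightarrow> (\<forall>p \<in> closed_annulus b. c p < k) \<and>
     (\<forall>p \<in> closed_annulus b. \<forall>q \<in> closed_annulus b.
        1 \<le> dist p q \<longrightarrow> dist p q \<le> b \<longrightarrow> c p \<noteq> c q)"

abbreviation annulus_graph :: "real \<Rightarrow> (real ^ 2) graph" where
  "annulus_graph b \<equiv> induced_subgraph (interval_distance_graph b) (closed_annulus b)"

lemma proper_coloring_annulus:
  "proper_coloring (annulus_graph b) C c \<longleftrightarrow> c ` closed_annulus b \<subseteq> C \<and>
     (\<forall>p \<in> closed_annulus b. \<forall>q \<in> closed_annulus b.
        1 \<le> dist p q \<longrightarrow> dist p q \<le> b \<longrightarrow> c p \<noteq> c q)"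
  unfolding proper_coloring_def induced_subgraph_def interval_distance_graph_def Pi_def
  by (simp add: image_subset_iff) blast

lemma chromatic_number_annulus_le:
  assumes "annulus_coloring b k c"
  shows "chromatic_number (annulus_graph b) \<le> enat k"
proof -
  have "proper_coloring (annulus_graph b) {..<k} c"
    using assms unfolding proper_coloring_annulus annulus_coloring_def by blast
  then have "enat (card {..<k}) \<in> {enat (card C) | C :: nat set. finite C \<and> (\<exists>c. proper_coloring (annulus_graph b) C c)}"
    by blast
  then show ?thesis
    unfolding chromatic_number_def by (intro Inf_lower) simp
qed

text \<open>A bijection onto an initial segment renumbers any finite color set of size at most k by
  colors below k. If no finite color set works at all, the infimum is \<infinity> and the bound is
  trivial.\<close>

lemma chromatic_number_annulus_ge:
  assumes "\<nexists>c. annulus_coloring b k c"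
  shows "enat (Suc k) \<le> chromatic_number (annulus_graph b)"
  unfolding chromatic_number_def
proof (rule Inf_greatest, clarify)
  fix C :: "nat set" and c
  assume C: "finite C" and c: "proper_coloring (annulus_graph b) C c"
  have "\<not> card C \<le> k"
  proof
    assume k: "card C \<le> k"
    obtain h where h: "bij_betw h C {0..<card C}"
      using ex_bij_betw_finite_nat[OF C] by blast
    have c_in: "c p \<in> C" if "p \<in> closed_annulus b" for p
      using c that unfolding proper_coloring_annulus by blast
    have "h x < k" if "x \<in> C" for x
      using bij_betwE[OF h] that k by fastforce
    moreover have "h x = h y \<longleftrightarrow> x = y" if "x \<in> C" "y \<in> C" for x y
      using bij_betw_imp_inj_on[OF h] that by (meson inj_on_eq_iff)
    ultimately have "annulus_coloring b k (h \<circ> c)"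
      using c c_in unfolding annulus_coloring_def proper_coloring_annulus comp_def by metis
    then show False using assms by blast
  qed
  then show "enat (Suc k) \<le> enat (card C)" by simp
qed

text \<open>Let \<open>C\<close> replace the cosine. For r \<le> s the expression is convex in r, so
  on [1, s] it is largest at an endpoint. At r = 1 (diagonal) it is at most 1 because s \<le> 2
  \<open>C\<close>; at r = s (chord) because s^2 (2 - 2 \<open>C\<close>) is at most its value for
  b. Strictness comes from \<open>C\<close> being below cos \<delta>.\<close>

lemma sector_distance_less_1:
  fixes r s b C \<delta> :: real
  assumes r: "1 \<le> r" "r \<le> b" and s: "1 \<le> s" "s \<le> b"
    and C: "C < cos \<delta>" "b \<le> 2 * C" "b\<^sup>2 * (2 - 2 * C) \<le> 1"
  shows "r\<^sup>2 + s\<^sup>2 - 2 * r * s * cos \<delta> < 1"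
proof -
  have *: "r\<^sup>2 + s\<^sup>2 - 2 * r * s * C \<le> 1" if r: "1 \<le> r" and rs: "r \<le> s" and s: "s \<le> b" for r s
  proof (cases "r + 1 - 2 * s * C \<le> 0")
    case True
    then have "(r - 1) * (r + 1 - 2 * s * C) \<le> 0"
      using r by (simp add: mult_nonneg_nonpos)
    moreover have "s * (s - 2 * C) \<le> 0"
      using s C r rs by (intro mult_nonneg_nonpos) auto
    ultimately show ?thesis by (simp add: power2_eq_square algebra_simps)
  next
    case False
    then have "0 \<le> (s - r) * (s + r - 2 * s * C)"
      using r rs by (intro mult_nonneg_nonneg) auto
    moreover have "C \<le> 1" using C(1) cos_le_one[of \<delta>] by linarith
    then have "s\<^sup>2 * (2 - 2 * C) \<le> b\<^sup>2 * (2 - 2 * C)"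
      using r rs s by (intro mult_right_mono power_mono) auto
    ultimately show ?thesis using C(3) by (simp add: power2_eq_square algebra_simps)
  qed
  have "2 * r * s * C < 2 * r * s * cos \<delta>"
    using r s C by (intro mult_strict_left_mono) auto
  moreover have "r\<^sup>2 + s\<^sup>2 - 2 * r * s * C \<le> 1"
    using *[of r s] *[of s r] r s by (cases "r \<le> s") (auto simp: algebra_simps)
  ultimately show ?thesis by linarith
qed

text \<open>The squared distance equals (r - s)^2 + 2 r s (1 - cos \<delta>), so two points at a
  given angle are closest when both lie on the unit circle.\<close>

lemma opposite_distance_greater:
  fixes r s C \<delta> b :: real
  assumes r: "1 \<le> r" and s: "1 \<le> s"
    and C: "cos \<delta> < C" "C \<le> 1" "b\<^sup>2 \<le> 2 - 2 * C"
  shows "b\<^sup>2 < r\<^sup>2 + s\<^sup>2 - 2 * r * s * cos \<delta>"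
proof -
  have "1 * 1 \<le> r * s" using r s by (intro mult_mono) auto
  moreover have "0 \<le> 1 - cos \<delta>" by simp
  ultimately have "1 * (1 - cos \<delta>) \<le> r * s * (1 - cos \<delta>)" by (intro mult_right_mono) auto
  moreover have "0 \<le> (r - s)\<^sup>2" by simp
  ultimately show ?thesis using C by (simp add: power2_eq_square algebra_simps)
qed

lemma cos_greater_if_abs_less:
  assumes "\<bar>\<delta>\<bar> < \<alpha>" "\<alpha> \<le> pi"
  shows "cos \<alpha> < cos \<delta>"
proof -
  have "cos \<alpha> < cos \<bar>\<delta>\<bar>" using assms by (intro cos_monotone_0_pi) auto
  then show ?thesis by simp
qed

lemma cos_less_if_between:
  assumes "\<alpha> < \<bar>\<delta>\<bar>" "\<bar>\<delta>\<bar> < 2 * pi - \<alpha>" "0 \<le> \<alpha>"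
  shows "cos \<delta> < cos \<alpha>"
proof (cases "\<bar>\<delta>\<bar> \<le> pi")
  case True
  then have "cos \<bar>\<delta>\<bar> < cos \<alpha>" using assms by (intro cos_monotone_0_pi) auto
  then show ?thesis by simp
next
  case False
  then have "cos (2 * pi - \<bar>\<delta>\<bar>) < cos \<alpha>" using assms by (intro cos_monotone_0_pi) auto
  then show ?thesis by (simp add: cos_diff)
qed

text \<open>Sectors of the same color are separated in both directions around the circle; the second
  bound is the direction across index 0, where the color pattern continues because k divides
  M.\<close>

lemma same_residue_far:
  fixes i j k M :: nat
  assumes "i mod k = j mod k" "i < j" "j < M" "k dvd M"
  shows "i + k \<le> j" "j + k \<le> i + M"
proof -
  have "k dvd j - i" using assms by (metis less_imp_le mod_eq_dvd_iff_nat)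
  then show "i + k \<le> j" using assms dvd_imp_le[of k "j - i"] by auto
  have "k dvd M - (j - i)" using \<open>k dvd j - i\<close> assms(4) by (metis dvd_diff_nat)
  then show "j + k \<le> i + M" using assms dvd_imp_le[of k "M - (j - i)"] by auto
qed

text \<open>The second and third conditions on b bound the diagonal and the outer chord of a sector.
  The last one concerns two sectors of the same color, which have at least k - 1 whole sectors
  between them. Since sectors are half-open, diameters are strictly below 1 and gaps strictly above
  b, which is why equality is allowed in all these conditions.\<close>

lemma sector_coloring:
  fixes M k :: nat and b :: real
  defines "\<alpha> \<equiv> 2 * pi / M"
  assumes M: "2 \<le> M" and k: "0 < k" "k dvd M"
    and b: "1 \<le> b" "b \<le> 2 * cos \<alpha>" "b\<^sup>2 * (2 - 2 * cos \<alpha>) \<le> 1"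
      "b\<^sup>2 \<le> 2 - 2 * cos (real (k - 1) * \<alpha>)"
  shows "\<exists>c. annulus_coloring b k c"
proof -
  define \<theta> where "\<theta> p = (SOME t. 0 \<le> t \<and> t < 2 * pi \<and> p = pt (dist p 0) t)" for p :: "real ^ 2"
  have \<theta>: "0 \<le> \<theta> p" "\<theta> p < 2 * pi" "p = pt (dist p 0) (\<theta> p)" for p
    using someI_ex[OF polar_form[of p]] unfolding \<theta>_def by auto
  have \<alpha>0: "0 < \<alpha>" using M by (simp add: \<alpha>_def)
  have M\<alpha>: "real M * \<alpha> = 2 * pi" using M by (simp add: \<alpha>_def)
  define \<iota> where "\<iota> p = nat \<lfloor>\<theta> p / \<alpha>\<rfloor>" for p :: "real ^ 2"
  have \<iota>: "real (\<iota> p) * \<alpha> \<le> \<theta> p" "\<theta> p < (real (\<iota> p) + 1) * \<alpha>" for p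
  proof -
    have "real (\<iota> p) = of_int \<lfloor>\<theta> p / \<alpha>\<rfloor>"
      using \<theta>(1)[of p] \<alpha>0 by (simp add: \<iota>_def)
    then have "real (\<iota> p) \<le> \<theta> p / \<alpha>" "\<theta> p / \<alpha> < real (\<iota> p) + 1" by linarith+
    then show "real (\<iota> p) * \<alpha> \<le> \<theta> p" "\<theta> p < (real (\<iota> p) + 1) * \<alpha>"
      using \<alpha>0 by (simp_all add: pos_le_divide_eq pos_divide_less_eq)
  qed
  have \<iota>M: "\<iota> p < M" for p
  proof -
    have "real (\<iota> p) * \<alpha> < real M * \<alpha>" using \<iota>(1)[of p] \<theta>(2)[of p] M\<alpha> by linarith
    then show ?thesis using \<alpha>0 by simp
  qed
  have dist: "(dist p q)\<^sup>2 = (dist p 0)\<^sup>2 + (dist q 0)\<^sup>2 - 2 * dist p 0 * dist q 0 * cos (\<theta> p - \<theta> q)" for p q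
    using dist_pt[of "dist p 0" "\<theta> p" "dist q 0" "\<theta> q"] \<theta>(3)[of p] \<theta>(3)[of q] by simp
  have far: "b < dist p q"
    if p: "p \<in> closed_annulus b" and q: "q \<in> closed_annulus b"
      and same: "\<iota> p mod k = \<iota> q mod k" and lt: "\<iota> p < \<iota> q" for p q
  proof -
    \<comment> \<open>The indices differ by at least k both ways around, but the points may sit at
      the facing ends of their sectors, so only an angle greater than (k - 1) \<alpha> is
      guaranteed.\<close>
    have "real (\<iota> p) + real k \<le> \<iota> q" "real (\<iota> q) + real k \<le> real (\<iota> p) + real M"
      using same_residue_far[OF same lt \<iota>M k(2)] by linarith+
    then have "(real (\<iota> p) + real k) * \<alpha> \<le> \<iota> q * \<alpha>" "(real (\<iota> q) + real k) * \<alpha> \<le> (real (\<iota> p) + real M) * \<alpha>"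
      using \<alpha>0 by (simp_all add: mult_right_mono)
    moreover have "real (k - 1) = real k - 1" using k by simp
    ultimately have "real (k - 1) * \<alpha> < \<theta> q - \<theta> p" "\<theta> q - \<theta> p < 2 * pi - real (k - 1) * \<alpha>"
      using \<iota>[of p] \<iota>[of q] M\<alpha> by (simp_all add: algebra_simps)
    moreover have "0 \<le> real (k - 1) * \<alpha>" using \<alpha>0 by simp
    ultimately have "cos (\<theta> q - \<theta> p) < cos (real (k - 1) * \<alpha>)"
      by (intro cos_less_if_between) auto
    then have "b\<^sup>2 < (dist p q)\<^sup>2"
      unfolding dist[of p q]
      using p q b cos_minus[of "\<theta> q - \<theta> p"]
      by (intro opposite_distance_greater[where C = "cos (real (k - 1) * \<alpha>)"])
        (auto simp: closed_annulus_def)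
    then show ?thesis using b by (simp add: power2_less_imp_less)
  qed
  have near: "dist p q < 1"
    if p: "p \<in> closed_annulus b" and q: "q \<in> closed_annulus b" and eq: "\<iota> p = \<iota> q" for p q
  proof -
    have "\<bar>\<theta> p - \<theta> q\<bar> < \<alpha>"
      using \<iota>[of p] \<iota>[of q] eq by (simp add: algebra_simps abs_less_iff)
    moreover have "\<alpha> \<le> pi" using M by (simp add: \<alpha>_def field_simps)
    ultimately have "cos \<alpha> < cos (\<theta> p - \<theta> q)" by (rule cos_greater_if_abs_less)
    then have "(dist p q)\<^sup>2 < 1"
      unfolding dist[of p q] using p q b
      by (intro sector_distance_less_1[where C = "cos \<alpha>"]) (auto simp: closed_annulus_def)
    then show ?thesis by (simp add: power_less_one_iff abs_square_less_1)
  qed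
  have "annulus_coloring b k (\<lambda>p. \<iota> p mod k)"
    unfolding annulus_coloring_def
  proof (intro conjI ballI impI)
    fix p q assume pq: "p \<in> closed_annulus b" "q \<in> closed_annulus b" "1 \<le> dist p q" "dist p q \<le> b"
    show "\<iota> p mod k \<noteq> \<iota> q mod k"
    proof
      assume same: "\<iota> p mod k = \<iota> q mod k"
      consider "\<iota> p < \<iota> q" | "\<iota> q < \<iota> p" | "\<iota> p = \<iota> q" by linarith
      then show False
        using far[OF pq(1,2) same] far[OF pq(2,1) same[symmetric]] near[OF pq(1,2)] pq
        by cases (auto simp: dist_commute)
    qed
  qed (use k in auto)
  then show ?thesis by blast
qed

text \<open>The angles 3 \<pi> / 5 and 2 \<pi> / 5 are supplementary. The formulas for triple and
  double angles then give a cubic equation for the cosine, with the spurious factor c + 1.\<close>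

lemma cos_pi_5: "4 * (cos (pi / 5))\<^sup>2 - 2 * cos (pi / 5) - 1 = 0"
proof -
  define c where "c = cos (pi / 5)"
  have "cos (3 * (pi / 5)) = - cos (2 * (pi / 5))"
    using cos_pi_minus[of "2 * (pi / 5)"] by (simp add: field_simps)
  then have "4 * c ^ 3 - 3 * c + 2 * c\<^sup>2 - 1 = 0"
    unfolding cos_treble_cos cos_double_cos c_def by simp
  then have "(c + 1) * (4 * c\<^sup>2 - 2 * c - 1) = 0"
    by (simp add: algebra_simps power2_eq_square power3_eq_cube)
  moreover have "0 < c" unfolding c_def by (intro cos_gt_zero) auto
  ultimately show ?thesis unfolding c_def by simp
qed

lemma cos_pi_5_eq: "cos (pi / 5) = (1 + sqrt 5) / 4"
proof -
  define c where "c = cos (pi / 5)"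
  have c0: "0 < c" unfolding c_def by (intro cos_gt_zero) auto
  have "(4 * c - 1)\<^sup>2 = 5" using cos_pi_5 unfolding c_def by (simp add: power2_eq_square algebra_simps)
  then have "\<bar>4 * c - 1\<bar> = sqrt 5" by (metis real_sqrt_abs)
  moreover have "2 < sqrt 5" by (rule real_less_rsqrt) simp
  ultimately have "4 * c - 1 = sqrt 5" using c0 by (auto simp: abs_if split: if_splits)
  then show ?thesis unfolding c_def by simp
qed

text \<open>With x = cos (\<pi> / k) only b \<le> 2 x has to be assumed. The chord condition becomes
  (2 x - 1) (4 x^2 - 2 x - 1) \<ge> 0, with equality at x = cos (\<pi> / 5); this is where k \<ge> 5
  enters. The gap condition becomes (2 x + 1) (x - 1) \<le> 0.\<close>

lemma opposite_sector_coloring: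
  assumes k: "5 \<le> k" and b: "1 \<le> b" "b \<le> 2 * cos (pi / k)"
  shows "\<exists>c. annulus_coloring b k c"
proof -
  define x where "x = cos (pi / k)"
  have "cos (pi / 5) \<le> x" unfolding x_def
    using k by (intro cos_monotone_0_pi_le) (auto simp: field_simps)
  then have x: "(1 + sqrt 5) / 4 \<le> x" by (simp add: cos_pi_5_eq)
  have x1: "x \<le> 1" by (simp add: x_def)
  have s5: "2 < sqrt 5" by (rule real_less_rsqrt) simp
  have b2: "b\<^sup>2 \<le> 4 * x\<^sup>2" using power_mono[of b "2 * x" 2] b by (simp add: x_def power_mult_distrib)
  \<comment> \<open>The product is 4 (4 x^2 - 2 x - 1), factored by its roots (1 + sqrt 5) / 4 and
    (1 - sqrt 5) / 4.\<close>
  have "0 \<le> (4 * x - 1 - sqrt 5) * (4 * x - 1 + sqrt 5)" using x s5 by (intro mult_nonneg_nonneg) auto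
  then have "0 \<le> 4 * x\<^sup>2 - 2 * x - 1" by (simp add: power2_eq_square algebra_simps)
  then have "0 \<le> (2 * x - 1) * (4 * x\<^sup>2 - 2 * x - 1)" using x s5 by (intro mult_nonneg_nonneg) auto
  then have "4 * x\<^sup>2 * (2 - 2 * x) \<le> 1" by (simp add: power2_eq_square algebra_simps)
  moreover have "b\<^sup>2 * (2 - 2 * x) \<le> 4 * x\<^sup>2 * (2 - 2 * x)" using b2 x1 by (intro mult_right_mono) auto
  ultimately have 1: "b\<^sup>2 * (2 - 2 * x) \<le> 1" by linarith
  have "(2 * x + 1) * (x - 1) \<le> 0" using x s5 x1 by (intro mult_nonneg_nonpos) auto
  then have 2: "b\<^sup>2 \<le> 2 + 2 * x" using b2 by (simp add: power2_eq_square algebra_simps)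
  have "real (k - 1) * (2 * pi / real (2 * k)) = pi - pi / k" using k by (simp add: field_simps)
  then have 3: "cos (real (k - 1) * (2 * pi / real (2 * k))) = - x" by (simp add: x_def)
  have 4: "2 * pi / real (2 * k) = pi / k" by simp
  show ?thesis
    using k b(1) by (intro sector_coloring[of "2 * k"]; (unfold 3)?; (unfold 4)?) (use b 1 2 in \<open>auto simp: x_def\<close>)
qed

text \<open>Nine sectors of 40 degrees; two sectors of the same color are separated by two whole
  sectors, hence 80 degrees, and cos 80 = sin 10 produces the threshold. The conditions on a single
  sector hold with room to spare and are checked by rational estimates.\<close>

lemma three_coloring:
  assumes b: "1 \<le> b" "b \<le> sqrt (2 - 2 * sin (pi / 18))"
  shows "\<exists>c. annulus_coloring b 3 c"
proof (rule sector_coloring[of 9 3])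
  have "real (3 - 1) * (2 * pi / real 9) = pi / 2 - pi / 18" by simp
  then have eq: "cos (real (3 - 1) * (2 * pi / real 9)) = sin (pi / 18)" by (simp only: cos_diff) simp
  have s: "0 < sin (pi / 18)" by (intro sin_gt_zero) auto
  have "b\<^sup>2 \<le> (sqrt (2 - 2 * sin (pi / 18)))\<^sup>2" using b by (intro power_mono) auto
  then show b2: "b\<^sup>2 \<le> 2 - 2 * cos (real (3 - 1) * (2 * pi / real 9))" unfolding eq by simp
  have c: "sqrt 2 / 2 \<le> cos (2 * pi / real 9)"
    unfolding cos_45[symmetric] by (intro cos_monotone_0_pi_le) auto
  have "b\<^sup>2 \<le> 2" using b2 s unfolding eq by simp
  then have "b \<le> sqrt 2" using real_le_rsqrt by blast
  then show "b \<le> 2 * cos (2 * pi / real 9)" using c by simp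
  have "7 / 5 \<le> sqrt 2" by (rule real_le_rsqrt) (simp add: power2_eq_square)
  then have c': "2 - 2 * cos (2 * pi / real 9) \<le> 3 / 5" using c by simp
  have "b\<^sup>2 \<le> 5 / 3"
  proof -
    \<comment> \<open>From sin 30 = 3 s - 4 s^3 with s = sin 10 (in degrees) and s^3 \<ge> 0. The
      bound 1 / 6 turns into b^2 \<le> 5 / 3, which matches the factor 3 / 5 obtained from cos 40
      \<ge> cos 45.\<close>
    have "1 / 6 \<le> sin (pi / 18)"
    proof -
      define s where "s = sin (pi / 18)"
      have "cos (3 * (4 * pi / 9)) = cos (pi / 3 + pi)" by (rule arg_cong[of _ _ cos]) simp
      then have "4 * cos (4 * pi / 9) ^ 3 - 3 * cos (4 * pi / 9) = - 1 / 2"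
        unfolding cos_treble_cos cos_periodic_pi cos_60 by simp
      then have "1 / 2 = 3 * s - 4 * s ^ 3"
        using eq by (simp add: s_def)
      moreover have "0 \<le> s ^ 3" using s by (simp add: s_def)
      ultimately show ?thesis unfolding s_def by linarith
    qed
    then show ?thesis using b2 unfolding eq by simp
  qed
  then have "b\<^sup>2 * (2 - 2 * cos (2 * pi / real 9)) \<le> 5 / 3 * (3 / 5)"
    using c' by (intro mult_mono) auto
  then show "b\<^sup>2 * (2 - 2 * cos (2 * pi / real 9)) \<le> 1" by simp
qed (use b in auto)

text \<open>Twelve sectors of 30 degrees; three whole sectors separate those of the same color, a
  right angle, whose chord on the unit circle is sqrt 2.\<close>

lemma four_coloring:
  assumes b: "1 \<le> b" "b \<le> sqrt 2"
  shows "\<exists>c. annulus_coloring b 4 c"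
proof (rule sector_coloring[of 12 4])
  have eq: "2 * pi / real 12 = pi / 6" by simp
  have eq2: "real (4 - 1) * (2 * pi / real 12) = pi / 2" by simp
  have b2: "b\<^sup>2 \<le> 2" using power_mono[OF b(2), of 2] b by simp
  then show "b\<^sup>2 \<le> 2 - 2 * cos (real (4 - 1) * (2 * pi / real 12))" unfolding eq2 by simp
  have s: "17 / 10 \<le> sqrt 3" by (rule real_le_rsqrt) (simp add: power2_eq_square)
  have "sqrt 2 \<le> sqrt 3" by (rule real_sqrt_le_mono) simp
  then show "b \<le> 2 * cos (2 * pi / real 12)" unfolding eq cos_30 using b by linarith
  have "b\<^sup>2 * (2 - sqrt 3) \<le> 2 * (3 / 10)" using b2 s by (intro mult_mono) (auto intro: real_le_lsqrt)
  then show "b\<^sup>2 * (2 - 2 * cos (2 * pi / real 12)) \<le> 1" unfolding eq cos_30 by simp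
qed (use b in auto)

section \<open>Colorings with two or three colors\<close>

lemma annulus_coloring_less:
  assumes "annulus_coloring b k c" "1 \<le> r" "r \<le> b"
  shows "c (pt r t) < k"
  using assms by (simp add: annulus_coloring_def closed_annulus_def norm_pt)

lemma annulus_coloring_neq:
  assumes "annulus_coloring b k c" "1 \<le> r" "r \<le> b" "1 \<le> s" "s \<le> b"
    and d: "1 \<le> r\<^sup>2 + s\<^sup>2 - 2 * r * s * cos (t - u)" "r\<^sup>2 + s\<^sup>2 - 2 * r * s * cos (t - u) \<le> b\<^sup>2"
  shows "c (pt r t) \<noteq> c (pt s u)"
proof -
  have 1: "1\<^sup>2 \<le> (dist (pt r t) (pt s u))\<^sup>2" and 2: "(dist (pt r t) (pt s u))\<^sup>2 \<le> b\<^sup>2"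
    using d unfolding dist_pt by simp_all
  have "0 \<le> b" using assms(2,3) by linarith
  with 2 have "dist (pt r t) (pt s u) \<le> b" by (rule power2_le_imp_le)
  moreover have "1 \<le> dist (pt r t) (pt s u)" using 1 zero_le_dist by (rule power2_le_imp_le)
  moreover have "pt r t \<in> closed_annulus b" "pt s u \<in> closed_annulus b"
    using assms(2-5) by (simp_all add: closed_annulus_def norm_pt)
  ultimately show ?thesis
    using assms(1) unfolding annulus_coloring_def by blast
qed

lemma annulus_coloring_neq_unit:
  assumes "annulus_coloring b k c" "1 \<le> b"
    and d: "\<alpha> \<le> d" "d \<le> \<beta>" "0 \<le> \<alpha>" "\<beta> \<le> pi" "cos \<alpha> \<le> 1 / 2" "2 - 2 * cos \<beta> \<le> b\<^sup>2"
  shows "c (pt 1 t) \<noteq> c (pt 1 (t + d))"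
proof -
  have "cos d \<le> cos \<alpha>" "cos \<beta> \<le> cos d" using d by (auto intro: cos_monotone_0_pi_le)
  moreover have "t - (t + d) = - d" by simp
  ultimately show ?thesis
    using d assms(2) by (intro annulus_coloring_neq[OF assms(1)]) (simp_all only: cos_minus, simp_all)
qed

text \<open>The radius \<open>e\<close> does not depend on the point, so any interval is covered by
  finitely many equal steps of length at most \<open>e\<close>.\<close>

lemma locally_constant_imp_constant:
  fixes g :: "real \<Rightarrow> 'a"
  assumes "0 < e" "\<And>t \<delta>. 0 \<le> \<delta> \<Longrightarrow> \<delta> \<le> e \<Longrightarrow> g (t + \<delta>) = g t"
  shows "g s = g t"
proof -
  have *: "g (t + n * \<delta>) = g t" if "0 \<le> \<delta>" "\<delta> \<le> e" for t \<delta> :: real and n :: nat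
  proof (induction n)
    case (Suc n)
    have "g (t + Suc n * \<delta>) = g ((t + n * \<delta>) + \<delta>)" by (simp add: algebra_simps)
    then show ?case using Suc assms(2)[OF that] by simp
  qed simp
  have **: "g s = g t" if "t \<le> s" for s t
  proof -
    obtain n :: nat where n: "(s - t) / e < n" using reals_Archimedean2 by blast
    then have "0 < n" using that assms(1) by (metis divide_nonneg_pos diff_ge_0_iff_ge le_less_trans of_nat_0_less_iff)
    then have "(s - t) / n \<le> e" using n assms(1) by (simp add: field_simps)
    then have "g (t + n * ((s - t) / n)) = g t" using that by (intro *) auto
    then show ?thesis using \<open>0 < n\<close> by simp
  qed
  show ?thesis using **[of s t] **[of t s] by (cases "s \<le> t") auto
qed

lemma no_two_coloring:
  assumes "1 < b"
  shows "\<nexists>c. annulus_coloring b 2 c"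
proof
  assume "\<exists>c. annulus_coloring b 2 c"
  then obtain c where c: "annulus_coloring b 2 c" ..
  \<comment> \<open>A chord of length b subtends an angle with cosine 1 - b^2 / 2. Truncation at 0
    keeps the argument of \<open>arccos\<close> in its domain when b is large and still leaves an
    angle of more than 60 degrees.\<close>
  define C where "C = max 0 (1 - b\<^sup>2 / 2)"
  define \<beta> where "\<beta> = arccos C"
  have b2: "1 < b\<^sup>2" using assms by (simp add: one_less_power)
  have C: "0 \<le> C" "C < 1 / 2" using b2 by (auto simp: C_def max_def)
  have \<beta>: "cos \<beta> = C" "0 \<le> \<beta>" "\<beta> \<le> pi"
    using C by (auto simp: \<beta>_def intro: arccos_lbound arccos_ubound)
  have gt: "pi / 3 < \<beta>"
  proof -
    have "cos \<beta> < cos (pi / 3)" using \<beta> C by (simp add: cos_60)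
    then show ?thesis using \<beta> by (subst (asm) cos_mono_less_eq) auto
  qed
  define g where "g t = c (pt 1 t)" for t
  have g2: "g t < 2" for t
    unfolding g_def using assms by (intro annulus_coloring_less[OF c]) auto
  have neq: "g t \<noteq> g (t + d)" if "pi / 3 \<le> d" "d \<le> \<beta>" for t d
    unfolding g_def using assms that \<beta>
    by (intro annulus_coloring_neq_unit[OF c, where \<alpha> = "pi / 3" and \<beta> = \<beta>]) (auto simp: cos_60 C_def max_def)
  \<comment> \<open>Both points differ in color from the one at t - \<pi> / 3, and only one other
    color exists.\<close>
  have "g (t + \<delta>) = g t" if "0 \<le> \<delta>" "\<delta> \<le> \<beta> - pi / 3" for t \<delta>
    using neq[of "pi / 3" "t - pi / 3"] neq[of "pi / 3 + \<delta>" "t - pi / 3"] gt that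
      g2[of t] g2[of "t - pi / 3"] g2[of "t + \<delta>"] by auto
  then have "g 0 = g (pi / 3)"
    by (rule locally_constant_imp_constant[of "\<beta> - pi / 3", rotated]) (use gt in auto)
  then show False using neq[of "pi / 3" 0] gt by simp
qed

section \<open>Winding of three-colorings along walks on the circle\<close>

definition step :: "nat \<Rightarrow> nat \<Rightarrow> int" where
  "step x y = (if (x + 1) mod 3 = y then 1 else - 1)"

lemma less_3_cases: "x < 3 \<longleftrightarrow> x = 0 \<or> x = 1 \<or> x = (2 :: nat)" by auto

lemma step_mod_3:
  assumes "x < 3" "y < 3" "x \<noteq> y"
  shows "3 dvd int x + step x y - int y"
  using assms unfolding less_3_cases by (elim disjE) (simp_all add: step_def)

text \<open>For distinct colors \<open>step\<close> is antisymmetric, so the difference of the two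
  sides is the total around a closed walk of length four in a triangle. That total is even,
  divisible by 3 and at most 4 in absolute value, hence 0.\<close>

lemma step_square:
  assumes "x < 3" "y < 3" "y' < 3" "z < 3" "x \<noteq> y" "y \<noteq> z" "x \<noteq> y'" "y' \<noteq> z"
  shows "step x y + step y z = step x y' + step y' z"
  using assms unfolding less_3_cases by (elim disjE) (simp_all add: step_def)

text \<open>Equal colors fall under the default -1, so that parity and size of a walk can be bounded
  without knowing that its steps are edges.\<close>

lemma step_cases: "step x y = 1 \<or> step x y = - 1"
  by (simp add: step_def)

text \<open>The coloring of the unit circle, pulled back to the line of angles; \<open>g_neq\<close>
  records the edges whose angles fill a whole interval, and it is the freedom within this interval
  that makes steps exchangeable.\<close>

locale circle_three_coloring =
  fixes g :: "real \<Rightarrow> nat" and \<alpha> \<beta> :: real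
  assumes g_less: "g t < 3"
    and g_periodic: "g (t + 2 * pi) = g t"
    and g_neq: "\<alpha> \<le> d \<Longrightarrow> d \<le> \<beta> \<Longrightarrow> g t \<noteq> g (t + d)"
begin

text \<open>Colors are regarded as residues mod 3; this is the displacement of the lift to the
  integers along a walk with start t and given turning angles. For a closed walk it is three times
  the winding number.\<close>

primrec walk :: "real \<Rightarrow> real list \<Rightarrow> int" where
  "walk t [] = 0"
| "walk t (d # ds) = step (g t) (g (t + d)) + walk (t + d) ds"

lemma walk_append: "walk t (xs @ ys) = walk t xs + walk (t + sum_list xs) ys"
  by (induction xs arbitrary: t) (auto simp: algebra_simps)

text \<open>The two walks have the same end points and thus bound a 4-cycle.\<close>

lemma two_steps:
  assumes "{d, e, d', e'} \<subseteq> {\<alpha>..\<beta>}" "d + e = d' + e'"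
  shows "walk t [d, e] = walk t [d', e']"
proof -
  have eq: "t + d' + e' = t + d + e" using assms(2) by simp
  have "step (g t) (g (t + d)) + step (g (t + d)) (g (t + d + e)) =
      step (g t) (g (t + d')) + step (g (t + d')) (g (t + d + e))"
    using assms(1) g_neq[of d t] g_neq[of d' t] g_neq[of e "t + d"] g_neq[of e' "t + d'"]
    by (intro step_square g_less) (simp_all add: eq)
  then show ?thesis by (simp add: eq)
qed

lemma walk_move:
  assumes "insert d (set xs) \<subseteq> {\<alpha>..\<beta>}"
  shows "walk t (xs @ d # ys) = walk t (d # xs @ ys)"
  using assms
proof (induction xs arbitrary: t)
  case (Cons x xs)
  have "walk t (x # d # xs @ ys) = walk t [x, d] + walk (t + (x + d)) (xs @ ys)"
    by (simp add: algebra_simps)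
  also have "walk t [x, d] = walk t [d, x]" using Cons.prems by (intro two_steps) auto
  also have "\<dots> + walk (t + (x + d)) (xs @ ys) = walk t (d # x # xs @ ys)"
    by (simp add: algebra_simps)
  finally show ?case using Cons by simp
qed simp

text \<open>Exchanging neighboring steps is an instance of \<open>two_steps\<close>, and every
  permutation is composed of such exchanges.\<close>

lemma walk_mset:
  assumes "mset xs = mset ys" "set xs \<subseteq> {\<alpha>..\<beta>}"
  shows "walk t xs = walk t ys"
  using assms
proof (induction xs arbitrary: ys t)
  case (Cons d xs)
  then have "d \<in> set ys" by (metis list.set_intros(1) set_mset_mset)
  then obtain us vs where ys: "ys = us @ d # vs" by (meson split_list)
  have "set ys \<subseteq> {\<alpha>..\<beta>}" using Cons.prems by (metis set_mset_mset)
  then have "walk t ys = walk t (d # us @ vs)"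
    unfolding ys by (intro walk_move) auto
  then show ?case using Cons.IH[of "us @ vs"] Cons.prems by (simp add: ys)
qed simp

lemma walk_mod_3: "set ds \<subseteq> {\<alpha>..\<beta>} \<Longrightarrow> 3 dvd int (g t) + walk t ds - int (g (t + sum_list ds))"
proof (induction ds arbitrary: t)
  case (Cons d ds)
  have "3 dvd int (g t) + step (g t) (g (t + d)) - int (g (t + d))"
    using Cons.prems by (intro step_mod_3 g_less g_neq) auto
  moreover have "3 dvd int (g (t + d)) + walk (t + d) ds - int (g (t + d + sum_list ds))"
    using Cons by simp
  ultimately have "3 dvd (int (g t) + step (g t) (g (t + d)) - int (g (t + d))) +
      (int (g (t + d)) + walk (t + d) ds - int (g (t + d + sum_list ds)))"
    by (rule dvd_add)
  then show ?case by (simp add: algebra_simps)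
qed simp

lemma walk_parity: "even (walk t ds + int (length ds))"
proof (induction ds arbitrary: t)
  case (Cons d ds)
  then show ?case using step_cases[of "g t" "g (t + d)"] Cons[of "t + d"] by auto
qed simp

lemma walk_bound: "\<bar>walk t ds\<bar> \<le> int (length ds)"
proof (induction ds arbitrary: t)
  case (Cons d ds)
  have "\<bar>walk (t + d) ds\<bar> \<le> int (length ds)" by (rule Cons)
  then show ?case using step_cases[of "g t" "g (t + d)"] by auto
qed simp

text \<open>A walk whose total has the largest possible absolute value must have all its steps
  equal. Only the first one is recorded, since the start is arbitrary.\<close>

lemma walk_extreme:
  "walk t ds = e * int (length ds) \<Longrightarrow> e = 1 \<or> e = -1 \<Longrightarrow> ds \<noteq> [] \<Longrightarrow> step (g t) (g (t + hd ds)) = e"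
  using walk_bound[of "t + hd ds" "tl ds"] step_cases[of "g t" "g (t + hd ds)"]
  by (cases ds) auto

lemma g_periodic_nat: "g (t + 2 * pi * real n) = g t"
proof (induction n)
  case (Suc n)
  have "g (t + 2 * pi * real (Suc n)) = g (t + 2 * pi * real n + 2 * pi)" by (simp add: algebra_simps)
  then show ?case using Suc g_periodic by simp
qed simp

lemma walk_periodic: "walk (t + 2 * pi * real n) ds = walk t ds"
proof (induction ds arbitrary: t)
  case (Cons d ds)
  have "t + 2 * pi * real n + d = (t + d) + 2 * pi * real n" by simp
  then show ?case by (simp only: walk.simps g_periodic_nat Cons)
qed simp

lemma closed_walk_mod_3:
  assumes "set ds \<subseteq> {\<alpha>..\<beta>}" "sum_list ds = 2 * pi * real n"
  shows "3 dvd walk t ds"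
  using walk_mod_3[OF assms(1), of t] by (simp add: assms(2) g_periodic_nat)

text \<open>Put a step d in front of the closed walk and move it to the end: the total does not
  change, and by periodicity the step contributes the same in both places. So the start may be
  shifted by any d in [\<alpha>, \<beta>], hence by small differences of such d, and the total is
  locally constant.\<close>

lemma closed_walk_shift:
  assumes "set ds \<subseteq> {\<alpha>..\<beta>}" "sum_list ds = 2 * pi * real n" "\<alpha> < \<beta>"
  shows "walk s ds = walk t ds"
proof -
  have 1: "walk (t + d) ds = walk t ds" if "d \<in> {\<alpha>..\<beta>}" for t d
  proof -
    have "walk t (d # ds) = walk t (ds @ [d])"
      using that assms(1) by (intro walk_mset) auto
    then show ?thesis using walk_periodic[of t n "[d]"] by (simp add: walk_append assms(2) algebra_simps)
  qed
  have "walk (t + \<delta>) ds = walk t ds" if "0 \<le> \<delta>" "\<delta> \<le> \<beta> - \<alpha>" for t \<delta>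
    using 1[of "\<alpha> + \<delta>" "t - \<alpha>"] 1[of \<alpha> "t - \<alpha>"] that assms(3) by simp
  then show ?thesis
    by (rule locally_constant_imp_constant[of "\<beta> - \<alpha>" "\<lambda>t. walk t ds", rotated]) (use assms in auto)
qed

end

text \<open>
  The steps of 80, 60, 80, 60, 80 degrees in \<open>F\<close> close up and have odd winding, hence \<open>N + H = \<plusminus>9\<close>, and so either all steps
  of 80 degrees or all steps of 60 degrees turn the color in the same direction.  In the first
  case this extends to the steps of angle \<open>\<tau>\<close>, but 1300 of them close up after 289 turns.  In the
  second case a slightly larger circle must be colored like the unit circle, which then is
  locally constant.
\<close>

lemma no_three_coloring:
  assumes b: "sqrt (2 - 2 * sin (18 * pi / 325)) < b"
  shows "\<nexists>c. annulus_coloring b 3 c"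
proof
  assume "\<exists>c. annulus_coloring b 3 c"
  then obtain c where c: "annulus_coloring b 3 c" ..
  \<comment> \<open>The threshold is the chord of this angle, which exceeds 80 degrees by only \<pi>
    / 5850. Exactly 80 degrees would not serve below, as such steps close up after 9, a multiple of
    3; steps of angle \<open>\<tau>\<close> close up after 1300, which is not one.\<close>
  define \<tau> where "\<tau> = 289 * pi / 650"
  have "pi / 2 - \<tau> = 18 * pi / 325" by (simp add: \<tau>_def)
  then have "cos \<tau> = sin (18 * pi / 325)" using cos_sin_eq[of \<tau>] by (metis of_real_eq_id id_apply)
  then have b_\<tau>: "sqrt (2 - 2 * cos \<tau>) < b" using b by (simp only:)
  have "cos \<tau> \<le> 1" by simp
  then have "(sqrt (2 - 2 * cos \<tau>))\<^sup>2 \<le> b\<^sup>2" using b_\<tau> by (intro power_mono) auto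
  then have b2: "2 - 2 * cos \<tau> \<le> b\<^sup>2" using \<open>cos \<tau> \<le> 1\<close> by (simp only: real_sqrt_pow2)
  \<comment> \<open>Comparison with 72 degrees, whose cosine has a closed form, suffices for b \<ge>
    11 / 10; this makes room for the second circle used below.\<close>
  have "cos \<tau> < cos (2 * pi / 5)" unfolding \<tau>_def by (intro cos_monotone_0_pi) auto
  moreover have "cos (2 * pi / 5) = (sqrt 5 - 1) / 4"
  proof -
    define x where "x = cos (pi / 5)"
    have "cos (2 * pi / 5) = 2 * x\<^sup>2 - 1"
      unfolding x_def using cos_double_cos[of "pi / 5"] by (simp only: times_divide_eq_right)
    moreover have "4 * x\<^sup>2 - 2 * x - 1 = 0" unfolding x_def by (rule cos_pi_5)
    moreover have "x = (1 + sqrt 5) / 4" unfolding x_def by (rule cos_pi_5_eq)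
    ultimately show ?thesis by algebra
  qed
  moreover have "sqrt 5 \<le> 23 / 10" by (rule real_le_lsqrt) (simp_all add: power2_eq_square)
  ultimately have "cos \<tau> < 33 / 100" by simp
  then have "121 / 100 < b\<^sup>2" using b2 by linarith
  moreover have "0 < b" using b_\<tau> \<open>cos \<tau> \<le> 1\<close> real_sqrt_ge_zero[of "2 - 2 * cos \<tau>"] by linarith
  ultimately have b11: "11 / 10 \<le> b" by - (rule power2_le_imp_le, simp_all add: power2_eq_square)
  define g where "g t = c (pt 1 t)" for t
  interpret circle_three_coloring g "pi / 3" \<tau>
  proof
    show "g t < 3" for t
      unfolding g_def using b11 by (intro annulus_coloring_less[OF c]) auto
    show "g (t + 2 * pi) = g t" for t
      using pt_periodic[of 1 t 1] by (simp add: g_def)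
    show "g t \<noteq> g (t + d)" if "pi / 3 \<le> d" "d \<le> \<tau>" for t d
      unfolding g_def using b11 b2 that
      by (intro annulus_coloring_neq_unit[OF c, where \<alpha> = "pi / 3" and \<beta> = \<tau>])
        (auto simp: cos_60 \<tau>_def)
  qed
  have \<tau>: "4 * pi / 9 < \<tau>" "pi / 3 < \<tau>" by (simp_all add: \<tau>_def)
  \<comment> \<open>Nine steps of 80 degrees make two turns and six steps of 60 degrees make one;
    neither total depends on the start.\<close>
  define N where "N = walk 0 (replicate 9 (4 * pi / 9))"
  define H where "H = walk 0 (replicate 6 (pi / 3))"
  define F where "F = [4 * pi / 9, pi / 3, 4 * pi / 9, pi / 3, 4 * pi / 9]"
  have N: "walk t (replicate 9 (4 * pi / 9)) = N" for t
    unfolding N_def using \<tau> by (intro closed_walk_shift[where n = 2]) (auto simp: sum_list_replicate)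
  have H: "walk t (replicate 6 (pi / 3)) = H" for t
    unfolding H_def using \<tau> by (intro closed_walk_shift[where n = 1]) (auto simp: sum_list_replicate)
  have "N + H = walk 0 (replicate 9 (4 * pi / 9) @ replicate 6 (pi / 3))"
    by (simp only: walk_append N H)
  \<comment> \<open>Both walks consist of nine steps of 80 degrees and six of 60 degrees, in
    different orders.\<close>
  also have "\<dots> = walk 0 (F @ F @ F)"
    using \<tau> by (intro walk_mset) (auto simp: F_def numeral_eq_Suc)
  also have "\<dots> = 3 * walk 0 F"
  proof -
    have "sum_list F = 2 * pi" by (simp add: F_def)
    then show ?thesis
      using walk_periodic[of 0 1 F] walk_periodic[of 0 2 F] by (simp add: walk_append algebra_simps)
  qed
  finally have NHF: "N + H = 3 * walk 0 F" .
  have F: "3 dvd walk 0 F" "odd (walk 0 F)" "\<bar>walk 0 F\<bar> \<le> 5"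
    using closed_walk_mod_3[of F 1 0] walk_parity[of 0 F] walk_bound[of 0 F] \<tau>
    by (auto simp: F_def)
  have N': "\<bar>N\<bar> \<le> 9" using walk_bound[of 0 "replicate 9 (4 * pi / 9)"] by (simp add: N_def)
  have H': "3 dvd H" "even H" "\<bar>H\<bar> \<le> 6"
    using closed_walk_mod_3[of "replicate 6 (pi / 3)" 1 0] walk_parity[of 0 "replicate 6 (pi / 3)"]
      walk_bound[of 0 "replicate 6 (pi / 3)"] \<tau> by (auto simp: H_def sum_list_replicate)
  \<comment> \<open>An odd multiple of 3 of absolute value at most 5. Likewise \<open>H\<close> is
    an even multiple of 3 of absolute value at most 6. If \<open>H\<close> is nonzero, the first
    alternative below need not hold, but if it is 0 then \<open>N\<close> itself is 9 or -9.\<close>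
  have "walk 0 F = 3 \<or> walk 0 F = - 3" using F by presburger
  moreover have "H = 0 \<or> H = 6 \<or> H = - 6" using H' by presburger
  ultimately consider e where "N = e * 9" "e = 1 \<or> e = - 1" | e where "H = e * 6" "e = 1 \<or> e = - 1"
    using NHF N' by force
  then show False
  proof cases
    case 1
    have s: "step (g t) (g (t + 4 * pi / 9)) = e" for t
      using walk_extreme[of t "replicate 9 (4 * pi / 9)" e] N[of t] 1 by simp
    have "step (g t) (g (t + \<tau>)) = e" for t
    proof -
      \<comment> \<open>Two steps of 80 degrees add up to 2 e. Replacing them by two steps with the
        same sum of angles keeps this total, so each of the new steps is e as well.\<close>
      have "walk t [\<tau>, 8 * pi / 9 - \<tau>] = walk t [4 * pi / 9, 4 * pi / 9]"
        by (intro two_steps) (auto simp: \<tau>_def)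
      then show ?thesis
        using s[of t] s[of "t + 4 * pi / 9"] 1(2) step_cases[of "g t" "g (t + \<tau>)"]
          step_cases[of "g (t + \<tau>)" "g (t + \<tau> + (8 * pi / 9 - \<tau>))"] by auto
    qed
    then have "walk t (replicate n \<tau>) = e * int n" for t n
      by (induction n arbitrary: t) (auto simp: algebra_simps)
    moreover have "3 dvd walk 0 (replicate 1300 \<tau>)"
      using \<tau> by (intro closed_walk_mod_3[where n = 289]) (auto simp: sum_list_replicate \<tau>_def)
    ultimately show False using 1(2) by auto
  next
    case 2
    have s: "step (g t) (g (t + pi / 3)) = e" for t
      using walk_extreme[of t "replicate 6 (pi / 3)" e] H[of t] 2 by simp
    define q where "q t = c (pt (11 / 10) t)" for t
    \<comment> \<open>At this angle a point of the unit circle and one at radius 11 / 10 have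
      distance exactly 1. It is smaller than 60 degrees, so edges between the circles reach angles
      that no edge within the unit circle has.\<close>
    define \<gamma> where "\<gamma> = arccos (11 / 20)"
    have \<gamma>: "cos \<gamma> = 11 / 20" "0 \<le> \<gamma>" "\<gamma> \<le> pi" by (auto simp: \<gamma>_def intro: arccos_lbound arccos_ubound)
    then have "cos (pi / 3) < cos \<gamma>" by (simp add: cos_60)
    then have \<gamma>3: "\<gamma> < pi / 3" using \<gamma> by (subst (asm) cos_mono_less_eq) auto
    have gq: "g t \<noteq> q (t + d)" "q t \<noteq> g (t + d)" if "\<gamma> \<le> d" "d \<le> pi / 3" for t d
    proof -
      have "cos d \<le> cos \<gamma>" "cos (pi / 3) \<le> cos d" using that \<gamma> by (auto intro: cos_monotone_0_pi_le)
      then have "cos d \<le> 11 / 20" "1 / 2 \<le> cos d" using \<gamma> by (auto simp: cos_60)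
      then show "g t \<noteq> q (t + d)" "q t \<noteq> g (t + d)" unfolding g_def q_def using b11 \<open>121 / 100 < b\<^sup>2\<close>
        by (intro annulus_coloring_neq[OF c]; simp add: power2_eq_square)+
    qed
    have q3: "q t < 3" for t
      unfolding q_def using b11 by (intro annulus_coloring_less[OF c]) auto
    \<comment> \<open>The outer point at t + \<pi> / 3 can replace the middle point of two
      consecutive steps of 60 degrees. The total 2 e is preserved, so the first step is e, and this
      determines the color.\<close>
    have "q (t + pi / 3) = g (t + pi / 3)" for t
    proof -
      have "step (g t) (q (t + pi / 3)) + step (q (t + pi / 3)) (g (t + pi / 3 + pi / 3)) =
          step (g t) (g (t + pi / 3)) + step (g (t + pi / 3)) (g (t + pi / 3 + pi / 3))"
        using gq(1)[of "pi / 3" t] gq(2)[of "pi / 3" "t + pi / 3"]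
          g_neq[of "pi / 3" t] g_neq[of "pi / 3" "t + pi / 3"] \<gamma>3 \<tau>
        by (intro step_square g_less q3) auto
      then have "step (g t) (q (t + pi / 3)) = e"
        using s[of t] s[of "t + pi / 3"] 2(2) step_cases[of "g t" "q (t + pi / 3)"]
          step_cases[of "q (t + pi / 3)" "g (t + pi / 3 + pi / 3)"] by auto
      then show ?thesis
        using s[of t] 2(2) gq(1)[of "pi / 3" t] g_neq[of "pi / 3" t] \<gamma>3 \<tau> g_less[of t] q3[of "t + pi / 3"] g_less[of "t + pi / 3"]
        by (auto simp: step_def less_3_cases split: if_splits)
    qed
    from this[of "t - pi / 3" for t] have qg: "q t = g t" for t by simp
    \<comment> \<open>Both circles carry the same coloring, so the edges between them become edges
      of the unit circle, and 60 degrees is now an interior point of the range of edge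
      angles.\<close>
    have near: "g t \<noteq> g (t + d)" if "\<gamma> \<le> d" "d \<le> pi / 3" for t d
      using gq(1)[OF that] by (simp add: qg)
    define \<epsilon> where "\<epsilon> = min (pi / 3 - \<gamma>) (\<tau> - pi / 3)"
    have "g (t + \<delta>) = g t" if \<delta>: "0 \<le> \<delta>" "\<delta> \<le> \<epsilon>" for t \<delta>
    proof -
      \<comment> \<open>The points t and t + \<delta> are both neighbors of x and of x + 2 \<pi> /
        3. The walk through t + \<delta> has total 2 e, hence so has the one through t, and both
        points have the color that follows that of x in direction e.\<close>
      define x where "x = t + \<delta> - pi / 3"
      have n: "g x \<noteq> g t" "g x \<noteq> g (t + \<delta>)" "g t \<noteq> g (x + pi / 3 + pi / 3)" "g (t + \<delta>) \<noteq> g (x + pi / 3 + pi / 3)"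
        using near[of "pi / 3 - \<delta>" x] g_neq[of "pi / 3 + \<delta>" t] g_neq[of "pi / 3" x] g_neq[of "pi / 3" "t + \<delta>"] \<delta> \<tau>
        unfolding x_def \<epsilon>_def by (auto simp: algebra_simps)
      then have "step (g x) (g t) + step (g t) (g (x + pi / 3 + pi / 3)) =
          step (g x) (g (t + \<delta>)) + step (g (t + \<delta>)) (g (x + pi / 3 + pi / 3))"
        by (intro step_square g_less)
      moreover have "step (g x) (g (t + \<delta>)) = e" "step (g (t + \<delta>)) (g (x + pi / 3 + pi / 3)) = e"
        using s[of x] s[of "t + \<delta>"] by (auto simp: x_def algebra_simps)
      ultimately have "step (g x) (g t) = step (g x) (g (t + \<delta>))"
        using 2(2) step_cases[of "g x" "g t"] step_cases[of "g t" "g (x + pi / 3 + pi / 3)"] by auto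
      then show ?thesis
        using n g_less[of x] g_less[of t] g_less[of "t + \<delta>"]
        by (auto simp: step_def less_3_cases split: if_splits)
    qed
    then have "g 0 = g (pi / 3)"
      by (rule locally_constant_imp_constant[of \<epsilon>, rotated]) (use \<tau> \<gamma>3 in \<open>auto simp: \<epsilon>_def\<close>)
    then show False using g_neq[of "pi / 3" 0] \<tau> by simp
  qed
qed

section \<open>Refuting colorings of concentric circles\<close>

datatype tree = N nat int "tree list"

type_synonym vertex = "nat \<times> int"
type_synonym table = "(int \<times> int) list list"

text \<open>List access with a default, so that positions out of range mean the absence of
  constraints instead of an unspecified value.\<close>

fun lookup :: "'a \<Rightarrow> 'a list \<Rightarrow> nat \<Rightarrow> 'a" where
  "lookup z [] i = z"
| "lookup z (x # xs) 0 = x"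
| "lookup z (x # xs) (Suc i) = lookup z xs i"

text \<open>
  In the graphs below a vertex \<open>(i, a)\<close> is the point with index \<open>a\<close> among \<open>n\<close> equally spaced points
  on the \<open>i\<close>-th circle.  The entry \<open>(lo, hi)\<close> at position \<open>(i, j)\<close> of a table says that vertices on the
  circles \<open>i\<close> and \<open>j\<close> have different colors if their cyclic index distance lies in \<open>{lo..hi}\<close>;
  out of range it is the empty interval \<open>(1, 0)\<close>.
\<close>

definition entry :: "table \<Rightarrow> nat \<Rightarrow> nat \<Rightarrow> int \<times> int" where
  "entry tab i j = lookup (1, 0) (lookup [] tab i) j"

text \<open>
  The list \<open>\<sigma>\<close> of the color classes describes a partial coloring, and a tree \<open>N i a ts\<close> is a refutation
  that branches on the color of \<open>(i, a)\<close>, with one subtree for each color that is still possible.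
\<close>

fun blocked :: "int \<Rightarrow> (int \<times> int) list \<Rightarrow> int \<Rightarrow> vertex list \<Rightarrow> bool" where
  "blocked n intvs a [] = False"
| "blocked n intvs a ((j, x) # W) =
    ((case lookup (1, 0) intvs j of (lo, hi) \<Rightarrow>
        let d = \<bar>a - x\<bar> in
          if d < lo then False else if d \<le> hi then True else let e = n - d in lo \<le> e \<and> e \<le> hi) \<or>
     blocked n intvs a W)"

text \<open>The branches appear in the order of the color classes, blocked classes are omitted and
  at most one new class is opened. A refutation tree therefore needs no color numbers: its subtrees
  are matched with the branches by position.\<close>

fun extensions :: "int \<Rightarrow> (int \<times> int) list \<Rightarrow> vertex \<Rightarrow> vertex list list \<Rightarrow> vertex list list list" where
  "extensions n intvs v [] = []"
| "extensions n intvs v (W # Ws) =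
    (if W = [] then [[v] # Ws]
     else if blocked n intvs (snd v) W then map ((#) W) (extensions n intvs v Ws)
     else ((v # W) # Ws) # map ((#) W) (extensions n intvs v Ws))"

text \<open>A node without subtrees is accepted only if no color is left for its vertex, which
  closes the branch.\<close>

fun check :: "int \<Rightarrow> table \<Rightarrow> vertex list list \<Rightarrow> tree \<Rightarrow> bool"
  and checks :: "int \<Rightarrow> table \<Rightarrow> vertex list list list \<Rightarrow> tree list \<Rightarrow> bool" where
  "check n tab \<sigma> (N i a ts) = checks n tab (extensions n (lookup [] tab i) (i, a) \<sigma>) ts"
| "checks n tab [] ts = (ts = [])"
| "checks n tab (\<sigma> # \<sigma>s) [] = False"
| "checks n tab (\<sigma> # \<sigma>s) (t # ts) = (check n tab \<sigma> t \<and> checks n tab \<sigma>s ts)"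

text \<open>Each table entry stays an interval: a new distance is recorded only if it adjoins one of
  the ends and is dropped otherwise. Certificates therefore proceed outward from the initial
  interval.\<close>

definition widen :: "int \<Rightarrow> int \<times> int \<Rightarrow> int \<times> int" where
  "widen d p = (case p of (lo, hi) \<Rightarrow>
     if d = lo - 1 then (d, hi) else if d = hi + 1 then (lo, d) else (lo, hi))"

definition widen_at :: "int \<Rightarrow> nat \<Rightarrow> nat \<Rightarrow> table \<Rightarrow> table" where
  "widen_at d i j tab = tab[i := (lookup [] tab i)[j := widen d (entry tab i j)]]"

text \<open>The pair to be separated is put into one common class, and \<open>es\<close> supplies
  the remaining, empty classes. For i \<noteq> j the entry is widened at both transposed
  positions.\<close>

fun saturate :: "int \<Rightarrow> vertex list list \<Rightarrow> table \<Rightarrow> (nat \<times> nat \<times> int \<times> tree) list \<Rightarrow> table option" where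
  "saturate n es tab [] = Some tab"
| "saturate n es tab ((i, j, d, t) # ls) =
    (if check n tab ([(i, 0), (j, d)] # es) t
     then saturate n es (let tab' = widen_at d i j tab in if i = j then tab' else widen_at d j i tab') ls
     else None)"

text \<open>Positions are all integers with period n, so that rotations and reflections act as
  translations and sign changes without reduction modulo n. The color bound is demanded for every
  circle index, also beyond the table.\<close>

definition ring_coloring :: "int \<Rightarrow> nat \<Rightarrow> table \<Rightarrow> (nat \<Rightarrow> int \<Rightarrow> nat) \<Rightarrow> bool" where
  "ring_coloring n K tab f \<longleftrightarrow> (\<forall>i a. f i a < K) \<and> (\<forall>i a. f i (a + n) = f i a) \<and>
     (\<forall>i j a d. fst (entry tab i j) \<le> d \<longrightarrow> d \<le> snd (entry tab i j) \<longrightarrow>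
        f i a \<noteq> f j (a + d) \<and> f i a \<noteq> f j (a - d))"

lemma lookup_conv_nth: "lookup z xs i = (if i < length xs then xs ! i else z)"
  by (induction z xs i rule: lookup.induct) auto

lemma ring_coloringD:
  assumes "ring_coloring n K tab f"
  shows "f i a < K" "f i (a + n) = f i a"
    and "fst (entry tab i j) \<le> d \<Longrightarrow> d \<le> snd (entry tab i j) \<Longrightarrow> f i a \<noteq> f j (a + d)"
    and "fst (entry tab i j) \<le> d \<Longrightarrow> d \<le> snd (entry tab i j) \<Longrightarrow> f i a \<noteq> f j (a - d)"
  using assms unfolding ring_coloring_def by blast+

section \<open>Symmetries of ring colorings and soundness of the refutation trees\<close>

lemma ring_coloring_shift:
  assumes f: "ring_coloring n K tab f"
  shows "ring_coloring n K tab (\<lambda>i a. f i (a + s))"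
  unfolding ring_coloring_def
proof (intro conjI allI impI)
  fix i j a d
  show "f i (a + s) < K" by (rule ring_coloringD(1)[OF f])
  show "f i (a + n + s) = f i (a + s)" using ring_coloringD(2)[OF f, of i "a + s"] by (simp add: algebra_simps)
  assume d: "fst (entry tab i j) \<le> d" "d \<le> snd (entry tab i j)"
  show "f i (a + s) \<noteq> f j (a + d + s)" using ring_coloringD(3)[OF f d, of "a + s"] by (simp add: algebra_simps)
  show "f i (a + s) \<noteq> f j (a - d + s)" using ring_coloringD(4)[OF f d, of "a + s"] by (simp add: algebra_simps)
qed

lemma ring_coloring_reflect:
  assumes f: "ring_coloring n K tab f"
  shows "ring_coloring n K tab (\<lambda>i a. f i (s - a))"
  unfolding ring_coloring_def
proof (intro conjI allI impI)
  fix i j a d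
  show "f i (s - a) < K" by (rule ring_coloringD(1)[OF f])
  show "f i (s - (a + n)) = f i (s - a)" using ring_coloringD(2)[OF f, of i "s - a - n"] by (simp add: algebra_simps)
  assume d: "fst (entry tab i j) \<le> d" "d \<le> snd (entry tab i j)"
  show "f i (s - a) \<noteq> f j (s - (a + d))" using ring_coloringD(4)[OF f d, of "s - a"] by (simp add: algebra_simps)
  show "f i (s - a) \<noteq> f j (s - (a - d))" using ring_coloringD(3)[OF f d, of "s - a"] by (simp add: algebra_simps)
qed

lemma ring_coloring_transpose:
  assumes f: "ring_coloring n K tab f" and xy: "x < K" "y < K"
  shows "ring_coloring n K tab (\<lambda>i a. Transposition.transpose x y (f i a))"
  unfolding ring_coloring_def
proof (intro conjI allI impI)
  fix i j a d
  have "Transposition.transpose x y u < K" if "u < K" for u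
    using that xy by (simp add: Transposition.transpose_def)
  then show "Transposition.transpose x y (f i a) < K" using ring_coloringD(1)[OF f] .
  show "Transposition.transpose x y (f i (a + n)) = Transposition.transpose x y (f i a)"
    using ring_coloringD(2)[OF f] by simp
  have inj: "Transposition.transpose x y u \<noteq> Transposition.transpose x y v" if "u \<noteq> v" for u v
    using that by (metis transpose_involutory)
  assume "fst (entry tab i j) \<le> d" "d \<le> snd (entry tab i j)"
  note d = ring_coloringD(3,4)[OF f this]
  show "Transposition.transpose x y (f i a) \<noteq> Transposition.transpose x y (f j (a + d))"
    by (rule inj[OF d(1)])
  show "Transposition.transpose x y (f i a) \<noteq> Transposition.transpose x y (f j (a - d))"
    by (rule inj[OF d(2)])
qed

text \<open>Only a positive answer needs justification. If it is due to n - d, the interval is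
  reached across position 0, and periodicity in n moves the point back.\<close>

lemma blocked_sound:
  assumes f: "ring_coloring n K tab f"
    and b: "blocked n (lookup [] tab i) a W" and W: "\<forall>(j, x) \<in> set W. f j x = c"
  shows "f i a \<noteq> c"
  using b W
proof (induction W)
  case (Cons w W)
  obtain j x where w: "w = (j, x)" by force
  obtain lo hi where e: "entry tab i j = (lo, hi)" by force
  have neq: "f i a \<noteq> f j (a + d)" "f i a \<noteq> f j (a - d)" if "lo \<le> d" "d \<le> hi" for d
    using ring_coloringD(3,4)[OF f, of i j d a] that e by simp_all
  have per: "f j (y + n) = f j y" for y
    using f unfolding ring_coloring_def by blast
  define d where "d = \<bar>a - x\<bar>"
  show ?case
  proof (cases "blocked n (lookup [] tab i) a W")
    case True
    then show ?thesis using Cons by simp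
  next
    case False
    then have "lo \<le> d \<and> d \<le> hi \<or> lo \<le> n - d \<and> n - d \<le> hi"
      using Cons.prems(1) e by (auto simp: w d_def entry_def Let_def split: if_splits)
    then have "f i a \<noteq> f j x"
    proof
      assume "lo \<le> d \<and> d \<le> hi"
      then show ?thesis using neq[of d] by (auto simp: d_def abs_if split: if_splits)
    next
      assume d: "lo \<le> n - d \<and> n - d \<le> hi"
      show ?thesis
      proof (cases "a < x")
        case True
        then show ?thesis using neq(2)[of "n - d"] d per[of "a - (n - d)"] by (auto simp: d_def)
      next
        case False
        then show ?thesis using neq(1)[of "n - d"] d per[of x] by (auto simp: d_def add.commute)
      qed
    qed
    then show ?thesis using Cons.prems(2) w by auto
  qed
qed simp

text \<open>The recursion ends at the first empty class, so a color is reached only if all earlier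
  classes are in use.\<close>

lemma extensions_member:
  assumes "c < length \<sigma>" "\<forall>c' < c. \<sigma> ! c' \<noteq> []" "\<not> blocked n intvs (snd v) (\<sigma> ! c)"
  shows "\<sigma>[c := v # \<sigma> ! c] \<in> set (extensions n intvs v \<sigma>)"
  using assms
proof (induction \<sigma> arbitrary: c)
  case (Cons W Ws)
  show ?case
  proof (cases c)
    case (Suc c')
    then have "W \<noteq> []" using Cons.prems(2) by force
    moreover have "Ws[c' := v # Ws ! c'] \<in> set (extensions n intvs v Ws)"
      using Cons.prems Suc by (intro Cons.IH) auto
    ultimately show ?thesis using Suc by auto
  qed (use Cons.prems in auto)
qed simp

lemma checks_sound: "checks n tab \<sigma>s ts \<Longrightarrow> \<sigma> \<in> set \<sigma>s \<Longrightarrow> \<exists>t \<in> set ts. check n tab \<sigma> t"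
  by (induction \<sigma>s arbitrary: ts) (case_tac ts; auto)+

definition extends :: "(nat \<Rightarrow> int \<Rightarrow> nat) \<Rightarrow> vertex list list \<Rightarrow> bool" where
  "extends f \<sigma> \<longleftrightarrow> (\<forall>c < length \<sigma>. \<forall>(i, a) \<in> set (\<sigma> ! c). f i a = c)"

text \<open>
  In a partial coloring \<open>\<sigma>\<close> the unused colors come last, so that by symmetry it suffices
  to try the first of them for the next vertex.
\<close>

lemma check_sound:
  assumes "check n tab \<sigma> t" "ring_coloring n K tab f" "length \<sigma> = K"
    and "\<forall>c c'. c < c' \<longrightarrow> c' < K \<longrightarrow> \<sigma> ! c = [] \<longrightarrow> \<sigma> ! c' = []"
  shows "\<not> extends f \<sigma>"
  using assms
proof (induction t arbitrary: \<sigma> f)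
  case (N i a ts)
  let ?intvs = "lookup [] tab i"
  show ?case
  proof
    assume ext: "extends f \<sigma>"
    have fK: "f i a < K" using N.prems(2) by (auto simp: ring_coloring_def)
    \<comment> \<open>Stated for an arbitrary coloring \<open>g\<close>, since it is applied either
      to \<open>f\<close> itself or to \<open>f\<close> with two colors exchanged.\<close>
    have step: False
      if g: "ring_coloring n K tab g" "extends g \<sigma>"
        and new: "\<forall>c' < g i a. \<sigma> ! c' \<noteq> []" for g
    proof -
      define \<sigma>' where "\<sigma>' = \<sigma>[g i a := (i, a) # \<sigma> ! g i a]"
      have gK: "g i a < K" using g by (auto simp: ring_coloring_def)
      have gl: "g i a < length \<sigma>" using gK N.prems(3) by simp
      have "\<forall>(j, x) \<in> set (\<sigma> ! g i a). g j x = g i a" using g(2) gl unfolding extends_def by blast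
      then have "\<not> blocked n ?intvs a (\<sigma> ! g i a)" using blocked_sound[OF g(1)] by blast
      then have "\<sigma>' \<in> set (extensions n ?intvs (i, a) \<sigma>)"
        unfolding \<sigma>'_def using gl new by (intro extensions_member) simp_all
      then obtain t where t: "t \<in> set ts" "check n tab \<sigma>' t"
        using checks_sound[of n tab "extensions n ?intvs (i, a) \<sigma>" ts] N.prems(1) by auto
      have "\<forall>(j, x) \<in> set (\<sigma>' ! c). g j x = c" if "c < length \<sigma>'" for c
      proof -
        have "\<forall>(j, x) \<in> set (\<sigma> ! c). g j x = c"
          using g(2) that unfolding extends_def \<sigma>'_def length_list_update by blast
        then show ?thesis using gl by (cases "c = g i a") (simp_all add: \<sigma>'_def)
      qed
      then have ext': "extends g \<sigma>'" unfolding extends_def by blast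
      have "\<sigma>' ! c' = []" if c: "c < c'" "c' < K" "\<sigma>' ! c = []" for c c'
      proof -
        have "c \<noteq> g i a" using c(3) gl by (auto simp: \<sigma>'_def)
        then have "\<sigma> ! c = []" using c(3) by (simp add: \<sigma>'_def)
        then have "\<not> c < g i a" using new by blast
        then have "g i a < c" using \<open>c \<noteq> g i a\<close> by simp
        moreover have "\<sigma> ! c' = []" by (rule N.prems(4)[rule_format, OF c(1,2) \<open>\<sigma> ! c = []\<close>])
        ultimately show ?thesis using c(1) by (simp add: \<sigma>'_def)
      qed
      then have inv: "\<forall>c c'. c < c' \<longrightarrow> c' < K \<longrightarrow> \<sigma>' ! c = [] \<longrightarrow> \<sigma>' ! c' = []" by blast
      have "length \<sigma>' = K" using N.prems(3) by (simp add: \<sigma>'_def)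
      then show False using N.IH[OF t(1,2) g(1) _ inv] ext' by blast
    qed
    show False
    proof (cases "\<forall>c' < f i a. \<sigma> ! c' \<noteq> []")
      case True
      then show ?thesis by (rule step[OF N.prems(2) ext])
    next
      case False
      then obtain c0 where c0: "c0 < f i a" "\<sigma> ! c0 = []" by blast
      then obtain c where c: "\<sigma> ! c = []" "\<forall>c' < c. \<sigma> ! c' \<noteq> []"
        using exists_least_iff[of "\<lambda>c. \<sigma> ! c = []"] by blast
      have "c \<le> c0" using c(2) c0(2) by (meson not_le)
      then have cf: "c < f i a" using c0(1) by simp
      let ?g = "\<lambda>j x. Transposition.transpose c (f i a) (f j x)"
      have empty: "\<sigma> ! f i a = []" by (rule N.prems(4)[rule_format, OF cf fK c(1)])
      have "extends ?g \<sigma>"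
        unfolding extends_def
      proof (intro allI impI ballI, clarify)
        fix c' j x assume c': "c' < length \<sigma>" "(j, x) \<in> set (\<sigma> ! c')"
        then have "f j x = c'" using ext by (auto simp: extends_def)
        moreover have "c' \<noteq> c" "c' \<noteq> f i a" using c'(2) c(1) empty by auto
        ultimately show "Transposition.transpose c (f i a) (f j x) = c'" by simp
      qed
      moreover have "ring_coloring n K tab ?g"
        using N.prems(2) cf fK by (intro ring_coloring_transpose) auto
      ultimately show ?thesis using step[of ?g] c(2) by simp
    qed
  qed
qed

lemma check_empty_sound:
  assumes "check n tab (replicate K []) t"
  shows "\<not> ring_coloring n K tab f"
  using check_sound[OF assms] by (auto simp: extends_def)

text \<open>The certificate treats positions 0 and d sharing color 0. Exchanging two colors covers
  any common color, rotation any position a, and reflection the distance -d.\<close>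

lemma check_pair_sound:
  assumes ch: "check n tab ([(i, 0), (j, d)] # replicate k []) t" and f: "ring_coloring n (Suc k) tab f"
  shows "f i a \<noteq> f j (a + d)" "f i a \<noteq> f j (a - d)"
proof -
  have *: "g i 0 \<noteq> g j d" if g: "ring_coloring n (Suc k) tab g" for g
  proof
    assume eq: "g i 0 = g j d"
    let ?g = "\<lambda>l x. Transposition.transpose 0 (g i 0) (g l x)"
    have "ring_coloring n (Suc k) tab ?g"
      using g by (intro ring_coloring_transpose) (auto simp: ring_coloring_def)
    then have "\<not> extends ?g ([(i, 0), (j, d)] # replicate k [])"
      using check_sound[OF ch] by (simp add: nth_Cons split: nat.splits)
    then show False using eq by (auto simp: extends_def less_Suc_eq_0_disj)
  qed
  show "f i a \<noteq> f j (a + d)" using *[OF ring_coloring_shift[OF f, of a]] by (simp add: add.commute)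
  show "f i a \<noteq> f j (a - d)" using *[OF ring_coloring_reflect[OF f, of a]] by simp
qed

lemma entry_widen_at:
  "entry (widen_at d i j tab) i' j' =
     (if i' = i \<and> j' = j \<and> i < length tab \<and> j < length (tab ! i) then widen d (entry tab i j) else entry tab i' j')"
  by (auto simp: widen_at_def entry_def lookup_conv_nth nth_list_update)

lemma widen_bounds:
  "fst (widen d p) \<le> e \<Longrightarrow> e \<le> snd (widen d p) \<Longrightarrow> e = d \<or> fst p \<le> e \<and> e \<le> snd p"
  by (cases p) (auto simp: widen_def split: if_splits)

lemma ring_coloring_widen_at:
  assumes f: "ring_coloring n K tab f" and d: "\<And>a. f i a \<noteq> f j (a + d) \<and> f i a \<noteq> f j (a - d)"
  shows "ring_coloring n K (widen_at d i j tab) f"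
  unfolding ring_coloring_def
proof (intro conjI allI impI)
  fix i' j' a e
  show "f i' a < K" "f i' (a + n) = f i' a" by (rule ring_coloringD[OF f])+
  assume e: "fst (entry (widen_at d i j tab) i' j') \<le> e" "e \<le> snd (entry (widen_at d i j tab) i' j')"
  have "i' = i \<and> j' = j \<and> e = d \<or> fst (entry tab i' j') \<le> e \<and> e \<le> snd (entry tab i' j')"
    using e widen_bounds[of d "entry tab i j" e] by (auto simp: entry_widen_at split: if_splits)
  then show "f i' a \<noteq> f j' (a + e)" "f i' a \<noteq> f j' (a - e)"
    using d ring_coloringD(3,4)[OF f] by blast+
qed

lemma saturate_sound:
  assumes "saturate n (replicate k []) tab ls = Some tab'" "ring_coloring n (Suc k) tab f"
  shows "ring_coloring n (Suc k) tab' f"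
  using assms
proof (induction ls arbitrary: tab)
  case (Cons l ls)
  obtain i j d t where l: "l = (i, j, d, t)" by (metis prod_cases4)
  have ch: "check n tab ([(i, 0), (j, d)] # replicate k []) t"
    using Cons.prems(1) by (auto simp: l split: if_splits)
  note ij = check_pair_sound[OF ch Cons.prems(2)]
  have ji: "f j a \<noteq> f i (a + d) \<and> f j a \<noteq> f i (a - d)" for a
    using ij(2)[of "a + d"] ij(1)[of "a - d"] by auto
  have 1: "ring_coloring n (Suc k) (widen_at d i j tab) f"
    using Cons.prems(2) ij by (intro ring_coloring_widen_at) blast+
  then have "ring_coloring n (Suc k) (widen_at d j i (widen_at d i j tab)) f"
    using ji by (rule ring_coloring_widen_at)
  then show ?case
    using Cons.IH Cons.prems(1) ch 1 by (auto simp: l Let_def split: if_splits)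
qed simp

text \<open>For fixed radii the distance increases with the angle on [0, \<pi>], and 2 hi \<le> n
  keeps all angles in that range; so testing the lower end against 1 and the upper end against b
  covers the whole interval. Circle indices out of range get the dummy color 0.\<close>

lemma ring_coloring_of_annulus:
  fixes n :: int and R :: "real list"
  defines "dist2 i j d \<equiv> (R ! i)\<^sup>2 + (R ! j)\<^sup>2 - 2 * R ! i * R ! j * cos (2 * pi * real_of_int d / n)"
  assumes c: "annulus_coloring b K c" and K: "0 < K" and n: "0 < n"
    and R: "\<forall>r \<in> set R. 1 \<le> r \<and> r \<le> b"
    and tab: "length tab = length R" "\<forall>es \<in> set tab. length es = length R"
    and bounds: "\<And>i j. i < length R \<Longrightarrow> j < length R \<Longrightarrow>
      (case tab ! i ! j of (lo, hi) \<Rightarrow> 0 \<le> lo \<and> 2 * hi \<le> n \<and> 1 \<le> dist2 i j lo \<and> dist2 i j hi \<le> b\<^sup>2)"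
  shows "ring_coloring n K tab (\<lambda>i a. if i < length R then c (pt (R ! i) (2 * pi * real_of_int a / n)) else 0)"
    (is "ring_coloring n K tab ?f")
  unfolding ring_coloring_def
proof (intro conjI allI impI)
  fix i j a d
  have R': "1 \<le> R ! i" "R ! i \<le> b" if "i < length R" for i using R that by simp_all
  show "?f i a < K"
    using annulus_coloring_less[OF c R'] K by simp
  have "2 * pi * real_of_int (a + n) / n = 2 * pi * real_of_int a / n + 2 * pi * real_of_int 1"
    using n by (simp add: field_simps)
  then show "?f i (a + n) = ?f i a" by (simp only: pt_periodic)
  assume d: "fst (entry tab i j) \<le> d" "d \<le> snd (entry tab i j)"
  then have ij: "i < length R" "j < length R"
    using tab by (auto simp: entry_def lookup_conv_nth split: if_splits)
  then have "j < length (tab ! i)" using tab by simp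
  then have e: "entry tab i j = tab ! i ! j" using ij tab by (simp add: entry_def lookup_conv_nth)
  obtain lo hi where lh: "tab ! i ! j = (lo, hi)" by force
  have b: "0 \<le> lo" "2 * hi \<le> n" "1 \<le> dist2 i j lo" "dist2 i j hi \<le> b\<^sup>2"
    using bounds[OF ij] lh by auto
  have d': "lo \<le> d" "d \<le> hi" using d e lh by auto
  define \<theta> where "\<theta> x = 2 * pi * real_of_int x / n" for x
  have mono: "\<theta> x \<le> \<theta> y" if "x \<le> y" for x y
    using that n by (simp add: \<theta>_def divide_right_mono mult_left_mono)
  have "0 \<le> \<theta> lo" using b(1) n by (simp add: \<theta>_def)
  moreover have "2 * real_of_int hi \<le> real_of_int n" using b(2) by linarith
  then have "\<theta> hi \<le> pi" using n mult_left_mono[of "2 * real_of_int hi" "real_of_int n" pi]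
    by (simp add: \<theta>_def pos_divide_le_eq mult.commute mult.left_commute)
  ultimately have cos: "cos (\<theta> d) \<le> cos (\<theta> lo)" "cos (\<theta> hi) \<le> cos (\<theta> d)"
    using mono[OF d'(1)] mono[OF d'(2)] by (auto intro!: cos_monotone_0_pi_le)
  have "0 \<le> 2 * R ! i * R ! j" using R'(1)[OF ij(1)] R'(1)[OF ij(2)] by simp
  from mult_left_mono[OF cos(1) this] mult_left_mono[OF cos(2) this]
  have dist: "1 \<le> (R ! i)\<^sup>2 + (R ! j)\<^sup>2 - 2 * R ! i * R ! j * cos (\<theta> d)"
    "(R ! i)\<^sup>2 + (R ! j)\<^sup>2 - 2 * R ! i * R ! j * cos (\<theta> d) \<le> b\<^sup>2"
    using b(3,4) unfolding dist2_def \<theta>_def by linarith+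
  have neq: "c (pt (R ! i) (\<theta> x)) \<noteq> c (pt (R ! j) (\<theta> y))" if "cos (\<theta> x - \<theta> y) = cos (\<theta> d)" for x y
    by (rule annulus_coloring_neq[OF c R'[OF ij(1)] R'[OF ij(2)]]) (use dist that in simp_all)
  have diff: "\<theta> a - \<theta> (a + d) = - \<theta> d" "\<theta> a - \<theta> (a - d) = \<theta> d"
    using n by (simp_all add: \<theta>_def field_simps)
  show "?f i a \<noteq> ?f j (a + d)" "?f i a \<noteq> ?f j (a - d)"
    using neq[of a "a + d"] neq[of a "a - d"] diff ij unfolding \<theta>_def[symmetric] by simp_all
qed

section \<open>Rational bounds for cosines\<close>

text \<open>The Taylor polynomial of the cosine in the variable \<open>y = x\<^sup>2\<close>.\<close>

definition cos_poly :: "real \<Rightarrow> real" where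
  "cos_poly y = 1 - y / 2 * (1 - y / 12 * (1 - y / 30 * (1 - y / 56 * (1 - y / 90 *
     (1 - y / 132 * (1 - y / 182))))))"

text \<open>The denominator is 16!, from the Lagrange remainder of the Maclaurin expansion with 16
  terms.\<close>

lemma cos_approx: "\<bar>cos x - cos_poly (x\<^sup>2)\<bar> \<le> (x\<^sup>2) ^ 8 / 20922789888000"
proof -
  obtain t where t: "cos x = (\<Sum>m<16. cos_coeff m * x ^ m) + cos (t + 1 / 2 * real 16 * pi) / fact 16 * x ^ 16"
    using Maclaurin_cos_expansion[of x 16] by blast
  have "(\<Sum>m<16. cos_coeff m * x ^ m) = 1 - x ^ 2 / 2 + x ^ 4 / 24 - x ^ 6 / 720 + x ^ 8 / 40320
      - x ^ 10 / 3628800 + x ^ 12 / 479001600 - x ^ 14 / 87178291200"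
    by (simp add: cos_coeff_def lessThan_nat_numeral fact_numeral)
  also have "\<dots> = cos_poly (x\<^sup>2)"
    by (simp add: cos_poly_def algebra_simps flip: power_mult power_add)
  finally have "(\<Sum>m<16. cos_coeff m * x ^ m) = cos_poly (x\<^sup>2)" .
  moreover have "\<bar>cos (t + 1 / 2 * real 16 * pi) / fact 16 * x ^ 16\<bar> \<le> 1 / fact 16 * x ^ 16"
  proof -
    have "\<bar>cos (t + 1 / 2 * real 16 * pi)\<bar> / fact 16 \<le> 1 / (fact 16 :: real)"
      by (intro divide_right_mono abs_cos_le_one) simp
    then show ?thesis unfolding abs_mult abs_divide by (intro mult_mono) auto
  qed
  ultimately show ?thesis unfolding t by (simp add: fact_numeral flip: power_mult)
qed

text \<open>Here y is a rational lower bound of the squared angle, obtained from 3.14159 \<le>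
  \<pi>; as the cosine decreases up to \<pi>, its value at sqrt y is an upper bound. Working with y
  avoids square roots in the numerical check.\<close>

lemma cos_2pi_le:
  fixes d n :: int
  assumes n: "0 \<le> d" "2 * d \<le> n" "0 < n"
    and y: "0 \<le> y" "y \<le> (314159 / 50000 * d / n)\<^sup>2" "cos_poly y + y ^ 8 / 20922789888000 \<le> u"
  shows "cos (2 * pi * d / n) \<le> u"
proof -
  have "sqrt y \<le> 314159 / 50000 * d / n" using y n by (intro real_le_lsqrt) auto
  also have "\<dots> \<le> 2 * pi * d / n"
    using n pi_approx by (intro divide_right_mono mult_right_mono) auto
  finally have "sqrt y \<le> 2 * pi * d / n" .
  moreover have "2 * real_of_int d \<le> real_of_int n" using n by linarith
  then have "2 * pi * d / n \<le> pi" using n by (simp add: pos_divide_le_eq)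
  ultimately have "cos (2 * pi * d / n) \<le> cos (sqrt y)"
    using y by (intro cos_monotone_0_pi_le) auto
  moreover have "\<bar>cos (sqrt y) - cos_poly y\<bar> \<le> y ^ 8 / 20922789888000"
    using cos_approx[of "sqrt y"] y(1) by (simp only: real_sqrt_pow2)
  ultimately show ?thesis using y(3) by linarith
qed

text \<open>The counterpart with \<pi> \<le> 3.1416 and an upper bound y of the squared angle. The
  condition y \<le> 9.86 keeps sqrt y below 3.14159, in the range where the cosine
  decreases.\<close>

lemma cos_2pi_ge:
  fixes d n :: int
  assumes n: "0 \<le> d" "0 < n"
    and y: "(3927 / 625 * d / n)\<^sup>2 \<le> y" "y \<le> 986 / 100" "l \<le> cos_poly y - y ^ 8 / 20922789888000"
  shows "l \<le> cos (2 * pi * d / n)"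
proof -
  have "2 * pi * d / n \<le> 3927 / 625 * d / n"
    using n pi_approx by (intro divide_right_mono mult_right_mono) auto
  also have "\<dots> \<le> sqrt y" using y by (intro real_le_rsqrt)
  finally have "2 * pi * d / n \<le> sqrt y" .
  moreover have "sqrt y \<le> 314159 / 100000"
    using y by (intro real_le_lsqrt) (auto simp: power2_eq_square intro: order_trans[of _ y])
  then have "sqrt y \<le> pi" using pi_approx(1) by simp
  ultimately have "cos (sqrt y) \<le> cos (2 * pi * d / n)"
    using n by (intro cos_monotone_0_pi_le) auto
  moreover have "0 \<le> y" using y(1) by (rule order_trans[rotated]) simp
  then have "\<bar>cos (sqrt y) - cos_poly y\<bar> \<le> y ^ 8 / 20922789888000"
    using cos_approx[of "sqrt y"] by (simp only: real_sqrt_pow2)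
  ultimately show ?thesis using y(3) by linarith
qed

text \<open>An angle of 60 degrees on the unit circle gives distance exactly 1, where no
  approximation is good enough.\<close>

lemma cos_2pi_div_6:
  fixes d n :: int
  assumes "n = 6 * d" "d \<noteq> 0"
  shows "cos (2 * pi * d / n) = 1 / 2"
proof -
  have "2 * pi * d / n = pi / 3" using assms by simp
  then show ?thesis by (simp only: cos_60)
qed

section \<open>Colorings with four, five or six colors\<close>

text \<open>
  The certificates \<open>saturate_*\<close> and \<open>check_*\<close> were found by a computer search over the number \<open>n\<close> of
  points, the radii and the branching order.
\<close>

lemma saturate_five_1:
  "saturate 190 (replicate 3 [])
    [[(32, 50), (23, 37)], [(23, 37), (21, 31)]]
    [(0, 0, 31, N 0 140 [N 0 173 [N 0 33 [N 1 8 [N 1 167 [N 1 5 [N 1 166 [N 1 187 [N 1 163 [N 0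
    189 [N 0 175 [N 0 35 [N 0 32 [N 1 185 [N 1 23 [N 0 49 [N 0 81 [N 1 58 [N 1 37 [N 1 16 [N 1
    177 [N 1 156 [N 0 131 [N 1 108 [N 0 80 [N 1 103 [N 0 67 [N 0 99 []]]]]]]]]]]]], N 0 183 [N
    0 179 [N 1 12 [N 1 177 [N 1 156 [N 0 133 [N 0 49 [N 1 26 [N 1 57 [N 0 94 [N 1 68 [N 0 101
    [N 1 78 [N 0 105 [N 0 73 [N 1 110 [N 0 80 []]]]]]]]]]]]]]]]]]]]]]]]]]]]], N 1 8 [N 0 32 [N
    0 172 [N 1 5 [N 0 189 [N 1 166 [N 0 143 [N 1 163 [N 1 36 [N 1 26 [N 0 49 [N 1 25 [N 0 48 [N
    1 11 [N 0 80 [N 1 56 [N 0 79 [N 1 23 [N 1 15 [N 1 46 [N 1 68 [N 1 39 [N 0 16 [N 1 44 [N 1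
    65 [N 0 81 [N 1 58 [N 0 45 [N 0 95 [N 1 118 [N 1 89 [N 1 117 [N 1 86 [N 0 111 [N 0 161 [N 1
    132 [N 0 155 []]]]]]]]]]]]]]]]]]]]]]]]]]]]]]]]]]]]]]]]),
    (0, 1, 38, N 1 166 [N 0 141 [N 0 1 [N 1 167 [N 0 144 [N 0 4 [N 1 164 [N 0 14 [N 1 37 [N 0
    64 [N 0 63 [N 0 13 [N 1 36 [N 0 153 [N 0 110 [N 0 60 [N 0 12 [N 0 152 [N 0 102 [N 0 59 [N 0
    9 [N 1 34 [N 0 57 [N 0 8 [N 1 31 [N 0 54 []]]]]]]]]]]]]]]]]], N 0 32 [N 0 173 [N 0 64 [N 1
    37 [N 0 62 [N 1 26 [N 0 50 [N 1 24 [N 0 33 [N 0 127 [N 1 156 [N 0 159 [N 0 19 [N 0 69 [N 1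
    46 [N 0 83 [N 0 126 [N 0 76 [N 0 31 [N 0 171 [N 0 121 [N 0 75 [N 0 25 [N 0 170 [N 0 120 [N
    0 70 [N 0 24 [N 0 164 [N 0 119 []]]]]]]]]]]]]]]]]]], N 0 83 [N 1 51 [N 0 77 [N 1 45 [N 0 73
    [N 1 110 [N 0 147 [N 0 116 [N 1 153 [N 0 123 [N 1 100 []]]]]]]]]]]]]]]]]]]], N 0 64 [N 1 37
    [N 0 62 [N 1 26 [N 0 50 [N 1 24 [N 0 47 [N 0 33 [N 1 69 [N 1 48 [N 1 70 [N 0 96 [N 0 95 [N
    0 83 [N 1 120 [N 0 157 [N 0 126 [N 1 163 [N 0 127 []]]]]]]]]], N 0 106 [N 1 70 [N 0 92 [N 0
    127 [N 1 101 [N 0 78 [N 1 115 [N 0 152 [N 0 114 [N 1 91 []]]]]], N 0 83 [N 1 51 [N 0 77 [N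
    1 45 [N 0 73 [N 0 108 []]]]]]]]]]]]]]]]]]]]]]]]]]]]),
    (0, 1, 39, N 0 62 [N 0 12 [N 1 38 [N 0 15 [N 0 65 [N 0 1 [N 1 167 [N 0 144 [N 0 4 [N 0 159
    [N 0 111 [N 0 61 [N 0 11 [N 1 34 [N 0 151 [N 0 108 [N 0 60 [N 0 10 [N 0 150 [N 0 100 [N 0
    57 [N 0 9 [N 1 32 [N 0 55 [N 0 6 [N 1 31 [N 0 54 []]]]]]]]]]]]]]]]]]]]], N 1 32 [N 1 27 [N
    0 50 [N 1 17 [N 1 26 [N 0 49 [N 1 24 [N 0 47 [N 0 34 [N 1 70 [N 0 83 [N 1 53 [N 0 77 [N 0
    115 [N 1 153 [N 0 127 [N 1 103 [N 0 80 [N 0 130 [N 1 107 [N 0 145 [N 0 114 []]]]]]]]]]], N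
    0 114 [N 1 91 [N 0 115 [N 1 92 [N 0 84 [N 1 61 [N 0 38 [N 1 76 [N 0 78 [N 0 176 [N 0 130 [N
    1 167 [N 0 144 [N 1 121 [N 0 98 [N 0 148 [N 1 122 [N 0 99 [N 0 149 [N 0 118 [N 0 168 [N 0
    28 []]]]]]]]]]]], N 0 145 [N 0 103 [N 0 134 [N 1 103 [N 0 126 []]]]]]]]]]]]]], N 1 91 [N 0
    115 [N 1 92 [N 1 153 [N 0 130 [N 1 167 [N 0 144 [N 1 121 [N 0 145
    []]]]]]]]]]]]]]]]]]]]]]]]]]]),
    (0, 0, 30, N 0 46 [N 0 78 [N 0 32 [N 1 55 [N 0 31 [N 1 54 [N 1 23 [N 0 189 [N 0 49 [N 1 26
    [N 1 5 [N 0 172 [N 1 7 [N 0 174 []]]]]]]]]]], N 1 7 [N 0 174 [N 1 69 [N 0 189 [N 1 151 [N 0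
    128 [N 0 96 [N 0 140 []]]]]]]]]]])] =
   Some
    [[(30, 50), (23, 39)], [(23, 39), (21, 31)]]"
  by code_simp

text \<open>The word \<open>five\<close> counts the colors shown to be necessary, so four are
  refuted: the class of the identified pair and the three empty ones of
  \<open>replicate 3 []\<close>. The initial table is the one produced by
  \<open>saturate_five_1\<close>, so the pairs separated there are available here.\<close>

lemma saturate_five_2:
  "saturate 190 (replicate 3 [])
    [[(30, 50), (23, 39)], [(23, 39), (21, 31)]]
    [(0, 0, 29, N 0 141 [N 0 176 [N 0 30 [N 0 78 [N 1 55 [N 1 25 [N 1 52 [N 1 23 [N 0 47 [N 0
    189 [N 1 166 [N 1 6 [N 0 173 [N 0 33 [N 1 10 [N 1 175 [N 1 154 [N 0 131 [N 1 108 [N 0 71 [N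
    0 101 [N 1 68 [N 0 91 []]]]]]]]]]]]]]]]]]], N 1 55 [N 0 127 [N 1 104 [N 0 67 [N 0 97 [N 1
    68 [N 0 91 []]]]], N 1 153 [N 1 184 [N 1 163 [N 1 4 [N 1 167 [N 1 6 [N 1 175 [N 1 150 [N 0
    173 []]]]]]]]]]]], N 0 189 [N 1 166 [N 0 143 [N 0 173 [N 1 6 [N 0 159 [N 0 157 [N 0 45 [N 0
    172 [N 1 5 [N 1 26 [N 0 49 [N 1 25 [N 0 48 [N 0 78 [N 1 54 [N 0 77 [N 0 107 [N 1 72 [N 0 95
    [N 1 120 [N 0 94 [N 1 117 [N 0 156 []]]]]]]]]]]]]]]]]]]]]]]]]]]),
    (0, 1, 40, N 1 166 [N 0 1 [N 0 143 [N 1 167 [N 0 144 [N 0 4 [N 0 50 [N 1 27 [N 1 25 [N 0 48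
    [N 1 24 [N 0 47 [N 0 94 [N 0 54 [N 1 31 [N 0 8 [N 0 58 [N 1 35 [N 0 12 [N 0 62 [N 1 39 [N 1
    70 [N 0 109 [N 0 16 [N 0 66 [N 0 37 [N 1 76 [N 1 105 [N 0 82 [N 1 121 [N 1 152 [N 0 129
    []]]]]]]]]]]]]]]]]]], N 1 71 [N 0 46 [N 1 69 [N 1 39 [N 0 63 []]]]]]]]]]], N 1 27 [N 1 26
    [N 0 49 [N 1 24 [N 0 16 [N 1 183 [N 0 66 [N 1 39 [N 0 78 [N 0 29 [N 0 174 [N 0 79 [N 0 129
    [N 1 163 [N 0 124 [N 0 75 [N 0 26 [N 0 166 [N 0 116 [N 0 158 []]]]]]]]]]]]]]]]]]]]]]]]]]]),
    (1, 1, 32, N 0 182 [N 0 150 [N 0 5 [N 0 55 [N 1 31 [N 0 8 [N 0 58 [N 0 29 [N 0 27 [N 0 167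
    [N 1 10 [N 1 179 [N 1 17 [N 1 176 [N 0 138 [N 1 174 [N 0 134 [N 0 40 [N 1 63 [N 1 94 [N 1
    69 [N 1 98 [N 0 75 [N 1 115 []]]]]]]]]]]]]]]]]]]], N 1 31 [N 1 28 [N 0 26 [N 0 166 [N 1 10
    [N 0 167 [N 0 9 [N 0 59 [N 0 72 [N 0 121 [N 1 98 [N 0 138 [N 0 101 []]]], N 1 49 [N 1 20 [N
    1 41 [N 1 17 [N 0 40 []]]]]]]]]]]]]]], N 1 159 [N 1 31 [N 0 55 [N 0 9 [N 0 59 [N 1 28 [N 0
    40 [N 0 109 [N 1 80 [N 1 57 [N 0 80 [N 1 56 [N 1 77 [N 0 102 [N 0 54 [N 0 4 [N 0 144 [N 1
    169 [N 1 138 [N 0 99 [N 0 129 []]]]]]]]]]]]], N 1 80 [N 1 49 [N 0 72 []]]]]]]]]]]]]]),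
    (0, 1, 41, N 0 64 [N 0 15 [N 1 40 [N 0 17 [N 0 67 [N 0 48 [N 1 19 [N 1 15 [N 0 38 [N 0 81
    [N 0 31 [N 1 71 [N 0 7 [N 0 4 [N 0 1 [N 1 24 [N 0 47 [N 0 76 [N 0 141 [N 1 181 [N 0 26 [N 1
    167 [N 0 181 [N 0 131 [N 1 157 [N 0 117 [N 0 166 []]]]]]]], N 1 104 [N 1 167 [N 0 144 [N 0
    115 [N 1 92 [N 0 127 []]]]]]]]]]]]]]]]]]], N 1 25 [N 0 2 [N 1 167 [N 0 144 [N 0 98 [N 0 63
    [N 0 13 [N 1 36 [N 0 59 [N 0 12 [N 1 35 [N 0 58 [N 0 8 [N 1 34 [N 0 57 [N 0 7 [N 1 30 [N 0
    56 [N 0 6 [N 1 29 [N 0 52 []]]]]]]]]]]]]]]]]]]]]]]]]]]),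
    (0, 0, 28, N 0 46 [N 0 189 [N 1 23 [N 0 49 [N 1 26 [N 1 5 [N 0 172 [N 1 149 [N 0 142 [N 0
    32 [N 1 69 [N 0 99 [N 1 73 [N 1 51 [N 0 74 [N 0 124 [N 0 92 []]]]]]]]]]]]]]]]]),
    (0, 1, 42, N 0 143 [N 0 1 [N 1 167 [N 0 144 [N 0 141 [N 1 27 [N 0 50 [N 1 24 [N 0 47 [N 0
    65 [N 0 19 [N 0 162 [N 0 115 [N 1 91 [N 0 18 [N 1 41 [N 1 69 [N 0 92 [N 1 62 [N 0 91 [N 0
    119 [N 0 69 []]]]]]]]]]]], N 1 41 [N 1 73 [N 1 105 [N 0 114 [N 1 70 [N 1 91 [N 0 132 [N 0
    82 []]]]]]]]]]]], N 0 50 [N 0 18 [N 0 180 [N 0 68 [N 1 41 [N 1 73 [N 0 82 [N 0 132 [N 1 163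
    [N 1 159 [N 0 118 [N 1 95 [N 1 121 [N 0 98 [N 0 148 [N 1 123 [N 0 100 [N 0 150 [N 0 122 [N
    0 172 [N 0 29 []]]]]]]]]]]]]]]]]]]]]]]]]]]),
    (0, 0, 27, N 1 2 [N 1 23 [N 0 171 [N 0 28 [N 1 4 [N 0 168 []], N 1 4 [N 0 168 []]], N 0 31
    [N 1 4 [N 0 46 [N 1 69 [N 0 189 [N 1 148 [N 0 143 [N 0 96 [N 1 73 [N 1 50 [N 0 73 [N 0 123
    [N 0 93 []]]]]]]]]]]]]]]])] =
   Some
    [[(27, 50), (23, 42)], [(23, 42), (21, 32)]]"
  by code_simp

text \<open>The interval of the unit circle now also grows at its upper end: distance 51 is
  separated although its chord exceeds the threshold, which is the chord of 50.\<close>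

lemma saturate_five_3:
  "saturate 190 (replicate 3 [])
    [[(27, 50), (23, 42)], [(23, 42), (21, 32)]]
    [(1, 1, 33, N 0 41 [N 0 181 [N 1 31 [N 0 56 [N 0 10 [N 1 158 [N 0 154 [N 0 60 [N 0 131 [N 0
    104 [N 1 81 [N 1 52 [N 0 75 []]]], N 0 104 [N 1 81 [N 1 59 [N 0 82 [N 0 109 []]]]]]]]]], N
    1 21 [N 1 18 [N 0 23 [N 0 10 [N 1 177 [N 1 12 [N 1 181 [N 1 160 [N 0 137 [N 1 171 [N 0 134
    [N 0 86 [N 1 63 [N 1 42 []]]]]]]]]]]]]]], N 1 10 [N 0 8 [N 0 58 [N 1 32 [N 1 64 [N 0 9 [N 0
    59 [N 0 32 [N 0 75 [N 0 27 [N 0 167 [N 0 109 [N 1 86 [N 0 125 [N 1 101 [N 0 136 []]]], N 1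
    86 [N 0 125 [N 1 101 [N 0 136 []]]]]]]]]]]]]]]]]]]),
    (0, 0, 51, N 0 50 [N 0 1 [N 1 27 [N 0 4 [N 1 26 [N 1 24 [N 0 47 [N 0 99 [N 1 76 [N 0 44 [N
    0 42 [N 0 69 [N 0 36 [N 0 100 [N 1 77 [N 0 90 [N 0 119 [N 1 161 [N 0 13 [N 0 176 [N 1 142
    [N 1 167 [N 0 126 []]]]]]], N 0 140 [N 1 110 [N 1 89 [N 1 111 [N 1 90 [N 1 69 [N 1 98 [N 1
    167 [N 1 10 [N 0 177 [N 1 144 [N 0 121 [N 0 75 [N 0 73 [N 0 23 [N 1 48 [N 0 25 [N 1 2 [N 1
    171 [N 1 150 [N 0 127 []]]]]]]]]]]]]]]]]]]]]]]]]]]]], N 1 76 [N 0 100 [N 0 150 [N 0 101 [N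
    1 78 [N 0 151 [N 1 74 [N 0 97 [N 0 147 [N 0 144 [N 1 167 [N 1 10 [N 0 174 [N 0 124 [N 1 92
    [N 0 120 [N 0 74 []]]]]]]]]]]]]]]]]]]]]]]]]),
    (0, 1, 43, N 0 140 [N 0 1 [N 1 167 [N 0 144 [N 0 5 [N 1 163 [N 0 51 [N 1 28 [N 1 24 [N 1 10
    [N 0 172 [N 0 19 [N 0 70 [N 1 42 [N 0 84 [N 0 121 []]]]]]]]], N 1 28 [N 1 26 [N 0 49 [N 1
    25 [N 0 48 [N 0 89 [N 1 47 [N 0 70 [N 1 112 [N 0 154 [N 0 121 []]]]], N 0 121 [N 0 94 [N 1
    71 [N 1 42 [N 0 66 []]]], N 1 159 [N 0 117 [N 1 93 [N 1 72 [N 1 42 [N 0 66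
    []]]]]]]]]]]]]]]]]]]]),
    (0, 0, 26, N 0 170 [N 0 30 [N 1 3 [N 0 169 [N 1 2 [N 1 23 [N 0 46 [N 1 69 [N 0 189 [N 1 147
    [N 0 143 [N 0 97 [N 1 73 [N 1 49 [N 0 72 [N 0 123 [N 0 92 []]]]]]]]]]]]]]]]]),
    (0, 1, 44, N 1 42 [N 0 1 [N 0 50 [N 1 27 [N 0 70 [N 0 21 [N 0 164 [N 0 20 [N 1 167 [N 0 144
    [N 0 118 [N 1 93 [N 1 72 [N 0 95 [N 0 121 []]]]]]]]]]]], N 1 27 [N 0 51 [N 1 26 [N 0 49 [N
    0 75 [N 1 24 [N 0 47 [N 1 70 [N 0 73 [N 1 21 [N 0 188 [N 0 25 [N 0 164 [N 1 0 [N 0 23 [N 0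
    163 [N 1 186 [N 0 22 [N 0 161 [N 1 20 [N 0 167 [N 0 141 [N 1 118 [N 0 93
    []]]]]]]]]]]]]]]]]]]]]]]]]]]),
    (0, 1, 45, N 0 1 [N 0 48 [N 1 25 [N 0 51 [N 1 28 [N 1 24 [N 0 47 [N 0 68 [N 0 22 [N 0 161
    [N 0 73 [N 0 21 [N 1 167 [N 0 144 [N 1 117 [N 0 94 []]]]]]]], N 1 44 [N 1 70 [N 0 21 [N 0
    72 [N 1 49 [N 0 93 [N 0 46 []]]]]]]]]]]]]]]),
    (1, 1, 34, N 0 147 [N 0 179 [N 0 7 [N 0 57 [N 1 33 [N 1 12 []], N 1 33 [N 1 12 []]], N 1 33
    [N 0 58 [N 0 10 [N 1 55 [N 0 78 [N 1 103 [N 0 129 [N 1 101 [N 1 123 [N 0 155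
    []]]]]]]]]]]]]),
    (0, 1, 46, N 0 69 [N 1 24 [N 1 45 [N 0 22 [N 1 67 [N 0 90 [N 0 1 [N 1 167 [N 0 140
    []]]]]]]]]),
    (1, 1, 35, N 0 58 [N 0 31 [N 0 80 [N 1 57 [N 1 34 [N 0 11 []]], N 1 57 [N 0 34 [N 0 8 [N 1
    33 [N 1 12 [N 0 179 [N 1 156 [N 0 131 [N 1 104 [N 0 150 []]]]]]]]]]]]]),
    (0, 1, 47, N 0 70 [N 1 25 [N 1 46 [N 0 23 [N 1 69 [N 0 92 [N 0 2 [N 1 167 [N 0 141
    []]]]]]]]]),
    (1, 1, 36, N 0 45 [N 0 184 [N 1 22 [N 1 1 [N 0 167 [N 0 28 [N 1 71 [N 0 79 [N 0 26 [N 1 169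
    [N 0 146 [N 1 123 [N 0 95 []]]]]]]]]]]]]),
    (1, 1, 20, N 1 43 [N 0 67 [N 1 22 [N 0 187 [N 0 48 [N 0 46 [N 1 189 [N 0 166 [N 0 25 [N 1
    168 [N 0 145 [N 0 118 [N 1 95 [N 0 142 [N 0 94 []]]]]]]]]]]]]]]),
    (1, 1, 37, N 0 47 [N 0 186 [N 1 24 [N 1 4 [N 0 167 [N 0 28 [N 1 73 [N 0 79 [N 0 27 [N 1 170
    [N 0 147 [N 1 124 [N 0 96 []]]]]]]]]]]]]),
    (1, 1, 38, N 1 21 [N 0 184 [N 0 45 [N 1 22 [N 1 2 [N 0 167 [N 0 28 [N 1 73 [N 0 79 [N 0 27
    [N 1 170 [N 0 147 [N 1 124 [N 0 96 []]]]]]]]]]]]]]),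
    (0, 1, 22, N 0 49 [N 0 189 [N 1 26 [N 1 2 [N 0 169 [N 1 146 [N 0 143 [N 1 46 [N 0 69 [N 1
    96 [N 0 119 []]]]]]]]]]])] =
   Some
    [[(26, 51), (22, 47)], [(22, 47), (20, 38)]]"
  by code_simp

lemma saturate_five_4:
  "saturate 190 (replicate 3 [])
    [[(26, 51), (22, 47)], [(22, 47), (20, 38)]]
    [(1, 1, 39, N 0 61 [N 0 13 [N 1 38 [N 1 18 [N 0 186 [N 1 164 [N 0 17 [N 1 64 [N 1 63 [N 0 85
    [N 0 38 [N 0 86 [N 0 137 [N 1 108 [N 0 155 []]]]]]]]]]]]]]]),
    (1, 1, 40, N 0 4 [N 0 143 [N 1 170 [N 0 148 [N 1 5 [N 0 27 [N 0 168 [N 1 25 [N 0 47 [N 1 74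
    [N 0 121 [N 1 99 [N 1 68 [N 0 92 []]]]]]]]]]]]]]),
    (0, 1, 48, N 0 95 [N 0 44 [N 1 73 [N 0 51 [N 1 72 [N 0 25 [N 0 76 [N 1 29 [N 1 9 [N 1 168
    [N 0 146 [N 0 1 []]]]]]]]]]]]),
    (0, 0, 25, N 0 49 [N 1 1 [N 1 27 [N 1 3 [N 0 171 [N 1 29 [N 0 76 [N 1 54 [N 1 34 [N 1 72 [N
    0 145 [N 1 123 [N 0 94 []]]]]]]]]]]]]),
    (0, 0, 24, N 1 44 [N 0 189 [N 1 24 [N 1 64 [N 1 47 [N 1 27 [N 0 75 [N 1 53 [N 0 25 [N 1 167
    [N 1 147 [N 0 125 [N 0 99 []]]]]]]]]]]]]),
    (0, 1, 49, N 0 141 [N 0 1 [N 1 168 [N 0 26 [N 1 48 [N 1 27 [N 0 49 [N 0 97 [N 0 71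
    []]]]]]]]]),
    (1, 1, 41, N 0 25 [N 1 74 [N 0 49 [N 1 3 [N 1 170 [N 0 148 [N 0 123 [N 0 97 []]]]]]]]),
    (0, 1, 50, N 0 1 [N 0 166 [N 1 144 [N 1 168 [N 0 143 [N 1 25 [N 1 49 [N 1 29 [N 1 70 [N 0
    92 []]]]]]]]]]),
    (1, 1, 42, N 1 1 [N 0 141 [N 1 170 [N 1 21 [N 1 41 [N 1 62 [N 0 90 []]]]]]]),
    (0, 1, 51, N 0 5 [N 1 27 [N 1 50 [N 1 30 [N 1 72 [N 0 28 [N 1 168 [N 1 148 [N 0 98
    []]]]]]]]]),
    (0, 1, 52, N 1 80 [N 0 102 [N 1 51 [N 1 79 [N 0 28 [N 0 4 [N 1 168 [N 1 148 []]]]]]]]),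
    (0, 1, 53, N 0 99 [N 0 145 [N 0 48 [N 1 77 [N 1 52 [N 0 30 [N 1 168 [N 0 1 []]]]], N 1 77
    [N 1 52 [N 0 30 [N 0 1 []]]]]]]),
    (1, 1, 43, N 0 31 [N 1 84 [N 1 64 [N 1 42 [N 1 22 [N 1 2 [N 1 170 []]]]]]]),
    (1, 1, 44, N 0 49 [N 0 25 [N 1 3 [N 1 170 [N 1 150 [N 0 97 [N 1 75 []]]]]]]),
    (1, 1, 45, N 1 4 [N 1 24 [N 1 170 [N 1 150 [N 0 13 [N 1 66 [N 1 44 []]]]]]]),
    (1, 1, 46, N 0 68 [N 0 97 [N 1 45 [N 1 25 [N 1 5 [N 1 170 [N 1 150 []]]]]]]),
    (1, 1, 19, N 1 65 [N 0 43 [N 1 21 [N 1 189 [N 1 169 [N 1 149 [N 0 118 [N 1 96 [N 0 137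
    []]]]]]]]]),
    (0, 1, 54, N 0 104 [N 1 53 [N 1 82 [N 0 31 [N 1 9 [N 1 168 [N 0 146 []]]]]]]),
    (0, 1, 55, N 0 108 [N 0 84 [N 1 54 [N 1 35 [N 1 16 [N 1 162 [N 1 136 []]]]]]]),
    (0, 1, 56, N 0 83 [N 0 107 [N 1 55 [N 1 36 [N 1 17 [N 1 162 [N 1 135 []]]]]]]),
    (1, 1, 18, N 0 42 [N 1 64 [N 1 20 [N 1 189 [N 1 170 [N 1 151 [N 0 120 [N 1 98 [N 0 134
    []]]]]]]]]),
    (1, 1, 17, N 0 43 [N 0 73 [N 1 21 [N 1 189 [N 1 171 [N 1 153 [N 1 129 [N 1 111 [N 0 55
    []]]]]]]]])] =
   Some
    [[(24, 51), (22, 56)], [(22, 56), (17, 46)]]"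
  by code_simp

text \<open>Points 0 and 44 of the unit circle and 22 of the outer one form a triangle, since 44 and
  22 have become edge distances. Point 78 of the unit circle then has the color of point 0 or the
  fourth color.\<close>

lemma check_five:
  "check 190
    [[(24, 51), (22, 56)], [(22, 56), (17, 46)]]
    (replicate 4 [])
    (N 0 0 [N 0 44 [N 1 22 [N 0 78 [N 1 5 [N 1 178 [N 0 156 [N 1 134 [N 1 117 [N 1 100
    []]]]], N 1 168 [N 1 151 [N 1 134 [N 0 112 []]]]], N 1 56 [N 1 39 []]]]]])"
  by code_simp

section \<open>Certificates against five colors: three circles, indices in units of 2
  degrees\<close>

lemma saturate_six_1:
  "saturate 180 (replicate 4 [])
    [[(30, 59), (22, 43), (16, 36)], [(22, 43), (21, 36), (18, 32)], [(16, 36), (18, 32), (17, 30)]]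
    [(0, 0, 29, N 0 160 [N 2 176 [N 2 13 [N 0 32 [N 2 16 [N 2 179 [N 0 163 [N 0 35 [N 2 19 [N 2
    2 [N 0 166 [N 0 38 [N 2 22 [N 2 5 [N 0 169 [N 0 41 [N 2 25 [N 2 8 [N 0 172 [N 0 44 [N 2 28
    [N 2 11 [N 0 175 [N 2 31 [N 0 47 []]]]]]]]]]]]]]]]]]]]]]]]]),
    (0, 0, 28, N 0 44 [N 0 166 [N 1 22 [N 2 2 [N 0 162 [N 0 34 [N 2 18 [N 0 38 [N 2 22 [N 1 4
    []]]], N 2 18 [N 0 38 [N 2 22 [N 1 4 []]]]], N 2 18 [N 0 34 []]], N 2 22 [N 0 38 [N 2 5 [N
    0 169 [N 2 25 [N 2 8 [N 0 172 [N 2 28 [N 2 11 [N 0 175 [N 0 47 [N 2 31 [N 2 12 [N 0 163 [N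
    1 5 [N 0 159 [N 2 175 [N 2 158 [N 0 142 []]]]]]]]]]]]]]]]]]]]]]]),
    (0, 0, 27, N 0 158 [N 2 11 [N 0 28 [N 2 174 [N 0 157 [N 2 173 [N 2 10 [N 0 164 [N 0 43 [N 2
    20 [N 2 3 [N 2 27 [N 2 47 [N 0 63 [N 1 26 [N 0 55 [N 0 176 []]]]]]]], N 2 7 [N 0 151 [N 1
    173 [N 0 36 [N 2 20 [N 1 0 []]]]]]], N 2 5 [N 0 149 [N 2 4 [N 0 37 [N 2 21 [N 0 175 [N 0 47
    [N 1 25 [N 0 163 [N 2 179 [N 2 16 [N 0 161 [N 2 178 [N 0 160 [N 2 176 [N 1 5 [N 0 48 [N 1
    26 [N 0 177 [N 0 130 [N 2 159 [N 1 141 [N 0 119 [N 2 142 [N 0 126 []]]]]], N 2 33 [N 0 55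
    [N 0 179 [N 0 107 [N 0 103 [N 0 51 [N 2 138 [N 0 122 [N 2 158 [N 0 142 [N 2 126 [N 2 144 [N
    2 161 []]]]]], N 2 163 [N 2 146 [N 2 129 [N 0 128 [N 0 69 [N 2 52 [N 0 68 [N 2 84 [N 2 67
    [N 0 95 [N 1 117 [N 2 135 [N 2 105 [N 0 89 [N 0 148 [N 2 132 [N 1 112 [N 0 90
    []]]]]]]]]]]]]]]]]]]]]]]]]]]]]]]]]]]]]]]]]]]]]]]]]]]]),
    (2, 2, 31, N 0 164 [N 0 36 [N 2 2 [N 2 20 [N 2 3 [N 2 1 [N 0 177 [N 0 145 [N 2 161 [N 0 17
    []], N 2 161 [N 0 17 []]], N 2 13 [N 0 29 [N 0 56 [N 2 30 [N 0 54 [N 0 175 [N 2 11 [N 2 28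
    [N 0 47 [N 0 45 [N 0 174 [N 2 10 [N 0 26 [N 0 171 [N 1 13 [N 0 150 [N 0 170 [N 2 6 [N 0 22
    [N 2 166 [N 0 168 [N 1 10 [N 0 147 [N 2 163 [N 2 146 [N 0 130 []]]]]]]]]]]]]]]], N 0 167 [N
    0 44 [N 0 43 [N 2 27 [N 0 11 [N 0 63 [N 2 47 [N 1 21 [N 0 64 [N 2 48 [N 2 77 [N 2 60 [N 2
    75 [N 0 91 [N 1 48 [N 0 70 [N 0 12 []]]]]]]]]]]]]]]]]]]]]]]]]]]]]]]]]]),
    (0, 0, 26, N 2 22 [N 0 40 [N 0 179 [N 2 4 [N 0 168 [N 2 24 [N 2 7 [N 0 171 [N 0 50 [N 2 27
    [N 2 10 [N 0 174 [N 0 53 [N 1 31 [N 2 20 [N 0 36 [N 2 19 [N 2 36 [N 2 58 [N 0 74 [N 2 52 [N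
    0 68 []]]]]]]]]]]]]]]]]], N 2 24 [N 2 21 [N 0 165 [N 2 7 [N 1 39 [N 0 43 [N 2 27 [N 2 10 [N
    0 46 [N 2 30 [N 1 24 [N 0 163 [N 0 162 [N 1 4 [N 0 47 [N 1 25 [N 1 22 [N 0 37 [N 2 3 [N 2
    20 [N 0 36 [N 2 0 [N 2 19 [N 0 35 [N 2 179 [N 2 16 [N 2 35 [N 0 58 [N 2 34 [N 0 50 [N 0 32
    [N 0 160 [N 2 176 [N 0 159 [N 1 1 [N 2 146 [N 2 163 [N 2 145 [N 2 162 [N 0 126 [N 2 144 [N
    2 161 [N 0 125 [N 0 66 [N 1 145 [N 0 106 [N 2 83 [N 0 101 [N 2 66 [N 0 85 [N 0 138
    []]]]]]]]]]]]]]], N 2 173 [N 0 157 [N 0 127 [N 0 68 [N 2 51 [N 0 67 [N 0 99 [N 2 83 [N 2 66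
    [N 0 85 [N 0 144 [N 2 162 [N 0 146 [N 2 130 [N 1 111 [N 0 89 [N 0 148 [N 0 27
    []]]]]]]]]]]]]]]]]]]]]]]]]]]]]]]]]]]]]]]]]]]]]]]]]]]]]]]]]])] =
   Some
    [[(26, 59), (22, 43), (16, 36)], [(22, 43), (21, 36), (18, 32)], [(16, 36), (18, 32), (17, 31)]]"
  by code_simp

lemma saturate_six_2:
  "saturate 180 (replicate 4 [])
    [[(26, 59), (22, 43), (16, 36)], [(22, 43), (21, 36), (18, 32)], [(16, 36), (18, 32), (17, 31)]]
    [(2, 2, 32, N 0 14 [N 0 48 [N 2 31 [N 0 66 [N 2 50 [N 2 30 [N 0 15 [N 0 67 [N 2 51 [N 2 47
    [N 0 74 [N 1 32 [N 2 14 [N 0 176 []]]], N 0 11 [N 2 27 [N 2 20 [N 0 4 [N 1 45 [N 0 74 [N 0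
    36 []]]], N 0 36 [N 2 17 [N 2 34 [N 2 65 [N 1 33 [N 0 175 [N 2 12 []]]]]], N 2 14 [N 0 176
    []]]]]]]]]]]], N 2 50 [N 0 67 [N 2 49 [N 0 65 [N 0 6 [N 0 34 [N 0 15 [N 2 51 [N 0 35 [N 0
    176 [N 2 19 [N 0 169 [N 2 16 [N 0 162 [N 2 1 [N 0 17 [N 0 43 [N 0 164 []]]]]]]], N 2 23 [N
    2 19 [N 0 3 [N 0 157 [N 2 2 [N 0 164 [N 0 43 [N 0 175 [N 2 11 [N 0 30 [N 0 151 [N 0 174 [N
    2 10 [N 0 26 [N 0 147 [N 2 163 [N 0 138 [N 2 172 [N 2 9 [N 0 25 [N 2 169 [N 2 8 [N 0 24 [N
    2 168 [N 2 5 [N 0 23 [N 2 167 []]]]]]]]]]]]]]]]]]]]]]]]]]]]]]]]]]]]]]]]]),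
    (0, 0, 25, N 0 163 [N 0 26 [N 2 2 [N 0 166 [N 0 35 [N 2 19 [N 2 1 [N 2 18 [N 0 162 [N 2 178
    [N 2 16 [N 0 160 [N 0 38 [N 2 22 [N 2 5 [N 0 169 [N 0 41 [N 2 25 [N 2 8 [N 2 171 [N 0 155
    [N 2 9 [N 0 173 [N 0 52 [N 0 179 [N 2 33 [N 0 49 [N 0 58 [N 2 42 [N 0 61 [N 2 45 [N 0 81 [N
    2 65 [N 0 101 [N 0 42 []]]]]]]]]]]]]]]]]]]]]]]]]]]]]], N 2 9 [N 0 173 [N 0 147 [N 2 172 [N
    0 156 []]]]]], N 2 19 [N 0 35 []]]]]]),
    (0, 0, 24, N 0 25 [N 2 2 [N 0 164 [N 0 35 [N 2 19 [N 2 1 [N 2 18 [N 0 162 [N 2 179 [N 2 16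
    [N 0 160 [N 0 166 [N 0 38 [N 2 22 [N 2 5 [N 0 169 [N 0 41 [N 2 25 [N 2 8 [N 2 171 [N 0 155
    [N 0 147 [N 0 172 [N 0 51 [N 0 179 [N 2 163 [N 0 143 [N 2 159 [N 0 123 [N 2 139 [N 0 104 [N
    0 45 [N 1 2 []]]]]]]]]]]]]]]]]]]]]]]]]]]]], N 2 8 [N 0 172 [N 0 147 [N 2 171 [N 0 155 [N 0
    34 [N 2 18 [N 2 1 []]]]]]]]]]]]),
    (0, 0, 23, N 0 43 [N 2 17 [N 0 178 [N 0 36 [N 0 167 [N 0 50 [N 2 34 [N 2 7 [N 2 32 [N 2 0
    [N 0 164 [N 0 24 []]]]]], N 2 27 [N 2 7 [N 0 161 [N 0 33 [N 2 177 [N 0 154 [N 0 102 [N 0 25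
    [N 0 146 [N 2 162 [N 2 138 [N 0 122 [N 2 158 [N 0 141 []]]]]]]]]]]]]]], N 2 23 [N 2 6 [N 0
    170 [N 2 26 [N 2 7 [N 0 171 [N 0 50 [N 2 34 [N 2 54 [N 0 70 [N 0 24 []]]]]]]]]]]], N 2 20
    [N 1 1 [N 0 171 [N 2 7 [N 2 27 [N 0 56 [N 0 32 [N 0 156 [N 2 3 [N 0 167 []]]]]]]]]]]]]]),
    (0, 0, 60, N 0 24 [N 0 1 [N 0 59 [N 0 83 [N 0 106 [N 0 131 [N 0 157 [N 0 118 [N 2 154 [N 0
    138 [N 2 147 [N 2 164 [N 0 128 [N 0 151 [N 0 92 [N 2 76 [N 2 102 [N 2 122 []]]]]]]]]]]], N
    0 157 [N 0 134 [N 0 111 [N 2 95 [N 2 78 [N 0 56 [N 0 79 [N 2 60 [N 0 44 [N 2 26 [N 2 43 [N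
    0 7 []]]]]]]]]]]]], N 0 47 [N 0 157 [N 0 134 [N 0 111 [N 0 131 [N 2 95 [N 0 79 [N 2 147 [N
    2 115 [N 1 97 [N 2 79 [N 0 115 [N 1 158 [N 0 136 [N 0 99 [N 2 83 [N 2 63 [N 2 43 [N 0 15 [N
    2 164 []]]]]]]]]]]]]]]]]]]]], N 0 52 [N 0 36 [N 2 20 [N 2 43 [N 2 16 [N 2 36 [N 1 18 [N 0
    157 [N 0 134 [N 2 164 [N 0 148 [N 0 7 []]]]]]]]]]]]]]]]),
    (0, 0, 22, N 0 161 [N 0 35 [N 2 179 [N 2 17 [N 2 0 [N 0 164 [N 2 19 [N 2 2 [N 0 166 [N 0 38
    [N 2 22 [N 2 5 [N 0 169 [N 0 41 [N 2 25 [N 2 6 [N 0 170 [N 0 42 [N 2 16 [N 0 160 [N 0 32 [N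
    2 176 [N 0 50 [N 2 34 [N 2 54 [N 0 70 [N 0 23 []]]], N 0 179 [N 0 156 [N 0 102 [N 0 27 [N 0
    147 [N 2 163 [N 2 138 [N 0 122 [N 2 158 [N 0 140 []]]]]]]]]]]]]]]]]]]]]]]]]]]]]]]]])] =
   Some
    [[(22, 60), (22, 43), (16, 36)], [(22, 43), (21, 36), (18, 32)], [(16, 36), (18, 32), (17, 32)]]"
  by code_simp

lemma saturate_six_3:
  "saturate 180 (replicate 4 [])
    [[(22, 60), (22, 43), (16, 36)], [(22, 43), (21, 36), (18, 32)], [(16, 36), (18, 32), (17, 32)]]
    [(0, 1, 44, N 0 45 [N 0 1 [N 0 23 [N 0 148 [N 0 50 [N 0 67 [N 0 16 [N 2 164 [N 0 146 [N 2
    162 [N 0 126 [N 2 147 [N 0 131 [N 0 11 []]]]]]], N 2 164 [N 0 142 [N 2 162 [N 0 126 [N 2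
    147 [N 0 131 [N 0 11 []]]]]]]], N 2 34 [N 2 17 [N 0 53 [N 2 36 [N 2 19 [N 0 3 [N 2 167 [N 0
    20 [N 2 4 [N 2 28 [N 0 44 [N 0 164 [N 2 0 []]]]]]]]]]]]]], N 2 29 [N 0 13 [N 0 72 []]]], N
    0 11 [N 0 71 [N 0 49 [N 0 27 [N 0 69 [N 2 33 [N 0 17 [N 0 77 [N 0 55 [N 2 39 [N 2 61 [N 0
    87 [N 1 60 [N 1 39 [N 2 21 [N 0 165 [N 2 1 [N 0 145 []]]]]]]]]]]]]]]]], N 2 164 [N 0 146 [N
    2 162 [N 0 126 [N 2 147 [N 0 131 []]]]]]]]]]]),
    (0, 1, 45, N 0 67 [N 0 23 [N 0 45 [N 0 82 [N 0 7 [N 0 29 [N 0 60 [N 2 34 [N 0 50 [N 2 23 [N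
    0 1 []]]]], N 2 65 [N 0 89 []]], N 0 60 [N 2 36 [N 2 66 [N 0 89 [N 0 29 []]]]]], N 0 56 [N
    0 1 [N 2 29 [N 0 13 [N 0 73 [N 0 51 [N 2 35 [N 2 18 [N 0 171 [N 0 111 [N 2 75 [N 0 89 [N 2
    73 [N 1 93 [N 2 61 [N 0 77 [N 0 17 []]]]]]]]]]]]]]]], N 0 34 [N 2 64 [N 0 80 [N 0 20 [N 2
    36 [N 0 7 []]]]]]]]]]]),
    (1, 2, 33, N 0 179 [N 0 49 [N 2 15 [N 2 32 [N 0 178 [N 2 14 [N 2 31 [N 0 177 [N 2 13 [N 0
    51 [N 0 29 [N 0 157 [N 0 37 [N 2 21 [N 2 4 [N 0 158 [N 0 38 [N 2 22 [N 2 5 [N 0 169 [N 0 47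
    [N 0 6 [N 2 1 [N 0 42 [N 0 164 [N 2 0 [N 0 16 [N 0 64 []]]], N 2 26 [N 0 10 [N 0 69 [N 0 17
    []]]]]]]]]]]]]]]]]]]]]]]]]]]]),
    (2, 2, 33, N 0 17 [N 0 164 [N 2 1 [N 0 19 [N 2 3 [N 0 39 [N 0 147 [N 2 163 [N 0 145 [N 2
    161 [N 0 177 [N 2 15 [N 0 36 [N 0 167 []]]]]]], N 2 163 [N 0 145 [N 2 161 [N 0 177 [N 0 27
    [N 0 49 [N 0 175 [N 2 11 [N 2 32 [N 1 12 [N 0 170 []]]]], N 2 20 [N 0 36 [N 2 11 [N 0 175
    [N 2 31 [N 2 14 []]]]]]]]]]]]], N 2 20 [N 0 36 [N 0 158 [N 1 2 [N 0 4 [N 0 64 [N 0 59 [N 2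
    23 [N 0 7 [N 0 67 [N 0 179 [N 2 17 [N 0 35 [N 2 51 [N 0 16 [N 2 32 [N 1 52 [N 0 79 [N 2 49
    [N 0 13 [N 2 29 [N 0 45 []]]]]]]]]]]]]]]]]]]]]]], N 2 163 [N 0 147 []]], N 2 163 [N 0 147
    []]]]]]),
    (0, 1, 46, N 0 1 [N 0 52 [N 2 18 [N 2 36 [N 2 19 [N 0 3 [N 0 55 [N 2 17 [N 2 34 [N 0 50 [N
    0 33 [N 0 91 [N 2 66 [N 2 33 [N 0 49 [N 2 65 [N 2 32 [N 0 48 [N 2 64 [N 2 31 [N 0 47 [N 1
    69 [N 0 24 [N 0 46 [N 1 68 [N 0 23 [N 2 39 [N 2 63 [N 0 79 [N 0 20 [N 0 69
    []]]]]]]]]]]]]]]]]]], N 2 69 [N 0 90 [N 0 30 [N 0 151 [N 0 129 [N 2 164 [N 0 148 [N 0 126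
    []]]]]]]]]]]]]]]]]]]]),
    (1, 2, 34, N 0 178 [N 2 14 [N 0 36 [N 0 50 [N 2 33 [N 2 16 [N 0 0 [N 0 158 [N 1 24 [N 0 58
    []]]]]], N 2 33 [N 2 32 [N 2 20 [N 0 4 [N 0 158 [N 2 1 [N 0 17 [N 0 64 [N 0 42 [N 2 26 [N 2
    9 [N 0 173 [N 0 48 [N 0 70 [N 0 10 []]]]]]]]]]]]]]]]]]]),
    (0, 1, 47, N 0 1 [N 0 53 [N 2 36 [N 2 19 [N 0 3 [N 0 55 [N 2 17 [N 2 34 [N 0 50 [N 0 33 [N
    0 92 [N 2 69 [N 0 93 [N 2 66 [N 2 33 [N 0 49 [N 2 65 [N 2 32 [N 0 48 [N 1 70 [N 0 25 [N 0
    47 [N 1 69 [N 0 23 [N 2 39 [N 2 64 [N 0 80 [N 0 20 [N 0 71 []]]]]]]]]]]]]]]]]], N 2 69 [N 0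
    93 [N 0 153 [N 0 131 [N 2 164 [N 0 148 [N 0 126 []]]]]]]]]]]]]]]]]]),
    (2, 2, 34, N 0 164 [N 2 1 [N 0 36 [N 2 20 [N 2 3 [N 2 18 [N 0 162 [N 0 4 [N 0 34 [N 0 56 [N
    0 0 [N 2 16 [N 2 33 [N 0 17 [N 0 64 [N 0 53 [N 0 50 [N 0 32 [N 0 178 [N 2 14 [N 0 30 [N 0
    150 [N 1 172 [N 0 142 [N 2 163 [N 0 147 [N 0 125 [N 2 148 [N 0 132 [N 0 12 [N 2 48 [N 0 72
    []]]]]]]]], N 2 11 [N 2 28 [N 0 44 [N 0 173 [N 2 9 [N 0 26 [N 0 147 [N 2 163 [N 0 145 [N 0
    167 []]]]]]]]]]]]]]]]]]]]]]]]]]]]]]]]])] =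
   Some
    [[(22, 60), (22, 47), (16, 36)], [(22, 47), (21, 36), (18, 34)], [(16, 36), (18, 34), (17, 34)]]"
  by code_simp

lemma saturate_six_4:
  "saturate 180 (replicate 4 [])
    [[(22, 60), (22, 47), (16, 36)], [(22, 47), (21, 36), (18, 34)], [(16, 36), (18, 34), (17, 34)]]
    [(0, 0, 21, N 2 179 [N 0 35 [N 2 17 [N 0 163 [N 2 19 [N 2 2 [N 0 166 [N 0 38 [N 2 22 [N 2 5
    [N 0 169 [N 0 41 [N 2 25 [N 2 16 [N 0 160 [N 0 32 [N 2 178 [N 2 177 [N 0 174 [N 0 54 [N 2
    38 [N 0 22 [N 0 152 [N 2 168 [N 0 142 []]]]]], N 0 152 [N 0 31 [N 0 53 [N 0 179 [N 2 163 [N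
    0 141 [N 2 157 [N 0 121 [N 0 61 [N 2 39 [N 0 23 []]]]]]]]]]]]]]]]]]]]]]]]]]]]]]),
    (2, 2, 35, N 0 51 [N 0 179 [N 2 15 [N 2 34 [N 2 17 [N 0 1 [N 0 53 [N 0 32 [N 0 160 [N 0 36
    [N 2 20 [N 2 3 [N 0 164 [N 2 2 [N 0 18 [N 0 152 [N 0 4 [N 0 64 [N 0 24 [N 2 8 [N 0 172 [N 0
    143 [N 2 163 [N 0 147 [N 0 126 [N 2 148 [N 0 132 [N 0 12 [N 2 48 [N 0 72 []]]]]]]]]]], N 2
    168 [N 0 143 [N 2 163 [N 0 147 []]]]]]]]]]]]]]]]]]]]]]]),
    (2, 2, 36, N 0 12 [N 0 162 [N 0 34 [N 2 1 [N 2 18 [N 0 164 [N 0 36 [N 2 20 [N 0 56 [N 2 35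
    [N 0 19 [N 0 72 [N 2 55 [N 0 79 [N 0 51 []]]]]]]]]]], N 2 18 [N 0 164 [N 0 161 [N 0 2 [N 0
    62 [N 2 35 [N 0 54 [N 2 28 [N 0 44 [N 0 178 [N 2 14 [N 0 30 [N 0 150 [N 0 171 [N 2 13 [N 0
    29 [N 0 149 [N 0 170 [N 2 6 [N 0 28 [N 0 148 [N 0 169 [N 2 5 [N 0 21 [N 2 166 [N 0 143
    []]]]]]]]]]]]]]]]]]]]]]]]]]]]]]),
    (0, 2, 37, N 0 19 [N 0 59 [N 2 35 [N 0 10 [N 0 71 [N 2 55 [N 2 36 [N 0 20 [N 0 72 [N 2 56
    [N 1 38 [N 0 73 [N 0 52 [N 0 9 [N 2 25 [N 0 41 [N 2 57 [N 2 24 [N 0 40 []]]]]]]]]]]]]], N 2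
    55 [N 0 39 [N 0 73 [N 0 52 [N 2 36 [N 0 20 [N 2 56 [N 0 40 [N 0 32 [N 2 23 [N 2 57 [N 0 41
    [N 1 5 [N 2 32 [N 0 48 [N 0 69 [N 0 9 [N 2 25 []]]]]]]], N 2 4 [N 0 168 [N 0 159 [N 1 6 [N
    2 24 [N 0 60 [N 0 28 [N 2 44 [N 0 80 [N 0 148 [N 2 164 [N 0 140 [N 2 176 [N 0 160 [N 0 8 [N
    0 128 [N 2 144 [N 0 120 [N 0 108 [N 2 124 [N 2 104 [N 0 88
    []]]]]]]]]]]]]]]]]]]]]]]]]]]]]]]]], N 0 70 [N 2 54 [N 0 18 [N 2 34 [N 0 50 [N 0 71
    []]]]]]]]]]),
    (2, 2, 37, N 2 36 [N 0 53 [N 2 19 [N 0 3 [N 0 56 [N 0 35 [N 0 162 [N 2 2 [N 0 164 [N 0 20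
    [N 0 143 [N 2 163 [N 0 147 [N 0 27 [N 2 11 [N 0 175 [N 0 126 [N 2 148 [N 0 132 [N 0 12 [N 0
    72 [N 2 56 [N 0 74 []]]]]]]]]]]]]]]]]]]]]]]),
    (0, 1, 48, N 0 72 [N 0 93 [N 0 51 [N 0 47 [N 0 14 [N 2 35 [N 2 72 [N 0 56 [N 2 37 [N 2 74
    [N 0 58 [N 0 37 [N 0 88 [N 0 28 [N 0 21 [N 0 81 [N 2 65 [N 2 44 [N 0 60 []]]]]]]]]]]]]], N
    2 35 [N 0 19 [N 0 13 [N 0 34 [N 2 53 [N 0 69 [N 2 34 [N 2 51 [N 0 68 [N 2 31 [N 2 50 [N 0
    66 [N 0 7 [N 1 29 [N 0 76 [N 0 55 []]]]]]]]]]]]]]]]], N 2 73 [N 0 89 [N 0 29 [N 0 50 [N 2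
    66 [N 2 31 [N 0 12 []]]]]]]]]]]),
    (0, 0, 61, N 0 127 [N 0 103 [N 0 155 [N 0 1 [N 0 22 [N 0 54 [N 2 38 [N 2 19 [N 0 35 [N 0 82
    []]]], N 2 38 [N 2 19 [N 0 35 [N 0 56 []]]]], N 1 158 [N 0 148 [N 2 164 [N 2 147 [N 0 163
    [N 2 140 [N 0 124 [N 2 161 [N 2 144 []]]]]]]]]], N 0 159 [N 0 138 [N 0 148 [N 2 164 [N 2
    144 [N 0 160 [N 1 6 [N 2 143 [N 2 126 [N 0 144 [N 2 160 [N 2 177 [N 2 21 [N 0 58 [N 2 40 [N
    0 22 []]]]]]]]]]]]]]]]]]]]),
    (1, 2, 35, N 0 68 [N 2 32 [N 0 16 [N 2 52 [N 2 34 [N 0 18 [N 0 71 [N 2 55 [N 0 39 [N 0 72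
    [N 0 51 [N 0 7 [N 2 23 [N 2 2 [N 0 158 [N 2 15 [N 0 179 []]]]]]]]]]]]]]]]]),
    (0, 0, 20, N 2 16 [N 0 179 [N 0 39 [N 0 60 [N 2 23 [N 1 47 [N 1 26 [N 0 165 [N 2 4 [N 0 158
    []]]]]], N 2 36 [N 0 53 [N 2 22 [N 2 33 [N 0 49 [N 0 168 [N 2 4 [N 2 163 [N 0 147 [N 0 121
    [N 2 158 [N 0 142 [N 2 179 [N 1 161 []]]]]]]]]]]]]]]]]]),
    (0, 2, 38, N 2 27 [N 0 53 [N 0 1 [N 0 21 [N 2 37 [N 2 19 [N 2 36 [N 0 52 [N 0 72 [N 0 11
    []]]]]], N 2 37 [N 2 20 [N 0 4 [N 0 65 [N 0 43 []]]]]]]]])] =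
   Some
    [[(20, 61), (22, 48), (16, 38)], [(22, 48), (21, 36), (18, 35)], [(16, 38), (18, 35), (17, 37)]]"
  by code_simp

lemma saturate_six_5:
  "saturate 180 (replicate 4 [])
    [[(20, 61), (22, 48), (16, 38)], [(22, 48), (21, 36), (18, 35)], [(16, 38), (18, 35), (17, 37)]]
    [(0, 0, 19, N 0 41 [N 0 73 [N 0 20 [N 2 57 [N 2 37 [N 2 54 [N 0 70 [N 0 53 [N 0 179 [N 2 23
    [N 0 39 [N 0 159 [N 2 3 [N 0 167 [N 0 147 [N 2 166 [N 0 150 [N 0 130 [N 2 151 [N 1 133 [N 1
    112 [N 0 90 []]]]]]]]]]]]]]]]]]]]]]),
    (0, 0, 62, N 0 94 [N 0 59 [N 0 35 [N 0 81 [N 0 113 [N 2 97 [N 2 78 []], N 2 97 [N 2 78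
    []]], N 0 61 [N 0 42 [N 0 23 [N 2 45 [N 0 29 [N 0 10 [N 0 161 [N 0 142 [N 0 113
    []]]]]]]]]]]]]),
    (0, 2, 39, N 0 20 [N 0 54 [N 0 1 [N 2 38 [N 2 21 [N 0 5 [N 0 67 [N 1 45 [N 2 27 [N 0 11 [N
    0 73 []]]]]]]]]]]),
    (0, 0, 63, N 0 59 [N 0 114 [N 0 82 [N 2 98 [N 2 79 [N 2 96 [N 0 112 [N 0 131 [N 0 95 [N 0
    40 [N 0 21 [N 2 43 [N 0 27 [N 0 8 [N 0 150 []]]]]]]]]]]]]]]),
    (0, 0, 64, N 0 60 [N 0 115 [N 0 83 [N 2 99 [N 2 80 [N 2 97 [N 0 113 [N 0 132 [N 0 96 [N 0
    50 [N 0 41 [N 2 66 [N 0 82 [N 0 19 [N 2 44 [N 0 28 [N 0 9 [N 0 151 []]]]]]]]]]]]]]]]]]),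
    (0, 2, 40, N 0 75 [N 0 20 [N 0 55 [N 2 39 [N 2 59 [N 0 43 [N 0 24 [N 0 5 [N 2 27 [N 0 11
    []]]]]]]]]]),
    (0, 2, 41, N 0 78 [N 0 39 [N 0 14 [N 0 59 [N 2 40 [N 0 24 [N 2 62 [N 0 46 [N 2 30 [N 0 1
    []]]]]]]]]]),
    (0, 0, 18, N 0 162 [N 0 143 [N 0 19 [N 2 2 [N 2 165 [N 0 149 [N 0 33 [N 2 163 [N 0 179 [N 2
    17 [N 0 38 []]]]]]]]]]]),
    (0, 0, 65, N 0 142 [N 0 86 [N 2 103 [N 0 124 [N 2 106 [N 0 147 [N 0 129 [N 0 111 [N 0 93 [N
    0 157 [N 2 141 [N 0 160 []]]]]]]]]]]]),
    (0, 0, 66, N 0 46 [N 0 11 [N 2 29 [N 0 65 [N 2 49 [N 0 33 [N 0 162 [N 2 17 [N 0 1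
    []]]]]]]]]),
    (0, 0, 67, N 0 103 [N 0 144 [N 0 126 [N 0 85 [N 2 108 [N 0 92 [N 0 158 [N 2 142 [N 0 162
    []]]]]]]]]),
    (0, 2, 42, N 0 75 [N 0 8 [N 0 57 [N 2 41 [N 2 24 [N 0 7 [N 0 25 []]]]]]]),
    (0, 0, 17, N 0 18 [N 0 131 [N 0 84 [N 0 66 [N 2 50 [N 0 34 [N 2 47 [N 0 63 [N 0 178 [N 2
    162 [N 2 16 []]]]]]]]]]]),
    (0, 0, 68, N 2 147 [N 0 131 [N 0 163 [N 0 114 [N 0 1 []]]]]),
    (0, 2, 43, N 0 148 [N 0 1 [N 0 131 [N 2 164 [N 0 18 []]]]])] =
   Some
    [[(17, 68), (22, 48), (16, 43)], [(22, 48), (21, 36), (18, 35)], [(16, 43), (18, 35), (17, 37)]]"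
  by code_simp

text \<open>On the unit circle all distances from 17 to 68, that is from 34 to 136 degrees, are
  edges by now. The points 0, 114, 131 and 148 form a clique, and 97 has the color of 0 or the fifth
  color.\<close>

lemma check_six:
  "check 180
    [[(17, 68), (22, 48), (16, 43)], [(22, 48), (21, 36), (18, 35)], [(16, 43), (18, 35), (17, 37)]]
    (replicate 5 [])
    (N 0 0 [N 0 114 [N 0 148 [N 0 131 [N 0 97 [N 0 80 [N 2 115 [N 0 99 [N 0 82 [N 0 65 [N 0 48
    [N 2 83 [N 0 67 [N 0 50 [N 0 33 [N 0 16 [N 2 174 [N 2 157 [N 2 140 [N 2 123 [N 2 106 [N 2
    89 [N 2 72 [N 2 55 [N 2 38 [N 0 17 []]]]]]]]]]]]]]]]]]]]], N 0 80 [N 2 115 [N 0 99 [N 0 167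
    [N 2 132 [N 0 116 [N 0 4 [N 2 164 [N 2 129 [N 2 146 [N 0 162 []]]]]]]]]]]]]]]])"
  by code_simp

section \<open>Certificates against six colors: four circles, indices in units of 3 degrees\<close>

lemma saturate_seven_1:
  "saturate 120 (replicate 5 [])
    [[(20, 44), (17, 35), (12, 28), (8, 24)], [(17, 35), (16, 30), (13, 25), (11, 23)], [(12, 28), (13, 25), (12, 22), (11, 21)], [(8, 24), (11, 23), (11, 21), (11, 20)]]
    [(3, 3, 21, N 0 29 [N 0 8 [N 0 105 [N 0 9 [N 3 5 [N 0 112 [N 3 16 [N 0 24 [N 3 1 [N 2 17 [N
    0 44 [N 3 33 [N 0 13 [N 0 41 [N 0 117 [N 0 33 []]], N 0 101 [N 3 109 [N 1 98 [N 0 117 [N 0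
    96 [N 0 53 [N 0 89 []]]]]]]]], N 3 33 [N 0 5 [N 3 13 [N 0 21 [N 0 41 [N 0 117 [N 0 97 [N 3
    109 [N 0 13 []]]]]]]]]]]], N 3 1 [N 2 2 [N 3 13 [N 0 21 [N 0 117 [N 0 97 [N 3 109 [N 0 13
    []]]]]]]]]], N 0 13 [N 3 1 [N 3 16 [N 0 36 [N 2 11 [N 0 119 [N 3 109 [N 1 98 []]]]]]], N 3
    1 [N 1 20 [N 3 9 [N 0 24 [N 3 16 [N 1 118 [N 1 98 [N 3 109 [N 0 117 []]]]]]]]]]], N 3 16 [N
    0 112 [N 0 24 [N 3 32 [N 2 13 [N 1 109 [N 3 12 [N 0 21 [N 0 41 [N 3 20 [N 1 9 []]]]]]], N 3
    20 [N 1 43 [N 1 15 [N 0 43 [N 1 9 []]]]]], N 2 12 [N 3 1 [N 1 20 [N 0 40 [N 3 32 []]]]]], N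
    0 24 [N 3 1 [N 2 13 [N 0 117 [N 3 20 [N 0 44 [N 3 32 [N 1 43 [N 0 1 [N 0 101 [N 3 109 [N 0
    99 [N 3 108 [N 0 84 [N 0 97 [N 2 109 [N 1 14 [N 3 36 [N 0 60 [N 0 16 []]]]]]]]]]]]]], N 3
    33 [N 0 41 [N 1 20 [N 3 9 [N 0 0 []]]]]]]]]], N 3 9 [N 1 118 [N 0 1 [N 2 12 [N 3 1 [N 3 109
    [N 0 101 []]]]]]]]], N 0 112 [N 2 5 [N 2 4 [N 0 24 [N 3 2 [N 2 13 [N 1 109 [N 0 109 [N 3 13
    [N 0 21 [N 2 17 [N 3 6 [N 0 33 [N 1 16 [N 0 103 [N 2 115 [N 0 101 [N 0 13 [N 3 109 [N 0 96
    [N 2 109 [N 0 17 [N 3 9 [N 0 92 [N 0 53 [N 3 29 [N 3 18 [N 0 10 [N 1 44 [N 3 33 [N 3 22 [N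
    1 45 [N 3 34 [N 3 23 [N 0 47 [N 0 89 []]]]]]]]]]]]]]]]]]]]]]]]]]]]]]]]]]], N 0 24 [N 3 1 [N
    0 117 [N 3 15 [N 0 23 [N 3 14 [N 0 22 [N 3 13 [N 0 21 [N 3 12 [N 0 20 [N 2 17 [N 3 6 [N 0
    30 [N 2 18 [N 3 7 [N 3 116 [N 0 31 [N 2 19 [N 3 8 [N 0 32 [N 2 20 [N 3 9 [N 0 33 [N 1 16 [N
    0 101 [N 1 118 [N 0 44 [N 3 33 [N 0 43 [N 3 19 [N 0 11 [N 3 29 [N 0 51 [N 1 32 [N 0 15 [N 0
    98 [N 0 54 [N 3 31 [N 3 11 [N 0 19 [N 2 31 [N 3 10 [N 2 21 []]]]]]]]]]]]]]]], N 3 33 [N 3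
    20 [N 2 9 [N 0 36 [N 0 16 [N 0 97 [N 2 109 [N 0 92 [N 2 0 [N 0 12
    []]]]]]]]]]]]]]]]]]]]]]]]]]]]]]]]]]], N 3 20 [N 0 44 [N 3 33 [N 0 41 [N 2 21 [N 0 45 [N 0
    12 [N 3 36 [N 2 0 [N 3 32 [N 1 98 [N 3 109 [N 1 97 [N 3 108 [N 0 101 [N 0 13 [N 3 37 [N 0
    21 [N 3 13 [N 3 113 [N 3 26 [N 0 49 [N 3 41 [N 3 30 [N 2 29 [N 0 57 [N 3 45 [N 0 54 [N 1 21
    [N 0 4 [N 0 89 [N 2 101 [N 3 112 [N 0 88 [N 2 100 [N 3 111 [N 0 87 [N 0 43 [N 0 119 [N 3 7
    []]]]]]]]]]]]]]]]]]]]]], N 3 13 [N 1 2 [N 2 27 [N 0 55 [N 3 45 [N 0 61 [N 0 87 [N 0 43 [N 0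
    119 [N 0 84 []]]]]]]]]]]]]]]]], N 3 109 [N 0 97 [N 0 21 [N 3 13 [N 3 25 [N 2 43 [N 0 59 [N
    1 26 [N 0 43 [N 0 119 [N 3 10 []]]]]]]]]]]]]]]]]]]], N 3 33 [N 3 32 [N 1 43 [N 0 7 [N 3 15
    [N 0 6 [N 3 14 [N 0 5 [N 2 17 [N 0 45 [N 1 98 [N 3 114 [N 3 109 [N 0 101 [N 2 114 [N 0 86
    [N 2 98 [N 2 0 [N 0 12 []]]]]]]], N 3 109 [N 0 97 [N 3 107 [N 3 105 [N 0 81 [N 0 61 [N 3 37
    [N 0 60 [N 0 16 [N 3 113 [N 0 89 [N 3 103 [N 1 80 [N 0 63 [N 2 108 [N 0 3 [N 0 79 [N 3 87
    [N 3 98 [N 0 0 []]]]]]]]]]]]]]]]]]]]]]]]]]]]]]]]]]], N 2 5 [N 0 33 [N 2 20 [N 3 9 [N 1 118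
    [N 2 21 [N 3 10 [N 1 119 [N 0 2 [N 1 7 [N 0 42 [N 2 3 [N 3 14 [N 1 25 [N 2 1 [N 3 12 [N 1
    23 [N 0 6 [N 0 49 [N 3 41 [N 3 33 [N 2 12 [N 3 32 [N 2 11 [N 2 109 [N 0 97 [N 3 108 [N 3
    119 [N 0 95 [N 3 104 [N 3 118 [N 0 94 [N 0 50 [N 3 42 [N 0 66 [N 0 28 [N 0 104 [N 0 60
    []]]]]]]]]]]]]]]]]]]]]]]]]]]]]]]]]]]]]]]]]], N 3 20 [N 0 44 [N 3 32 [N 2 21 [N 0 49 [N 0 85
    [N 0 108 [N 0 117 [N 3 12 [N 0 20 []], N 3 12 [N 0 20 []]]]]]]], N 3 32 [N 2 21 [N 0 45 [N
    1 43 [N 0 40 [N 0 117 [N 2 12 [N 0 24 []], N 2 13 [N 3 33 [N 0 25 [N 0 116 [N 0 16 [N 3 8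
    [N 2 117 [N 0 104 [N 0 60 [N 3 37 []]]]]]]]]]]]]]]]], N 0 44 [N 3 32 [N 3 17 [N 2 21 [N 0
    49 [N 3 31 [N 1 42 [N 3 30 [N 0 45 [N 1 28 [N 0 117 [N 3 10 [N 0 25 []], N 3 16 [N 0 24 [N
    2 9 []]]]]]]]]]]]], N 3 32 [N 0 40 [N 0 117 [N 3 9 [N 0 24 [N 3 16 [N 3 5 []]]], N 3 16 [N
    0 24 [N 2 9 []]]]]]]]]]]])] =
   Some
    [[(20, 44), (17, 35), (12, 28), (8, 24)], [(17, 35), (16, 30), (13, 25), (11, 23)], [(12, 28), (13, 25), (12, 22), (11, 21)], [(8, 24), (11, 23), (11, 21), (11, 21)]]"
  by code_simp

lemma saturate_seven_2:
  "saturate 120 (replicate 5 [])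
    [[(20, 44), (17, 35), (12, 28), (8, 24)], [(17, 35), (16, 30), (13, 25), (11, 23)], [(12, 28), (13, 25), (12, 22), (11, 21)], [(8, 24), (11, 23), (11, 21), (11, 21)]]
    [(0, 0, 19, N 2 12 [N 0 119 [N 0 28 [N 0 116 [N 0 112 [N 2 4 [N 3 16 [N 0 24 [N 3 1 [N 3 15
    [N 0 111 [N 0 23 [N 3 119 [N 0 99 [N 3 110 [N 1 99 [N 0 98 [N 3 106 [N 0 20 [N 0 40 [N 0 82
    [N 3 99 [N 0 84 [N 0 63 [N 0 107 []]]]]]]]]]]]]]]]], N 3 15 [N 0 111 [N 2 3 [N 3 14 [N 0
    110 [N 2 2 [N 3 13 [N 0 109 [N 2 1 [N 3 12 [N 0 108 [N 2 0 []]]]]]]]]]]]]], N 0 24 [N 0 108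
    [N 0 104 [N 0 31 [N 3 23 [N 0 40 [N 2 26 [N 3 15 [N 1 2 [N 2 27 [N 3 16 [N 3 5 [N 1 1 [N 3
    12 [N 1 23 [N 3 0 [N 3 11 [N 1 22 [N 2 117 [N 3 10 [N 1 21 [N 2 116 [N 3 7 [N 1 19 [N 0 15
    [N 0 20 [N 0 96 [N 0 63 [N 2 37 [N 0 58 [N 3 35 [N 1 46 [N 1 17 [N 3 114 [N 0 99 [N 2 7 [N
    3 116 [N 3 105 [N 0 81 []]]]]]]]]]]], N 3 116 [N 2 7 [N 0 102 [N 2 114
    []]]]]]]]]]]]]]]]]]]]]]]]], N 0 63 [N 0 20 [N 0 99 [N 3 1 [N 3 12 [N 1 1 [N 0 36 [N 2 24 [N
    3 13 [N 1 2 [N 0 37 [N 2 25 [N 3 14 [N 0 6 [N 3 113 [N 1 98 [N 0 81 [N 0 60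
    []]]]]]]]]]]]]]]], N 3 1 [N 3 12 [N 1 1 [N 0 36 [N 3 28 [N 3 43 [N 0 52 [N 0 80 [N 1 98 [N
    3 119 [N 3 11 [N 3 110 [N 1 94 [N 2 107 [N 3 8 [N 3 117 []]]]]]]]]]]]]]]]], N 0 20 [N 3 12
    [N 1 1 []], N 0 99 [N 2 7 [N 3 116 [N 3 17 [N 2 17 [N 0 43 [N 3 35 [N 0 35 [N 1 18 [N 0 103
    [N 1 0 [N 3 12 [N 2 23 [N 0 51 [N 3 41 [N 3 30 [N 3 19 [N 3 8 [N 2 117 [N 3 11 [N 1 22 [N 0
    39 [N 0 59 [N 0 79 []]]]]]]]]]]]]]]]]]]]]]]]]]]], N 3 23 [N 3 20 [N 3 9 [N 2 118 [N 1 118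
    [N 0 101 [N 0 63 [N 3 41 [N 0 57 [N 0 43 [N 3 33 [N 2 44 [N 1 19 [N 3 30
    []]]]]]]]]]]]]]], N 3 1 [N 0 20 [N 3 12 [N 3 23 [N 0 31 []]], N 3 117 [N 3 8 [N 3 20 [N 0
    40 [N 0 32 [N 0 76 [N 3 96 [N 3 112 [N 0 103 [N 3 111 []]]]]]]]]]]]], N 3 1 [N 3 12 [N 0 20
    [N 2 15 [N 0 32 [N 3 23 [N 0 43 [N 0 76 [N 3 100 [N 3 111 [N 0 96 []]]]]]]]]]]], N 3 16 [N
    3 5 [N 2 5 [N 0 110 [N 0 109 [N 2 1 [N 3 12 [N 0 107 [N 0 106 [N 0 105 [N 1 2 [N 0 104 [N 1
    1 [N 0 20 [N 2 118 [N 3 9 [N 3 20 [N 0 40 [N 3 32 [N 0 63 [N 3 48 [N 0 68 [N 1 51 [N 3 40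
    [N 3 29 [N 3 18 [N 3 7 [N 2 116 []]]]]]]]]]]]]], N 0 96 [N 0 63 [N 0 40 [N 2 27 [N 2 15 [N
    0 43 [N 0 61 [N 3 37 [N 0 59 [N 3 36 [N 2 47 [N 3 35 [N 1 46 [N 1 18 [N 2 31 [N 3 43 [N 1
    54 [N 3 31 [N 2 42 [N 0 78 [N 3 55 [N 1 76 [N 3 53 [N 3 65 [N 1 70 [N 0 87 [N 3 102 [N 3
    118 [N 3 97 [N 3 76 [N 0 86 [N 1 51 [N 0 68 []]]]]]]]]]]]]]]]]]]]]]]]]]]]]]]], N 3 0 [N 3
    119 [N 3 10 [N 3 109 [N 0 8 [N 3 114 [N 3 118 [N 3 9 [N 3 20 [N 0 37 [N 1 17 [N 3 6 [N 3
    115 [N 3 104 [N 0 87 [N 0 43 [N 3 29 [N 3 40 [N 0 48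
    []]]]]]]]]]]]]]]]]]]]]]]]]]]]]]]]]]]], N 0 24 [N 0 36 [N 0 76 [N 3 4 [N 3 16 [N 3 1 [N 0
    113 [N 2 21 [N 0 37 [N 1 20 [N 3 15 [N 1 26 [N 0 43 [N 3 33 [N 0 55 [N 3 29 [N 1 41 [N 3 18
    [N 3 27 [N 2 38 [N 0 10 [N 3 26 [N 1 37 [N 1 21 [N 0 56 [N 0 100 [N 0 20
    []]]]]]]]]]]]]]]]]]]]]]], N 3 23 [N 3 16 [N 3 15 [N 0 23 [N 0 43 [N 3 35 [N 3 24 [N 0 48 [N
    2 36 [N 0 80 [N 3 104 [N 1 93 [N 1 2 [N 0 105 [N 0 63 [N 0 83 []]]]]]]]]]]]]]]]], N 0 108
    [N 3 1 [N 3 16 [N 3 5 [N 3 23 [N 0 40 [N 1 23 [N 3 12 []]]]]]], N 0 40 [N 0 20 [N 3 12 [N 3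
    1 [N 0 104 [N 1 1 [N 3 24 [N 1 47 [N 3 36 [N 3 15 [N 0 23 [N 0 43 []]]]]]]]]], N 3 12 [N 2
    1 [N 3 7 [N 0 103 [N 3 5 [N 3 16 [N 2 27 [N 0 101 [N 3 4 [N 3 15 [N 2 26 [N 1 26 [N 0 43 [N
    0 84 [N 3 104 [N 1 93 [N 0 62 [N 3 43 [N 0 57 [N 3 37 [N 2 49 [N 1 74 [N 0 92 [N 3 100 [N 3
    111 [N 0 87 []]]]]]]]]]]]]]]]]]]]]]]]]]], N 3 23 [N 3 12 [N 2 23 [N 2 1 [N 0 104 [N 1 1 [N
    3 24 [N 3 13 [N 3 2 [N 0 114 [N 0 38 [N 2 26 [N 3 15 [N 3 4 []]]]]]]]]]]]]]]]], N 3 16 [N 3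
    5 [N 1 26 [N 0 29 [N 2 17 [N 3 6 [N 0 30 [N 2 18 [N 3 7 [N 0 31 [N 3 23 [N 1 2 [N 0 105 [N
    0 43 [N 3 35 [N 0 46 [N 3 38 [N 0 62 [N 0 103 [N 3 111 [N 0 87 []]]]]]]]]]]]]]]]]]]]]], N 3
    16 [N 3 5 []]]], N 0 24 [N 0 40 [N 2 24 [N 3 13 [N 3 12 [N 2 23 [N 1 23 [N 0 20 [N 3 9 [N 3
    8 [N 3 19 [N 3 7 [N 0 96 [N 0 76 [N 2 4 [N 1 111 [N 3 2 [N 0 113 [N 3 1 [N 0 9 [N 1 109 [N
    0 107 [N 0 63 [N 0 106 [N 0 62 [N 0 104 [N 0 52 [N 3 34 [N 2 47 [N 3 36 [N 3 25 [N 2 14 [N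
    2 36 [N 0 42 [N 2 30 [N 3 43 [N 3 55 [N 1 77 [N 1 73 [N 1 69 [N 0 86 [N 3 100 [N 3 86 [N 3
    65 [N 1 42 [N 3 53 [N 3 64 [N 1 41 [N 2 16 [N 2 28 [N 3 39 [N 3 50 [N 1 61 [N 0 44
    []]]]]]]]]]]]]]]]]]]]]]]]]]], N 3 38 [N 3 17 [N 2 28 [N 2 7 [N 0 102 [N 0 58 [N 3 34
    []]]]]]]]]]]]]]]]]]], N 2 26 [N 3 15 [N 3 4 [N 0 103 []]]]]], N 3 108 [N 0 84 [N 3 105 [N 0
    81 [N 3 104 [N 0 80 [N 0 63 [N 1 46 [N 3 34 [N 1 54 [N 2 37 [N 3 16 [N 2 27 []]]]]], N 1 46
    [N 3 34 [N 1 54 [N 2 37 [N 3 16 [N 2 27 [N 1 2 [N 0 100 []]]]]]]]]]]]]]]]]]]]]]]]]], N 3 20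
    [N 3 9 [N 0 33 [N 2 21 [N 3 10 [N 0 34 [N 2 22 [N 3 11 [N 0 35 [N 2 23 [N 3 12 [N 0 36 [N 2
    24 []]]]]]]]]]]]]], N 3 16 [N 3 5 [N 0 117 [N 0 107 [N 0 106 [N 0 105 [N 3 12 [N 3 9 [N 3
    20 [N 0 40 [N 2 25 [N 0 20 [N 3 8 [N 3 19 [N 0 27 [N 3 7 [N 3 18 [N 0 26 [N 2 118 [N 1 18
    [N 0 96 [N 1 11 [N 0 76 [N 0 63 [N 0 61 [N 3 37 [N 0 58 [N 3 35 [N 1 46 [N 1 17 [N 3 114 [N
    3 100 [N 0 92 [N 3 113 [N 2 92 [N 3 103 []]]]]]]]]]]]]]], N 3 0 [N 0 8 [N 3 114 [N 1 17 [N
    3 6 [N 3 115 []]]]]]]]]]]]]]]]]]]]]]]]]]]]]]]])] =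
   Some
    [[(19, 44), (17, 35), (12, 28), (8, 24)], [(17, 35), (16, 30), (13, 25), (11, 23)], [(12, 28), (13, 25), (12, 22), (11, 21)], [(8, 24), (11, 23), (11, 21), (11, 21)]]"
  by code_simp

lemma saturate_seven_3:
  "saturate 120 (replicate 5 [])
    [[(19, 44), (17, 35), (12, 28), (8, 24)], [(17, 35), (16, 30), (13, 25), (11, 23)], [(12, 28), (13, 25), (12, 22), (11, 21)], [(8, 24), (11, 23), (11, 21), (11, 21)]]
    [(0, 0, 18, N 0 119 [N 0 24 [N 2 12 [N 0 108 [N 2 0 [N 0 104 [N 0 100 [N 0 62 [N 2 6 [N 0 32
    [N 3 23 [N 0 43 [N 2 18 [N 2 116 [N 3 7 [N 2 16 [N 3 115 [N 0 19 [N 0 103 [N 0 59 [N 3 35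
    [N 3 24 [N 2 13 [N 0 41 [N 3 27 [N 3 42 [N 1 53 [N 0 77 [N 3 54 [N 1 76 [N 1 93 [N 3 104 [N
    0 80 []]]]]]]]]]]]]]]]]]]]]]], N 3 23 [N 0 40 [N 0 20 [N 0 19 [N 3 115 [N 0 96 [N 3 104 [N
    0 81 []]]]]]]]], N 3 109 [N 1 31 [N 3 20 [N 0 43 [N 0 87 [N 3 105 [N 0 81 []]]]]]]], N 0 21
    [N 0 97 [N 0 40 [N 0 81 [N 3 105 [N 3 117 [N 2 6 [N 0 34 [N 3 23 [N 3 8 [N 2 107 [N 0 80 [N
    0 36 [N 1 1 []]]]]]]]]]]]]]], N 3 1 [N 2 119 [N 0 62 [N 0 19 [N 3 115 [N 2 6 [N 3 110 [N 1
    94 [N 2 107 [N 0 81 [N 0 43 [N 3 22 [N 0 37 [N 3 18 [N 0 28 [N 3 12 [N 1 1 [N 0 86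
    []]]]]]]]]]]]]]], N 2 6 [N 3 110 [N 0 98 [N 3 106 [N 0 22 [N 0 21 [N 0 40 [N 3 22 [N 1 34
    [N 3 15 [N 3 4 [N 3 112 [N 2 13 [N 0 41 [N 0 85 [N 3 101 [N 1 90 [N 0 93 [N 3 85 [N 0 68 [N
    1 51 [N 3 33 [N 0 57 [N 0 101 [N 0 25 [N 3 17 []]]]]]]]]]]]]]]]]]]]]]]]], N 3 115 [N 0 19
    [N 3 11 [N 3 23 [N 1 34 []]]]]]]]]], N 3 1 [N 0 28 [N 2 6 [N 3 20 [N 1 19 [N 3 117 [N 0 40
    [N 0 100 [N 3 110 [N 3 96 [N 0 84 [N 3 108 []]]]]]]]], N 0 32 [N 3 23 [N 3 12 [N 0 23 [N 3
    119 [N 3 10 [N 0 19 [N 3 117 [N 3 8 [N 1 19 [N 0 37 [N 0 76 [N 3 96 [N 3 114 [N 0 103 [N 3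
    111 []]]]]]]]]]]]]]], N 3 23 [N 0 31 [N 0 107 [N 3 115 [N 1 18 [N 3 7 [N 3 116 [N 1 19 [N 3
    8 [N 3 117 [N 0 21 [N 3 13 []]]]]]]]]]]]]]]]]], N 0 32 [N 0 76 [N 0 43 [N 3 23 [N 3 11 [N 3
    22 [N 3 1 [N 3 10 [N 3 21 [N 3 9 [N 3 20 [N 2 20 [N 0 113 [N 0 37 [N 2 25 [N 3 14 [N 3 3 [N
    0 115 [N 0 39 [N 3 31 [N 2 27 [N 3 16 [N 3 5 [N 3 26 [N 0 17 [N 0 117 [N 0 41 [N 1 24 [N 1
    53 [N 3 42 [N 1 19 [N 3 30 [N 3 41 [N 1 18 [N 3 29 [N 3 40 [N 1 17 [N 0 102 [N 3 114 [N 3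
    100 [N 3 113 [N 2 92 [N 3 110 [N 1 89 [N 3 103
    []]]]]]]]]]]]]]]]]]]]]]]]]]]]]]]]]]]]]]]]]], N 3 23 [N 2 16 [N 3 35 [N 3 24 [N 0 48 [N 3 37
    [N 2 36 [N 3 34 [N 0 51 [N 3 32 [N 1 43 [N 2 27 [N 0 40 [N 2 26 [N 0 38 [N 0 57 [N 0 100 [N
    3 4 [N 0 116 [N 3 20 [N 3 9 [N 0 106 [N 0 62 [N 3 48 [N 1 59 [N 2 46 [N 0 34 [N 3 26 [N 0
    50 [N 3 42 [N 3 31 [N 0 19 []]]]]]]]]]]]]]]]]]]]]]], N 1 34 [N 1 18 [N 3 7 [N 0 62 [N 2 45
    [N 0 33 [N 0 77 [N 0 58 [N 2 46 [N 0 34 [N 0 78 [N 0 59 [N 0 103 [N 3 4 [N 0 100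
    []]]]]]]]]]], N 3 54 [N 0 75 [N 0 94 [N 3 116 [N 0 103 []]]]]]]]]]]]]]]]]]], N 0 104 [N 3 1
    [N 3 12 [N 1 23 [N 0 40 [N 3 23 [N 3 11 [N 3 22 []]]]]]], N 0 114 [N 2 6 [N 0 100 [N 3 2 [N
    2 16 [N 3 1 [N 1 110 [N 3 13 [N 0 21 [N 0 40 [N 3 32 [N 0 56 [N 0 97 [N 0 53 [N 3 24 [N 3
    37 [N 0 45 [N 3 53 [N 0 74 [N 1 91 [N 3 111 [N 3 12 [N 1 1 []]]]]]]]]]]]]]]]]]], N 3 111 [N
    3 100 [N 1 89 [N 3 96 [N 0 72 [N 2 90 [N 0 62 [N 3 86 [N 3 107 [N 0 98 []]]]]]]]]]]], N 3
    23 [N 0 43 [N 2 20 [N 0 113 [N 3 1 [N 2 15 []]]]]]], N 0 38 [N 0 19 [N 3 11 [N 3 0 [N 0 103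
    [N 3 111 [N 0 95 []]]]], N 3 7 [N 3 1 [N 0 103 [N 0 62 [N 0 95 [N 3 115 [N 3 6 [N 3 105 [N
    0 82 [N 3 104 [N 0 80 [N 2 92 [N 2 104 [N 0 116 [N 3 4 [N 3 15 [N 2 26 [N 0 43
    []]]]]]]]]]]]], N 2 3 [N 0 61 [N 0 51 [N 3 33 [N 2 46 [N 3 35 [N 3 24 [N 2 13 [N 0 41 [N 3
    31 [N 3 42 [N 3 54 [N 1 68 [N 0 85 [N 0 43 []]]]]]]]]]]], N 3 42 [N 3 37 [N 3 16 [N 2 27 [N
    0 40 [N 3 24 [N 3 13 [N 3 34 [N 3 55 [N 0 75 [N 3 51 [N 3 62 [N 1 73 [N 3 50 [N 3 61 [N 1
    72 [N 3 49 [N 3 60 [N 1 71 [N 3 48 [N 3 59 [N 0 67 [N 3 75 [N 3 96 [N 0 86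
    []]]]]]]]]]]]]]]]]]]]]]]]]]]]], N 1 97 [N 3 111 [N 1 92 [N 3 106 [N 0 82 []]]]]]]]]]]]]], N
    3 10 [N 3 8 [N 0 19 [N 2 6 [N 0 114 [N 3 16 [N 2 20 [N 0 37 [N 2 19 [N 0 31 [N 3 7 [N 3 18
    [N 0 30 [N 0 106 [N 3 115 [N 0 105 [N 0 95 [N 3 104 [N 0 94 [N 3 102 [N 3 114 [N 3 5 [N 0
    117 [N 3 21 [N 0 13 [N 3 113 [N 2 92 [N 0 80 []]]]]]]]]]]]]]]]]]]]]]]], N 0 100 [N 0 114 [N
    3 2 [N 3 16 [N 0 113 [N 3 1 [N 0 25 [N 2 13 []]]]], N 3 111 [N 3 108 [N 0 99 [N 2 111 [N 2
    5 [N 3 16 [N 0 113 [N 3 1 [N 3 100 [N 0 84 [N 0 40 []]]]]]]]]]]], N 3 18 [N 0 29 [N 3 16 [N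
    3 5 [N 2 114 [N 0 98 [N 0 117 []]]]]]]], N 3 1 [N 0 113 [N 3 17 [N 1 28 [N 0 37 [N 0 31 [N
    0 107 [N 3 115 [N 3 6 [N 1 17 [N 0 30 [N 0 106 [N 3 114 [N 3 5 [N 3 16
    []]]]]]]]]]]]]]]]], N 3 1 [N 1 110 [N 3 13 [N 3 2 [N 1 111 [N 3 14 [N 3 3 [N 1 112 [N 3 15
    [N 3 4 [N 1 113 [N 3 16 [N 3 5 [N 1 114 [N 2 19 [N 0 40 [N 0 116
    []]]]]]]]]]]]]]]]]]]]]]]]])] =
   Some
    [[(18, 44), (17, 35), (12, 28), (8, 24)], [(17, 35), (16, 30), (13, 25), (11, 23)], [(12, 28), (13, 25), (12, 22), (11, 21)], [(8, 24), (11, 23), (11, 21), (11, 21)]]"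
  by code_simp

lemma saturate_seven_4:
  "saturate 120 (replicate 5 [])
    [[(18, 44), (17, 35), (12, 28), (8, 24)], [(17, 35), (16, 30), (13, 25), (11, 23)], [(12, 28), (13, 25), (12, 22), (11, 21)], [(8, 24), (11, 23), (11, 21), (11, 21)]]
    [(2, 2, 23, N 0 28 [N 0 10 [N 0 104 [N 0 108 [N 0 2 [N 3 10 [N 0 25 [N 0 20 [N 3 2 [N 2 16
    [N 3 119 [N 0 111 [N 2 118 [N 2 116 [N 0 35 [N 0 13 [N 2 1 [N 0 115 [N 2 22 [N 3 11 [N 0 97
    [N 0 17 [N 1 0 [N 3 109 [N 0 103 [N 1 18 [N 1 2 [N 0 90 [N 3 98 [N 1 1 []]]]]]]]]]]]]], N 3
    21 [N 3 34 [N 0 42 []]]], N 3 11 [N 1 1 [N 0 44 [N 3 34 [N 0 43 [N 3 19 [N 2 8 [N 0 116 [N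
    0 98 [N 0 18 [N 3 26 [N 0 34 [N 2 22 []]]]]]]]]], N 3 34 [N 3 20 [N 2 9 [N 0 117 [N 0 99 [N
    3 109 [N 0 88 [N 3 105 [N 0 81 [N 0 53 []]]]]]]]]]]]]]]]]]], N 2 16 [N 0 44 [N 3 34 [N 0 43
    [N 3 19 [N 3 21 [N 0 11 [N 3 35 [N 3 20 [N 0 12 [N 3 4 [N 0 35 [N 0 116 [N 3 9 [N 3 118 [N
    0 110 [N 0 33 [N 0 111 []]]]]], N 2 9 [N 0 117 [N 0 99 [N 0 13 [N 3 5 [N 0 29 [N 0 72 [N 3
    52 [N 1 63 [N 2 56 [N 3 45 [N 0 55 []]]]]]]]]]]]]]]]]]]]]], N 3 34 [N 3 21 [N 3 20 [N 0 12
    [N 0 35 [N 0 1 [N 3 9 [N 3 118 [N 0 110 [N 0 33 [N 0 111 []]]]]], N 2 9 [N 0 117 [N 0 99 [N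
    0 56 [N 1 32 [N 3 9 [N 0 1 [N 2 29 [N 0 17 []]]]]]]]]]]]]]]]], N 3 12 [N 3 1 [N 0 112 [N 2
    1 [N 3 2 [N 3 16 [N 0 36 [N 0 14 [N 3 22 [N 3 34 [N 1 45 []]]]]]]]]]]], N 3 12 [N 2 1 [N 2
    13 [N 3 2 [N 0 22 [N 0 13 [N 3 5 [N 0 117 [N 0 98 []]], N 3 109 [N 0 101 [N 3 5 [N 0 117
    []]]]]]]]]]]], N 3 10 [N 0 25 [N 0 44 [N 3 20 [N 3 2 [N 3 34 [N 0 43 [N 0 119 [N 3 7 [N 0
    35 [N 3 21 [N 0 13 [N 3 5 [N 0 117 [N 3 18 [N 0 41 [N 2 29 [N 1 24 [N 0 57 [N 0 101 [N 0 15
    []]]]]]]]]]], N 3 18 [N 0 114 [N 0 32 [N 3 21 [N 0 13 [N 3 5 [N 0 117 []]]]]]]]]]]]]], N 3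
    20 [N 3 34 [N 0 19 [N 1 37 [N 3 19 [N 2 15 [N 0 3 [N 2 31 [N 0 54 [N 0 98 [N 0 116 [N 3 4
    [N 0 115 [N 3 3 [N 0 99 [N 3 109 [N 0 94 [N 0 50 [N 2 22 [N 0 36 [N 3 12 [N 0 4 [N 2 112 [N
    0 86 []]]]]]]]]]]]]]]]]]]]]]]]], N 3 12 [N 2 1 [N 0 4 [N 0 48 [N 0 44 [N 3 34 [N 0 26 [N 3
    18 [N 1 118 [N 3 9 [N 2 20 [N 2 32 [N 0 54 [N 3 46 [N 3 35 [N 0 59 [N 3 50 [N 3 39 [N 0 60
    []]]]]]]]]]]]]], N 3 20 [N 0 35 [N 3 21 [N 0 13 [N 3 5 [N 0 117 [N 3 19 [N 0 27 [N 3 35 [N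
    3 18 [N 0 26 [N 0 102 [N 3 17 [N 3 6 [N 0 118 [N 0 42 [N 2 30 [N 0 58 [N 3 49 [N 0 57
    []]]]]]]]]]]]]]]]]], N 3 18 [N 0 26 [N 3 2 [N 0 114 [N 1 29 [N 0 12 [N 3 4 [N 0 116
    []]]]]]]]]]]]]]]], N 0 25 [N 0 44 [N 3 21 [N 0 32 [N 3 20 [N 3 2 [N 0 112 [N 0 36
    []]]]]], N 3 20 [N 3 34 [N 0 43 [N 2 15 [N 3 36 [N 0 116 [N 3 4 [N 0 101 [N 3 109 [N 0 88
    [N 3 112 [N 0 16 [N 0 60 [N 3 40 [N 0 64 [N 2 45 [N 2 88 [N 0 72 [N 2 60 [N 0 35
    []]]]]]]]]]]]]]]]]]]]], N 3 12 [N 2 1 [N 2 13 [N 0 35 [N 3 21 [N 1 118 [N 3 9 [N 3 20 [N 0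
    116 [N 3 8 [N 3 19 [N 0 115 [N 2 7 [N 3 4 [N 3 15 [N 2 15 [N 0 27 [N 3 3 [N 2 14 [N 0 26 [N
    3 2 [N 0 111 [N 0 44 [N 0 7 [N 3 119 [N 3 108 [N 0 99 []]]]]]]]]]]]]]]]]]]]]]], N 3 21 [N 3
    2 [N 0 114 [N 0 29 []]]]]]]]]]], N 3 2 [N 0 13 [N 3 5 [N 1 19 [N 3 8 [N 2 6 [N 2 2 [N 0 26
    [N 2 14 [N 0 0 [N 3 109 [N 0 98 []]]]]]]]]], N 3 5 [N 1 19 [N 3 8 [N 2 2 [N 0 26 [N 2 14 [N
    0 0 [N 3 109 [N 0 98 []]]]]]]]]], N 0 13 [N 0 98 [N 3 109 [N 0 119 [N 3 8 [N 0 118 [N 2 10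
    [N 3 119 [N 2 16 [N 0 111 [N 0 35 []]]]]]], N 3 8 [N 0 0 [N 0 117 [N 3 5 [N 2 16 [N 0 44 [N
    3 34 [N 3 21 [N 3 10 [N 0 2 [N 2 30 [N 0 54 [N 0 35 []]]]]]]]]]]]]]], N 3 109 [N 0 119 [N 3
    10 [N 3 118 [N 3 114 [N 0 90 [N 3 98 [N 3 113 [N 0 89 [N 3 97 [N 3 108 [N 0 116 [N 1 13 [N
    0 72 [N 3 82 [N 0 70 [N 0 88 [N 3 96 [N 3 107 [N 0 66 [N 2 78 [N 0 65 [N 1 82 [N 1 98 [N 0
    115 [N 2 87 [N 0 75 [N 0 57 [N 0 30 []]]]]]]]]]]]]]]]]]]]]]]]]]], N 3 10 [N 0 2 [N 3 114 [N
    0 90 []]]]]]], N 3 5 [N 2 1 [N 0 115 [N 3 19 [N 3 12 [N 1 1 [N 0 36 [N 1 19 [N 1 3 [N 0 38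
    [N 0 20 []]]]]]]], N 3 19 [N 0 35 [N 2 22 [N 1 18 [N 3 7 [N 0 119 [N 0 17 [N 3 9 [N 0 1 [N
    0 44 [N 0 26 [N 3 11 [N 0 3 [N 0 105 [N 2 13 []]]]], N 3 36 [N 0 50 [N 3 41 [N 1 9 [N 0 26
    [N 3 34 [N 0 8 [N 3 16 [N 3 27 [N 0 7 [N 0 25 [N 0 101 [N 3 109 [N 1 97 [N 3 108 [N 0 84 [N
    0 66 [N 1 85 [N 0 68 [N 2 56 [N 3 45 [N 0 57 []]]]]]]]]]]]]]]]]]]]]]]]]]]]]], N 2 12 [N 0 0
    [N 3 20 [N 0 26 [N 0 44 [N 3 36 [N 0 25 [N 0 101 [N 3 109 [N 0 100 [N 0 56 [N 0 86
    []]]]]]]]]]]]]]]]]]]]]]])] =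
   Some
    [[(18, 44), (17, 35), (12, 28), (8, 24)], [(17, 35), (16, 30), (13, 25), (11, 23)], [(12, 28), (13, 25), (12, 23), (11, 21)], [(8, 24), (11, 23), (11, 21), (11, 21)]]"
  by code_simp

lemma saturate_seven_5:
  "saturate 120 (replicate 5 [])
    [[(18, 44), (17, 35), (12, 28), (8, 24)], [(17, 35), (16, 30), (13, 25), (11, 23)], [(12, 28), (13, 25), (12, 23), (11, 21)], [(8, 24), (11, 23), (11, 21), (11, 21)]]
    [(2, 2, 24, N 0 28 [N 0 117 [N 3 12 [N 0 116 [N 0 36 [N 2 23 [N 2 1 [N 0 108 [N 0 13 [N 3 5
    [N 1 23 [N 0 41 [N 1 15 [N 0 4 [N 1 39 [N 0 48 [N 3 38 [N 0 51 [N 2 36 [N 0 8 [N 0 25 [N 0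
    101 [N 3 109 [N 0 95 [N 3 108 [N 0 84 [N 0 57 []]]]]]]]]]]]]]]]]], N 3 5 [N 2 16 [N 0 4 [N
    0 48 [N 3 37 [N 0 51 [N 1 15 [N 3 38 [N 0 105 [N 0 18 [N 3 4 [N 2 15 [N 0 27 [N 3 35 [N 2
    46 [N 0 62 [N 0 90 [N 3 109 [N 0 101 [N 1 84 [N 3 100 [N 2 89 [N 2 77 [N 0 77 [N 3 66 [N 0
    58 []]]]]]]]]]]]]]]]]]]]]]]]]]], N 3 10 [N 0 18 [N 0 106 [N 0 4 [N 3 5 [N 0 13 [N 3 21 [N 3
    4 [N 2 15 [N 0 27 [N 0 45 [N 3 35 [N 0 11 []]]]]]]]]]]]]], N 0 108 [N 0 13 [N 3 5 [N 3 4 [N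
    3 21 [N 0 12 [N 0 20 [N 0 99 [N 3 109 [N 0 18 [N 3 10 [N 0 2 [N 1 105 [N 1 37 [N 0 4 [N 2
    112 [N 0 88 [N 0 44 []]]]]]]]]]], N 0 107 [N 0 106 [N 0 4 [N 0 48 [N 3 37 [N 0 52 [N 2 40
    [N 3 28 [N 0 47 [N 0 46 [N 0 2 [N 3 10 [N 0 18 [N 0 95 [N 3 116 [N 3 114 [N 3 109 [N 1 98
    [N 0 93 [N 2 105 [N 0 90 [N 3 98 [N 0 81 [N 0 63 [N 2 48 [N 0 61 [N 0 17 [N 2 109 [N 0 1 [N
    0 77 [N 3 55 [N 3 73 [N 3 87 []]]]]]]]]]]]]]]]]]]]]]]]]]]]]]]]]]]]]], N 3 21 [N 3 10 [N 1
    119 [N 0 2 [N 0 104 [N 1 10 [N 0 45 [N 1 25 [N 2 12 [N 0 27 [N 2 15 [N 0 107 [N 0 5 [N 0 46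
    [N 3 22 [N 3 1 [N 3 109 [N 1 98 []]]]]]]]]]]]]]]]]]], N 2 16 [N 1 23 [N 0 41 [N 1 13 [N 0 4
    [N 1 39 [N 0 48 [N 3 37 [N 0 13 [N 2 36 [N 0 8 [N 0 25 [N 0 101 [N 3 109 [N 1 97 [N 3 108
    [N 0 84 [N 0 57 []]]]]]]]]]]]]]]]]]]]], N 0 0 [N 2 9 [N 3 20 [N 0 4 [N 0 104 [N 3 5 [N 3 16
    [N 2 16 [N 3 4 [N 3 15 [N 2 1 [N 0 108 [N 0 13 [N 3 26 [N 0 34 [N 0 32 [N 3 24 [N 3 13 [N 2
    2 [N 0 110 []]]]]]], N 3 21 [N 0 12 [N 3 3 [N 3 14 [N 0 22 [N 3 118 [N 0 110 [N 0 34 [N 0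
    112 []]]]]]]]]]]]]]]]], N 2 12 [N 0 20 [N 0 44 [N 2 16 [N 1 11 [N 0 114 [N 0 72 []]]], N 2
    32 [N 0 101 [N 3 5 [N 2 16 [N 0 16 [N 0 14 [N 3 4 [N 3 15 [N 3 26 [N 0 34 [N 2 1 [N 0 108
    [N 0 32 [N 3 24 [N 3 13 [N 2 2 [N 0 110 []]]]]]]]]]]]]]], N 0 57 [N 3 36 [N 3 48 [N 0 56 [N
    0 12 [N 3 21 [N 0 45 [N 2 33 [N 3 22 [N 0 46 [N 2 34 [N 3 23 [N 0 47 [N 2 35 [N 3 24 [N 2
    13 [N 2 36 [N 0 48 []]]]]]]]]]]]]]]]], N 3 36 [N 3 48 [N 0 56 [N 0 12 [N 3 109 [N 3 5 [N 2
    16 [N 3 4 [N 3 15 [N 3 26 [N 0 34 [N 2 1 [N 0 108 [N 0 32 [N 3 24 [N 3 13 [N 2 2 [N 0 110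
    []]]]]]]]]]]]]]]]]]]]]], N 3 9 [N 0 18 [N 0 38 []]]]]]]], N 3 20 [N 2 8 [N 2 23 [N 0 37 [N
    0 112 [N 0 35 [N 0 44 [N 1 23 [N 0 25 [N 0 23 [N 0 21 [N 0 20 [N 0 29 [N 3 21 [N 2 10 [N 0
    30 [N 0 12 [N 3 36 [N 2 18 [N 0 46 [N 2 33 [N 3 22 [N 3 11 [N 3 0 [N 0 108 []]]]]]]], N 3 4
    [N 0 108 [N 3 3 [N 0 99 [N 3 109 [N 0 88 [N 2 108 [N 0 81 [N 3 103 [N 0 79 [N 3 88 [N 3 99
    [N 0 75 [N 2 87 [N 3 98 []]]]]]]]]]]]]]]], N 3 10 [N 0 2 [N 0 108 [N 2 3 [N 2 15 [N 0 107
    [N 0 5 [N 0 11 [N 3 3 [N 1 105 [N 0 88 [N 3 109 [N 0 101 []]]]]]]]]]]]]]]], N 3 9 [N 0 1 [N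
    0 108 [N 2 7 [N 2 3 [N 2 15 [N 0 107 [N 0 5 [N 2 1 [N 2 13 [N 0 105 [N 0 3 [N 3 11 [N 0 19
    [N 0 11 [N 3 3 [N 1 104 [N 0 87 [N 3 109 [N 0 99 []]]]]]]]]]]]]]]]]]]]]]]]]], N 1 9 [N 0
    111 [N 0 108 [N 0 32 [N 3 21 [N 3 10 [N 1 10 [N 3 119 [N 0 20 []]]]]]]]]]], N 1 9 [N 0 44
    [N 0 20 [N 0 11 [N 3 3 [N 0 108 [N 0 9 [N 0 102 [N 0 101 [N 3 109 [N 0 13 [N 3 36 [N 0 57
    [N 2 32 [N 0 5 [N 0 81 [N 3 105 [N 0 85 []]]]]]]]]]]]]]]]]]]]]]]], N 3 20 [N 3 9 [N 1 24 [N
    0 41 [N 1 23 [N 0 23 [N 2 9 [N 0 108 [N 0 10 [N 2 23 [N 0 11 [N 3 3 [N 0 99 [N 3 109 [N 0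
    13 [N 2 1 [N 2 98 [N 0 85 [N 0 67 [N 0 57 [N 3 44 [N 3 35 [N 0 43 [N 2 55 [N 3 34 [N 2 45
    [N 2 22 [N 0 34 [N 3 10 [N 3 21 [N 0 29 []]]]]]]]]]]]]]]]]]]]]]]]]]]]]]]]], N 0 36 [N 2 23
    [N 3 10 [N 0 18 [N 3 9 [N 3 20 [N 3 7 [N 0 15 [N 3 6 [N 3 17 [N 0 25 [N 3 5 [N 2 11 [N 0
    101 [N 3 4 [N 3 15 [N 0 23 [N 0 12 [N 3 3 [N 0 99 []]]]]], N 2 1 [N 0 13 [N 3 109 [N 1 98
    [N 0 12 [N 3 4 [N 3 15 [N 0 23 [N 2 115 [N 0 91 [N 0 52 [N 3 36 [N 1 47 [N 3 24 [N 2 35 [N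
    3 14 [N 0 22 [N 2 34 [N 3 23 [N 0 47 []]]]]]]]]]]]]]]]]]]]]]]]]]]]]]]]], N 3 20 [N 2 9
    []]]]]]])] =
   Some
    [[(18, 44), (17, 35), (12, 28), (8, 24)], [(17, 35), (16, 30), (13, 25), (11, 23)], [(12, 28), (13, 25), (12, 24), (11, 21)], [(8, 24), (11, 23), (11, 21), (11, 21)]]"
  by code_simp

lemma saturate_seven_6:
  "saturate 120 (replicate 5 [])
    [[(18, 44), (17, 35), (12, 28), (8, 24)], [(17, 35), (16, 30), (13, 25), (11, 23)], [(12, 28), (13, 25), (12, 24), (11, 21)], [(8, 24), (11, 23), (11, 21), (11, 21)]]
    [(0, 0, 17, N 0 24 [N 2 12 [N 0 119 [N 0 32 [N 3 23 [N 0 36 [N 3 10 [N 0 18 [N 0 100 [N 0 60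
    [N 2 36 [N 0 61 [N 0 105 [N 3 4 [N 3 25 [N 2 14 [N 2 38 [N 3 26 [N 2 5 []]]]]]]]], N 2 36
    [N 0 61 [N 0 105 [N 3 4 [N 3 25 [N 3 3 [N 2 14 [N 0 42 []]]]]]]]], N 3 1 [N 1 110 [N 0 113
    [N 0 37 [N 0 94 [N 3 114 [N 3 5 [N 3 104 [N 0 81 [N 3 102 [N 3 113 [N 3 4 [N 3 15 [N 0 23
    [N 0 99 [N 2 111 [N 3 3 [N 3 14 [N 2 25 [N 0 42 []]]]]]]]]]]]]]], N 0 76 [N 0 61 [N 2 36 [N
    2 24 [N 3 13 [N 3 2 [N 0 114 [N 0 38 [N 0 20 [N 0 55 [N 3 34 [N 0 43 [N 3 53 [N 1 72 [N 0
    64 [N 1 47 [N 3 36 [N 2 25 [N 3 14 [N 3 3 [N 2 112 [N 3 100 [N 0 89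
    []]]]]]]]]]]]]]]]]]]]]]]]]]]]], N 2 36 [N 0 43 [N 3 35 [N 0 47 [N 3 39 [N 3 28 [N 3 34 [N 2
    45 [N 0 60 [N 0 104 [N 3 6 [N 0 102 [N 1 0 [N 0 100 []]]]]]]]]]]]]]], N 2 24 [N 1 119 [N 0
    118 [N 0 18 [N 3 6 [N 0 102 [N 0 43 [N 3 35 [N 1 49 [N 3 38 [N 0 61 []]]]]]], N 2 119 [N 0
    107 []]]]]]], N 0 76 [N 0 43 [N 0 100 [N 0 58 [N 3 35 [N 3 22 [N 3 33 [N 0 56 []]]]], N 0
    112 [N 3 4 [N 3 22 [N 3 1 []]], N 3 16 [N 3 4 [N 0 116 [N 3 20 [N 3 9 [N 0 105 [N 3 113 [N
    3 100 [N 0 92 [N 3 102 [N 0 94 []]]]]]]]]]]]]], N 0 116 [N 0 113 [N 0 100 [N 3 4 [N 1 110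
    [N 2 3 [N 0 111 [N 0 105 [N 0 61 [N 0 23 [N 0 99 [N 0 55 [N 0 22 [N 0 40 [N 3 32 [N 3 21 [N
    3 10 [N 3 119 [N 3 108 [N 0 97 [N 3 105 [N 0 81 []]]]]]]]]]]]]]]]]]], N 3 4 [N 3 22 [N 3 1
    []]]]]]]]], N 0 112 [N 2 5 [N 3 16 [N 3 1 [N 0 101 [N 3 110 [N 0 99 [N 0 97 [N 3 105 [N 0
    22 [N 0 40 [N 3 32 [N 0 56 [N 0 81 []]]]]]]]]]]], N 3 23 [N 0 31 [N 0 107 [N 3 16 [N 2 3 [N
    0 100 [N 0 18 [N 0 60 [N 0 104 [N 3 0 [N 3 11 [N 3 22 [N 0 30 [N 0 106 [N 3 114 []]]]]]], N
    0 40 [N 3 26 [N 3 41 [N 3 22 [N 0 30 [N 3 38 [N 3 19 [N 1 30 [N 0 47 [N 3 32 [N 0 76 [N 3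
    52 [N 0 65 []]]]]]]]]]]]]], N 0 106 [N 3 114 [N 2 15 [N 0 43 [N 3 35 [N 0 59 [N 0 36
    []]]]]]]], N 3 2 [N 3 13 [N 0 21 [N 3 119 [N 3 12 [N 0 20 [N 3 116 [N 3 9 [N 3 22 [N 0 30
    [N 0 106 [N 3 114 [N 0 18 []]]]]]]]]]]]]]]]]]]], N 3 16 [N 2 5 [N 0 113 [N 3 10 [N 3 9 [N 2
    20 [N 0 37 [N 0 18 [N 3 26 [N 0 40 [N 3 8 [N 2 19 [N 0 31 [N 3 7 [N 2 18 [N 0 30 [N 0 106
    [N 3 114 [N 3 5 [N 0 117 [N 3 21 [N 0 29 [N 3 37 [N 1 49 [N 3 38 [N 3 27 [N 1 50 [N 3 39 [N
    3 28 [N 1 51 [N 3 40 [N 3 29 [N 1 52 [N 3 41 [N 3 30 [N 0 54 [N 0 94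
    []]]]]]]]]]]]]]]]]]]]]]]]]]]]]]]]]]]]]]]]]])] =
   Some
    [[(17, 44), (17, 35), (12, 28), (8, 24)], [(17, 35), (16, 30), (13, 25), (11, 23)], [(12, 28), (13, 25), (12, 24), (11, 21)], [(8, 24), (11, 23), (11, 21), (11, 21)]]"
  by code_simp

lemma saturate_seven_7:
  "saturate 120 (replicate 5 [])
    [[(17, 44), (17, 35), (12, 28), (8, 24)], [(17, 35), (16, 30), (13, 25), (11, 23)], [(12, 28), (13, 25), (12, 24), (11, 21)], [(8, 24), (11, 23), (11, 21), (11, 21)]]
    [(0, 0, 16, N 2 12 [N 0 24 [N 0 119 [N 0 32 [N 3 23 [N 0 34 [N 3 9 [N 0 17 [N 0 100 [N 0 76
    [N 2 4 [N 3 25 [N 3 7 [N 0 103 [N 3 3 [N 1 112 [N 0 115 [N 3 113 [N 3 100 [N 0 92 [N 3 102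
    [N 0 93 []]]]]]]]]]], N 3 25 [N 2 36 [N 0 60 [N 0 104 []]]]], N 1 111 [N 3 4 [N 3 25 [N 2
    36 [N 0 60 [N 0 104 []]]]]]], N 3 1 [N 0 113 [N 0 37 [N 0 93 [N 0 60 [N 2 36 [N 3 25 [N 0
    49 []]]], N 3 113 [N 3 4 [N 3 103 [N 0 81 [N 3 101 [N 3 112 [N 3 3 [N 3 14 [N 2 25 [N 0 41
    []]]]]]]]]]]]]]], N 2 36 [N 0 43 [N 0 60 [N 0 104 [N 3 6 [N 0 102 []]]]]]], N 0 17 [N 3 8
    [N 0 43 [N 3 35 [N 3 24 [N 1 47 [N 3 36 [N 0 60 [N 0 104 [N 3 6 [N 0 102 []]]]]]]]]], N 2
    118 [N 0 106 []]]], N 3 12 [N 3 11 [N 3 22 [N 0 118 [N 0 76 [N 0 43 [N 3 33 [N 1 51 [N 1 22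
    [N 0 19 [N 2 31 [N 0 59 [N 0 102 [N 3 6 [N 3 20 [N 3 119 [N 0 111 [N 2 17 []]]]]]]]]]]]], N
    0 113 [N 3 1 [N 0 104 [N 0 102 [N 3 6 [N 0 60 [N 0 23 [N 0 99 [N 0 57 [N 3 33 [N 2 44 [N 2
    20 [N 2 117 [N 3 8 [N 2 19 [N 2 115 [N 0 103 [N 3 7 [N 2 116 []]]]]]]]]]]]]]]]]]]]]]]]]], N
    0 110 [N 2 4 [N 3 16 [N 3 1 [N 0 102 [N 3 110 [N 0 99 [N 3 108 [N 3 119 [N 0 96 [N 3 104 [N
    1 17 [N 0 40 [N 3 32 [N 0 56 [N 0 80 []]]]]]]]]]]]]], N 3 23 [N 0 31 [N 0 107 [N 3 16 [N 2
    3 [N 0 100 [N 0 17 [N 0 76 [N 0 34 [N 0 104 [N 3 113 [N 0 102 [N 3 6 [N 3 115 [N 2 104 [N 2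
    92 [N 0 78 [N 3 102 [N 0 94 [N 0 60 []]]]]]]]]], N 3 5 [N 3 114 [N 0 106 [N 0 30 [N 3 22 [N
    3 11 [N 3 0 []]]]]]]], N 3 11 [N 3 22 [N 0 30 [N 0 106 [N 3 10 [N 3 21 [N 0 29 [N 3 5 [N 3
    114 [N 0 104 [N 0 60 []]]]]]]]]]]], N 0 59 [N 0 56 [N 0 40 [N 3 32 [N 3 11 [N 3 22 [N 0 30
    [N 0 106 [N 2 43 [N 0 55 [N 3 31 [N 3 10 [N 3 21 [N 0 29 [N 3 5 [N 3 114 [N 0 104 [N 0 60
    [N 3 37 []]]]]]]]]]]]]]]]]]]], N 1 34 [N 0 60 [N 0 104 []]]], N 3 2 [N 3 13 [N 0 21 [N 3
    119 [N 3 12 [N 0 20 [N 3 116 [N 3 9 [N 3 22 [N 0 30 [N 0 106 [N 3 21 [N 0 29 [N 3 5 [N 3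
    114 [N 0 17 []]]]]]]]]]]]]]]]]]]]]]], N 3 14 [N 3 11 [N 3 10 [N 3 9 [N 0 17 [N 0 34 [N 0 93
    [N 0 76 [N 2 4 [N 3 16 [N 0 115 [N 3 3 [N 3 102 [N 0 78 [N 3 100 [N 3 1 [N 0 112
    []]]]]]]], N 3 25 [N 0 49 [N 3 26 [N 3 15 [N 3 36 [N 0 28 [N 3 20 [N 3 35 [N 0 43 [N 2 15
    []]]]]]]]]]]], N 0 76 [N 0 100 [N 3 3 [N 1 112 [N 3 15 [N 3 4 [N 3 113 [N 1 102 [N 0 105 [N
    3 97 [N 3 110 [N 0 118 [N 3 6 [N 2 18 [N 0 30 [N 0 106 [N 3 114 [N 3 5 [N 3 16 [N 0 112
    []]]]]]]]]]]]]]]]]], N 3 113 [N 2 4 [N 3 16 [N 0 115 [N 3 3 [N 0 99 [N 3 107 [N 3 96 [N 1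
    85 [N 3 101 [N 3 112 [N 2 3 [N 1 28 [N 3 17 [N 0 41 [N 3 33 [N 0 56 []]]]]]]]]]]]]]]]]], N
    2 4 [N 3 16 [N 2 1 [N 2 109 [N 0 97 [N 3 1 [N 0 112 []]]]]], N 3 113 [N 0 105 [N 3 97 [N 1
    86 [N 3 109 [N 0 118 [N 3 6 [N 3 106 [N 0 116 [N 3 5 [N 3 104 [N 0 112 []]]]]]]]]]]]]]]], N
    3 7 [N 2 18 [N 0 34 []]]]]]]]]]]]])] =
   Some
    [[(16, 44), (17, 35), (12, 28), (8, 24)], [(17, 35), (16, 30), (13, 25), (11, 23)], [(12, 28), (13, 25), (12, 24), (11, 21)], [(8, 24), (11, 23), (11, 21), (11, 21)]]"
  by code_simp

lemma saturate_seven_8: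
  "saturate 120 (replicate 5 [])
    [[(16, 44), (17, 35), (12, 28), (8, 24)], [(17, 35), (16, 30), (13, 25), (11, 23)], [(12, 28), (13, 25), (12, 24), (11, 21)], [(8, 24), (11, 23), (11, 21), (11, 21)]]
    [(2, 2, 25, N 0 13 [N 0 108 [N 3 5 [N 0 117 [N 0 101 [N 3 109 [N 3 4 [N 0 12 [N 2 1 [N 0 97
    [N 0 93 [N 2 105 [N 0 25 [N 2 9 [N 1 7 [N 0 92 [N 2 104 [N 0 9 [N 3 1 [N 0 37 [N 3 20 [N 0
    28 [N 3 12 [N 2 24 []]]], N 3 21 [N 3 10 [N 0 2 [N 3 110 [N 3 22 [N 3 11 [N 0 3 [N 3 115 [N
    0 91 [N 0 47 [N 0 31 [N 3 23 [N 3 12 [N 3 112 [N 3 3 [N 0 11 [N 3 19 [N 0 28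
    []]]]]]]]]]]]]]]]]]]]]]]]], N 0 28 [N 3 17 [N 3 6 [N 0 118 [N 0 102 [N 0 26 [N 3 18 [N 3 7
    [N 0 119 [N 0 103 [N 0 27 [N 3 19 [N 3 8 [N 0 0 [N 0 104 []]]]]]]]]]]]]], N 3 20 [N 0 41 [N
    0 9 [N 0 85 [N 0 69 [N 3 93 [N 2 82 [N 0 70 [N 0 65 [N 0 21 [N 0 37 [N 0 53 [N 3 45 [N 3 62
    [N 3 77 []]]]]]]]]]]]]]]]]]]]]]]]], N 0 25 [N 0 28 [N 2 16 [N 0 29 [N 0 37 [N 3 21 [N 3 10
    [N 0 2 [N 0 32 [N 3 24 [N 3 13 [N 2 2 [N 0 110 [N 0 34 [N 3 26 [N 3 15 [N 3 4 [N 0 116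
    []]]]]]]]]]]]], N 2 10 [N 3 109 [N 0 101 [N 2 9 []]]]]]], N 3 17 [N 3 16 [N 3 12 [N 2 1 [N
    0 105 [N 0 4 [N 2 13 [N 1 38 [N 3 27 [N 0 36 [N 3 21 [N 0 45 [N 3 37 [N 0 61 [N 0 89 [N 3
    109 [N 0 101 [N 0 85 [N 3 100 [N 2 89 [N 0 77 []]]]]]]]]]]]]]]]]]]]]], N 0 101 [N 3 109 [N
    0 92 [N 0 12 [N 0 28 [N 3 20 [N 0 41 [N 2 15 [N 0 3 [N 0 44 [N 3 36 [N 0 57 [N 0 88
    []]]]]]]]], N 3 4 [N 0 100 [N 0 56 [N 0 29 [N 3 21 [N 3 36 [N 0 44 []]]]]]]]]]]]]]]]),
    (0, 0, 45, N 0 17 [N 3 36 [N 0 44 [N 3 25 [N 0 12 [N 0 28 [N 3 20 [N 0 1 [N 3 9 [N 0 33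
    []]]], N 3 20 [N 0 1 [N 3 9 [N 1 32 [N 0 33 [N 0 88 [N 3 112 [N 3 108 [N 2 108 [N 0 61 [N 3
    37 [N 0 105 [N 0 104 [N 3 8 [N 3 2 [N 0 10 [N 3 18 [N 3 117 [N 3 106 [N 1 95 [N 0 77 [N 3
    57 [N 0 81 [N 1 64 [N 3 87 [N 0 95 []]]]]]]]]]]]]]]]]]]], N 3 112 [N 0 104 [N 3 8 [N 0 116
    [N 3 108 [N 2 108 [N 0 77 [N 3 57 [N 3 68 [N 0 76 [N 2 88 [N 0 100 [N 3 55 [N 3 54 [N 3 65
    [N 2 65 [N 2 90 [N 0 78 [N 2 66 [N 2 91 [N 0 79 [N 0 63 [N 3 53 [N 0 61 [N 3 37 [N 1 48 [N
    3 71 [N 0 95 [N 3 87 [N 3 76 [N 0 68 [N 3 92 [N 0 84 []]]]]]]]]]]]]]]]]]]]]]]]]], N 3 57 [N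
    0 81 [N 0 43 [N 0 59 [N 0 38 [N 3 46 [N 0 61 []]]]]]]]]]]]]]]]]]]]], N 0 28 [N 3 20 [N 3 35
    [N 0 11 [N 0 43 [N 3 19 [N 3 30 [N 0 6 [N 3 14 [N 0 38 []]]]]]]]], N 3 20 [N 0 61 [N 0 42
    [N 0 40 [N 0 56 [N 0 33 [N 3 41 [N 0 60 [N 3 52 [N 2 45 [N 0 72 [N 3 64 [N 3 53 [N 0 77 [N
    0 1 [N 0 88 [N 2 60 [N 0 32 [N 3 40 [N 3 19 [N 0 27 [N 3 35 [N 0 11 [N 0 87 [N 2 59 [N 0 31
    [N 3 39 [N 3 18 [N 0 26 [N 3 34 [N 0 10 [N 0 86 [N 2 58 [N 3 69 [N 0 93 [N 3 112 [N 3 101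
    []]]]]]]]]]]]]]]]]]]]]]]]]]]]]]]]]]], N 0 33 [N 0 1 [N 3 9 [N 0 109 [N 0 77 [N 3 53 [N 3 32
    [N 0 40 [N 0 56 [N 3 48 [N 0 72 [N 3 64 [N 2 60 [N 0 88 [N 3 80 [N 3 69 [N 0 93 [N 3 85 [N
    3 74 [N 3 93 [N 2 104 [N 3 117 []]]]]]]]]]]]]]]]], N 3 53 [N 0 72 [N 3 64 [N 0 40 [N 0 56
    [N 3 48 [N 2 59 []]]]]]]]]]], N 0 56 [N 3 48 [N 0 27 [N 3 35 [N 3 46 [N 0 23 [N 3 34 [N 3
    45 [N 0 21 [N 3 30 [N 3 41 []]]]]]]]]]]]]]]]]]]])] =
   Some
    [[(16, 45), (17, 35), (12, 28), (8, 24)], [(17, 35), (16, 30), (13, 25), (11, 23)], [(12, 28), (13, 25), (12, 25), (11, 21)], [(8, 24), (11, 23), (11, 21), (11, 21)]]"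
  by code_simp

lemma saturate_seven_9:
  "saturate 120 (replicate 5 [])
    [[(16, 45), (17, 35), (12, 28), (8, 24)], [(17, 35), (16, 30), (13, 25), (11, 23)], [(12, 28), (13, 25), (12, 25), (11, 21)], [(8, 24), (11, 23), (11, 21), (11, 21)]]
    [(0, 0, 15, N 0 91 [N 0 107 [N 3 115 [N 0 16 [N 3 7 [N 0 104 [N 0 60 [N 0 32 [N 3 8 [N 2 117
    [N 1 22 [N 3 11 [N 2 119 [N 0 31 [N 3 20 [N 2 32 [N 0 44 [N 0 76 []]]]]]]]]], N 3 8 [N 0 59
    [N 0 75 [N 3 99 [N 3 83 [N 0 61 [N 3 117 [N 0 109 [N 3 112 [N 2 119 [N 0 31 [N 2 3 [N 2 16
    [N 0 28 [N 0 103 [N 0 58 [N 0 74 [N 0 90 [N 3 98 [N 0 45 [N 3 36 [N 0 44 [N 3 20 [N 3 9 [N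
    3 118 [N 0 110 [N 3 14 [N 1 26 [N 0 27 [N 3 35 [N 0 43 [N 0 118 [N 3 22 [N 3 11 [N 3 0 [N 2
    109 [N 0 97 [N 0 22 []]]]]]]]]]]]]]]]]]]]]]]]]]]]]]]]]]]]]]], N 0 19 [N 0 103 [N 0 32 [N 3
    11 [N 3 116 [N 0 108 [N 0 92 [N 2 0 [N 0 28 [N 2 16 [N 3 114 [N 3 5 [N 0 102 [N 0 118 [N 3
    110 [N 3 99 [N 0 75 [N 0 31 []]]]]]]]]]]]]]], N 0 119 [N 3 99 [N 0 75 []]]]]]], N 3 8 [N 3
    117 [N 3 6 [N 2 119 [N 0 27 [N 2 12 [N 3 1 [N 2 0 [N 0 28 [N 0 32 [N 0 75 [N 3 99 [N 2 110
    [N 1 118 [N 3 20 [N 0 33 [N 0 31 [N 2 3 [N 3 15 [N 3 14 [N 3 25 [N 2 37 [N 3 26 [N 0 50 [N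
    0 95 []]]]]]]]]]]]]]], N 3 20 [N 1 118 [N 0 29 [N 2 17 [N 0 109 []]]]]]]]]]]]]]]], N 0 104
    [N 3 8 [N 3 117 [N 0 109 [N 0 21 [N 3 6 [N 0 32 [N 3 13 [N 3 2 [N 0 114 [N 3 18 [N 0 26
    []]]]], N 1 117 [N 3 106 [N 0 119 [N 2 105 [N 0 77 [N 3 100 [N 3 111 [N 2 92
    []]]]]]]]]]]]]], N 3 114 [N 3 112 [N 2 116 [N 0 60 [N 0 26 [N 3 8 [N 2 117 [N 3 6 [N 0 102
    [N 0 119 [N 3 111 [N 3 99 [N 2 0 [N 0 108 [N 3 100 [N 2 1 [N 0 109 [N 3 12 [N 0 34 [N 0 79
    [N 3 101 [N 3 2 [N 0 114 [N 3 106 [N 1 87 [N 2 101 [N 2 3 []]]]]]]]]]]]]]]]]]]]]], N 0 32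
    [N 3 11 [N 2 119 [N 3 18 [N 0 119 [N 2 14 [N 3 3 [N 0 103 [N 3 111 [N 3 99 [N 0 87 [N 0 42
    []]]]]]]]]]], N 3 11 [N 3 116 [N 0 108 [N 0 31 [N 2 16 [N 3 5 [N 0 76 [N 1 102 [N 0 119 [N
    0 75 []]]]]]]]]]]], N 0 32 [N 3 8 [N 2 117 [N 0 119 [N 3 106 [N 1 95 [N 3 117 [N 2 106 [N 0
    78 [N 0 44 [N 0 88 []]]]]]], N 0 77 [N 3 99 [N 0 75 [N 0 31 [N 2 3 [N 2 105 [N 0 93 [N 3
    117 [N 0 109 [N 3 101 [N 2 1 [N 2 109 [N 1 95 [N 3 118 [N 0 110 [N 3 102 [N 0 78
    []]]]]]]]]]]]]]]]]]]], N 0 119 [N 0 103 [N 3 6 [N 3 105 [N 1 86 [N 2 107 [N 0 80 [N 0 44 [N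
    0 88 []]]]]]]]]]]]]]]]]]]]),
    (0, 0, 14, N 0 104 [N 3 6 [N 3 115 [N 0 15 [N 0 107 [N 0 91 [N 0 30 [N 0 119 [N 3 99 [N 0
    75 []]], N 0 119 [N 0 75 [N 3 99 [N 3 113 [N 3 111 [N 0 103 [N 3 4 [N 2 15 [N 0 27
    []]]]]]]]]], N 3 113 [N 3 112 [N 0 16 [N 0 30 [N 1 115 [N 0 119 [N 3 104 [N 1 89 [N 2 102
    [N 0 75 []]]]]], N 3 8 [N 0 119 [N 3 111 [N 0 103 [N 3 4 [N 2 15 [N 0 27 []]]]]]]]]]]], N 0
    19 [N 3 8 [N 0 27 [N 2 2 [N 2 1 [N 2 0 [N 3 11 [N 1 117 [N 0 93 [N 3 101 [N 0 32 [N 3 24 [N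
    0 48 [N 0 77 []]]]]]]]]]], N 2 12 [N 3 1 [N 2 0 [N 0 28 [N 0 31 [N 3 20 [N 1 117 [N 0 30 [N
    0 105 [N 3 114 [N 3 5 [N 3 16 [N 0 112 []]]]]]]], N 0 119 [N 3 23 [N 3 12 [N 2 1 [N 0 29 [N
    3 21 [N 0 30 [N 2 2 [N 3 16 [N 2 27 [N 0 39 []]]]]]]]]]]]]]]]]]]]]]]]),
    (0, 0, 46, N 3 23 [N 0 31 [N 0 1 [N 0 45 [N 0 15 [N 0 60 [N 0 30 [N 0 105 [N 3 9 [N 0 17
    []]]], N 3 37 [N 3 25 [N 0 17 [N 3 9 [N 0 106 [N 0 29 []]]]]]]]]]]]),
    (0, 0, 47, N 3 37 [N 0 15 [N 0 46 [N 0 61 [N 0 29 [N 0 1 [N 0 106 [N 0 104 [N 0 92 [N 3 112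
    [N 3 10 [N 0 18 []]]]]], N 3 25 [N 0 17 [N 3 24 [N 0 32 [N 3 9 [N 0 106 []]]]]]]]]]]]),
    (0, 0, 48, N 0 62 [N 0 33 [N 0 106 [N 0 17 [N 0 1 [N 3 9 [N 3 25 [N 0 47 [N 3 39 [N 0 31
    []]]]], N 3 9 [N 3 25 [N 0 47 []]]]]]]]),
    (0, 0, 49, N 0 63 [N 0 16 [N 0 48 [N 0 32 [N 3 40 [N 3 24 [N 0 2 [N 0 106 [N 3 10 [N 0 18
    []]]]]]]]]])] =
   Some
    [[(14, 49), (17, 35), (12, 28), (8, 24)], [(17, 35), (16, 30), (13, 25), (11, 23)], [(12, 28), (13, 25), (12, 25), (11, 21)], [(8, 24), (11, 23), (11, 21), (11, 21)]]"
  by code_simp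

text \<open>The edge distances 50 and 51 of the unit circle complete the clique of six points on
  which \<open>check_seven\<close> rests.\<close>

lemma saturate_seven_10:
  "saturate 120 (replicate 5 [])
    [[(14, 49), (17, 35), (12, 28), (8, 24)], [(17, 35), (16, 30), (13, 25), (11, 23)], [(12, 28), (13, 25), (12, 25), (11, 21)], [(8, 24), (11, 23), (11, 21), (11, 21)]]
    [(0, 0, 50, N 0 2 [N 0 18 [N 0 32 [N 0 106 [N 3 10 [N 0 34 [N 3 26 [N 0 49 [N 3 41 [N 0 65
    []]]]]]]]]]),
    (0, 0, 51, N 0 32 [N 0 16 [N 0 1 [N 0 106 [N 0 86 [N 0 36 [N 3 24 [N 3 13 [N 0 22 [N 0 92
    [N 0 42 []]]]]], N 0 50 [N 0 100 [N 0 30 [N 3 10 [N 3 110 [N 0 102 []]]]]]]]]]])] =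
   Some
    [[(14, 51), (17, 35), (12, 28), (8, 24)], [(17, 35), (16, 30), (13, 25), (11, 23)], [(12, 28), (13, 25), (12, 25), (11, 21)], [(8, 24), (11, 23), (11, 21), (11, 21)]]"
  by code_simp

text \<open>The points 0, 14, 33, 51, 83 and 102 of the unit circle form a clique, so their colors
  are all six. From there on the tree never branches: each further point has just one possible
  color, until none is left.\<close>

lemma check_seven:
  "check 120
    [[(14, 51), (17, 35), (12, 28), (8, 24)], [(17, 35), (16, 30), (13, 25), (11, 23)], [(12, 28), (13, 25), (12, 25), (11, 21)], [(8, 24), (11, 23), (11, 21), (11, 21)]]
    (replicate 6 [])
    (N 0 0 [N 0 33 [N 0 14 [N 0 83 [N 0 102 [N 0 51 [N 0 32 [N 0 101 [N 0 50 [N 0 119 [N 0 68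
    [N 0 19 [N 0 88 [N 0 37 [N 0 106 [N 0 63 [N 0 12 [N 0 81 [N 0 31 [N 0 100 [N 0 49 [N 3 57
    [N 0 65 []]]]]]]]]]]]]]]]]]]]]]])"
  by code_simp

section \<open>Excluding four, five and six colors in the annulus\<close>

lemma no_four_coloring:
  assumes b: "sqrt (2 + 2 * sin (pi / 38)) < b"
  shows "\<nexists>c. annulus_coloring b 4 c"
proof
  assume "\<exists>c. annulus_coloring b 4 c"
  then obtain c where c: "annulus_coloring b 4 c" ..
  define C where "C d = cos (2 * pi * real_of_int d / real_of_int 190)" for d
  \<comment> \<open>In all these bounds y is the squared angle, rounded down for upper and up for
    lower bounds of the cosine. The bounds are only as sharp as the table requires.\<close>
  have u21: "C 21 \<le> 769 / 1000" unfolding C_def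
    by (rule cos_2pi_le[where y = "48227 / 100000"]; simp add: cos_poly_def power_divide)
  have u23: "C 23 \<le> 73 / 100" unfolding C_def
    by (rule cos_2pi_le[where y = "1157 / 2000"]; simp add: cos_poly_def power_divide)
  have u32: "C 32 \<le> 1 / 2" unfolding C_def
    by (rule cos_2pi_le[where y = "55991 / 50000"]; simp add: cos_poly_def power_divide)
  have u50: "C 50 \<le> - 8251 / 100000" unfolding C_def
    by (rule cos_2pi_le[where y = "54679 / 20000"]; simp add: cos_poly_def power_divide)
  note upper = u21 u23 u32 u50
  have l31: "1 / 2 \<le> C 31" unfolding C_def
    by (rule cos_2pi_ge[where y = "21019 / 20000"]; simp add: cos_poly_def power_divide)
  have l37: "17 / 50 \<le> C 37" unfolding C_def
    by (rule cos_2pi_ge[where y = "149713 / 100000"]; simp add: cos_poly_def power_divide)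
  note lower = l31 l37
  \<comment> \<open>The threshold is precisely the chord of 50 steps on the unit circle, so this
    edge has to be compared with b symbolically. The number 7357 / 5000 is a rational slightly below
    the threshold.\<close>
  have exact: "2 - 2 * C 50 \<le> b\<^sup>2" and bB: "7357 / 5000 \<le> b"
  proof -
    have "2 * pi * real_of_int 50 / real_of_int 190 = pi / 2 + pi / 38" by simp
    then have C: "C 50 = - sin (pi / 38)" unfolding C_def by (simp only: cos_add) simp
    have "(sqrt (2 - 2 * C 50))\<^sup>2 \<le> b\<^sup>2"
      using b C upper by (intro power_mono) auto
    moreover have "0 \<le> 2 - 2 * C 50" using upper by simp
    ultimately show "2 - 2 * C 50 \<le> b\<^sup>2" by (simp only: real_sqrt_pow2)
    have "7357 / 5000 \<le> sqrt (2 - 2 * C 50)" using upper by (intro real_le_rsqrt) (simp add: power2_eq_square)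
    then show "7357 / 5000 \<le> b" using b C by simp
  qed
  have "(7357 / 5000)\<^sup>2 \<le> b\<^sup>2" using bB by (intro power_mono) auto
  then have b2: "54125449 / 25000000 \<le> b\<^sup>2" by (simp add: power2_eq_square)
  \<comment> \<open>The outer circle has a fixed rational radius, not b: it lies in the annulus for
    every b above the threshold, and all remaining distances become numerical.\<close>
  let ?R = "[1, 7357 / 5000] :: real list" and ?T = "[[(32, 50), (23, 37)], [(23, 37), (21, 31)]]"
  have "ring_coloring 190 4 ?T (\<lambda>i a. if i < length ?R then c (pt (?R ! i) (2 * pi * real_of_int a / real_of_int 190)) else 0)"
  proof (rule ring_coloring_of_annulus[OF c])
    fix i j assume "i < length ?R" "j < length ?R"
    then have "i \<in> {0, 1}" "j \<in> {0, 1}" by auto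
    then show "case ?T ! i ! j of (lo, hi) \<Rightarrow> 0 \<le> lo \<and> 2 * hi \<le> 190 \<and>
        1 \<le> (?R ! i)\<^sup>2 + (?R ! j)\<^sup>2 - 2 * ?R ! i * ?R ! j * cos (2 * pi * real_of_int lo / real_of_int 190) \<and>
        (?R ! i)\<^sup>2 + (?R ! j)\<^sup>2 - 2 * ?R ! i * ?R ! j * cos (2 * pi * real_of_int hi / real_of_int 190) \<le> b\<^sup>2"
      unfolding C_def[symmetric] insert_iff empty_iff
      using upper lower b2 exact by (elim disjE; simp add: power2_eq_square)
  qed (use bB in auto)
  then have "ring_coloring 190 (Suc 3) ?T (\<lambda>i a. if i < length ?R then c (pt (?R ! i) (2 * pi * real_of_int a / real_of_int 190)) else 0)" by simp
  note saturate_sound[OF saturate_five_1 this]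
  note saturate_sound[OF saturate_five_2 this]
  note saturate_sound[OF saturate_five_3 this]
  note saturate_sound[OF saturate_five_4 this]
  then show False using check_empty_sound[OF check_five] by simp
qed

lemma no_five_coloring:
  assumes b: "sqrt (2 + 2 * sin (7 * pi / 45)) < b"
  shows "\<nexists>c. annulus_coloring b 5 c"
proof
  assume "\<exists>c. annulus_coloring b 5 c"
  then obtain c where c: "annulus_coloring b 5 c" ..
  define C where "C d = cos (2 * pi * real_of_int d / real_of_int 180)" for d
  have u16: "C 16 \<le> 17 / 20" unfolding C_def
    by (rule cos_2pi_le[where y = "3899 / 12500"]; simp add: cos_poly_def power_divide)
  have u17: "C 17 \<le> 8291 / 10000" unfolding C_def
    by (rule cos_2pi_le[where y = "35213 / 100000"]; simp add: cos_poly_def power_divide)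
  have u18: "C 18 \<le> 81 / 100" unfolding C_def
    by (rule cos_2pi_le[where y = "19739 / 50000"]; simp add: cos_poly_def power_divide)
  have u21: "C 21 \<le> 3 / 4" unfolding C_def
    by (rule cos_2pi_le[where y = "26867 / 50000"]; simp add: cos_poly_def power_divide)
  have u22: "C 22 \<le> 18 / 25" unfolding C_def
    by (rule cos_2pi_le[where y = "58973 / 100000"]; simp add: cos_poly_def power_divide)
  have u59: "C 59 \<le> - 23471 / 50000" unfolding C_def
    by (rule cos_2pi_le[where y = "106037 / 25000"]; simp add: cos_poly_def power_divide)
  note upper = u16 u17 u18 u21 u22 u59
  have l32: "21 / 50 \<le> C 32" unfolding C_def
    by (rule cos_2pi_ge[where y = "31193 / 25000"]; simp add: cos_poly_def power_divide)
  have l36: "3 / 10 \<le> C 36" unfolding C_def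
    by (rule cos_2pi_ge[where y = "31583 / 20000"]; simp add: cos_poly_def power_divide)
  have l43: "1 / 20 \<le> C 43" unfolding C_def
    by (rule cos_2pi_ge[where y = "225297 / 100000"]; simp add: cos_poly_def power_divide)
  note lower = l32 l36 l43
  have exact: "2 - 2 * C 59 \<le> b\<^sup>2" and bB: "17143 / 10000 \<le> b"
  proof -
    \<comment> \<open>The longest edge on the unit circle spans 118 = 90 + 28 degrees, which turns
      the cosine into the sine of the threshold.\<close>
    have "2 * pi * real_of_int 59 / real_of_int 180 = pi / 2 + 7 * pi / 45" by simp
    then have C: "C 59 = - sin (7 * pi / 45)" unfolding C_def by (simp only: cos_add) simp
    have "(sqrt (2 - 2 * C 59))\<^sup>2 \<le> b\<^sup>2"
      using b C upper by (intro power_mono) auto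
    moreover have "0 \<le> 2 - 2 * C 59" using upper by simp
    ultimately show "2 - 2 * C 59 \<le> b\<^sup>2" by (simp only: real_sqrt_pow2)
    have "17143 / 10000 \<le> sqrt (2 - 2 * C 59)" using upper by (intro real_le_rsqrt) (simp add: power2_eq_square)
    then show "17143 / 10000 \<le> b" using b C by simp
  qed
  have "(17143 / 10000)\<^sup>2 \<le> b\<^sup>2" using bB by (intro power_mono) auto
  then have b2: "293882449 / 100000000 \<le> b\<^sup>2" by (simp add: power2_eq_square)
  \<comment> \<open>Needed exactly twice: on the unit circle this chord is 1, and on the outermost
    circle it equals the radius, whose square is the lower bound for b^2 in
    \<open>b2\<close>.\<close>
  have sixty: "C 30 = 1 / 2" unfolding C_def by (rule cos_2pi_div_6) simp_all
  let ?R = "[1, 36 / 25, 17143 / 10000] :: real list" and ?T = "[[(30, 59), (22, 43), (16, 36)], [(22, 43), (21, 36), (18, 32)], [(16, 36), (18, 32), (17, 30)]]"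
  have "ring_coloring 180 5 ?T (\<lambda>i a. if i < length ?R then c (pt (?R ! i) (2 * pi * real_of_int a / real_of_int 180)) else 0)"
  proof (rule ring_coloring_of_annulus[OF c])
    fix i j assume "i < length ?R" "j < length ?R"
    then have "i \<in> {0, 1, 2}" "j \<in> {0, 1, 2}" by auto
    then show "case ?T ! i ! j of (lo, hi) \<Rightarrow> 0 \<le> lo \<and> 2 * hi \<le> 180 \<and>
        1 \<le> (?R ! i)\<^sup>2 + (?R ! j)\<^sup>2 - 2 * ?R ! i * ?R ! j * cos (2 * pi * real_of_int lo / real_of_int 180) \<and>
        (?R ! i)\<^sup>2 + (?R ! j)\<^sup>2 - 2 * ?R ! i * ?R ! j * cos (2 * pi * real_of_int hi / real_of_int 180) \<le> b\<^sup>2"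
      unfolding C_def[symmetric] insert_iff empty_iff
      using upper lower b2 sixty exact by (elim disjE; simp add: power2_eq_square)
  qed (use bB in auto)
  then have "ring_coloring 180 (Suc 4) ?T (\<lambda>i a. if i < length ?R then c (pt (?R ! i) (2 * pi * real_of_int a / real_of_int 180)) else 0)" by simp
  note saturate_sound[OF saturate_six_1 this]
  note saturate_sound[OF saturate_six_2 this]
  note saturate_sound[OF saturate_six_3 this]
  note saturate_sound[OF saturate_six_4 this]
  note saturate_sound[OF saturate_six_5 this]
  then show False using check_empty_sound[OF check_six] by simp
qed

text \<open>Unlike in the two cases before, the threshold is not a chord from the table. It enters
  only through the rational lower bound 4571 / 2500 for b, which is also the radius of the outermost
  circle.\<close>

lemma no_six_coloring:
  assumes b: "2 * sqrt 2 - 1 < b"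
  shows "\<nexists>c. annulus_coloring b 6 c"
proof
  assume "\<exists>c. annulus_coloring b 6 c"
  then obtain c where c: "annulus_coloring b 6 c" ..
  define C where "C d = cos (2 * pi * real_of_int d / real_of_int 120)" for d
  have u8: "C 8 \<le> 457 / 500" unfolding C_def
    by (rule cos_2pi_le[where y = "3509 / 20000"]; simp add: cos_poly_def power_divide)
  have u11: "C 11 \<le> 8387 / 10000" unfolding C_def
    by (rule cos_2pi_le[where y = "8293 / 25000"]; simp add: cos_poly_def power_divide)
  have u12: "C 12 \<le> 81 / 100" unfolding C_def
    by (rule cos_2pi_le[where y = "19739 / 50000"]; simp add: cos_poly_def power_divide)
  have u13: "C 13 \<le> 39 / 50" unfolding C_def
    by (rule cos_2pi_le[where y = "11583 / 25000"]; simp add: cos_poly_def power_divide)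
  have u16: "C 16 \<le> 67 / 100" unfolding C_def
    by (rule cos_2pi_le[where y = "70183 / 100000"]; simp add: cos_poly_def power_divide)
  have u17: "C 17 \<le> 63 / 100" unfolding C_def
    by (rule cos_2pi_le[where y = "7923 / 10000"]; simp add: cos_poly_def power_divide)
  note upper = u8 u11 u12 u13 u16 u17
  have l21: "9 / 20 \<le> C 21" unfolding C_def
    by (rule cos_2pi_ge[where y = "15113 / 12500"]; simp add: cos_poly_def power_divide)
  have l22: "19 / 50 \<le> C 22" unfolding C_def
    by (rule cos_2pi_ge[where y = "33173 / 25000"]; simp add: cos_poly_def power_divide)
  have l23: "351 / 1000 \<le> C 23" unfolding C_def
    by (rule cos_2pi_ge[where y = "14503 / 10000"]; simp add: cos_poly_def power_divide)
  have l24: "7 / 25 \<le> C 24" unfolding C_def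
    by (rule cos_2pi_ge[where y = "31583 / 20000"]; simp add: cos_poly_def power_divide)
  have l25: "23 / 100 \<le> C 25" unfolding C_def
    by (rule cos_2pi_ge[where y = "171349 / 100000"]; simp add: cos_poly_def power_divide)
  have l28: "1 / 10 \<le> C 28" unfolding C_def
    by (rule cos_2pi_ge[where y = "10747 / 5000"]; simp add: cos_poly_def power_divide)
  have l30: "- 1 / 50 \<le> C 30" unfolding C_def
    by (rule cos_2pi_ge[where y = "123371 / 50000"]; simp add: cos_poly_def power_divide)
  have l35: "- 13 / 50 \<le> C 35" unfolding C_def
    by (rule cos_2pi_ge[where y = "335843 / 100000"]; simp add: cos_poly_def power_divide)
  have l44: "- 67 / 100 \<le> C 44" unfolding C_def
    by (rule cos_2pi_ge[where y = "33173 / 6250"]; simp add: cos_poly_def power_divide)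
  note lower = l21 l22 l23 l24 l25 l28 l30 l35 l44
  have "7071 / 5000 \<le> sqrt 2" by (rule real_le_rsqrt) (simp add: power2_eq_square)
  then have bB: "4571 / 2500 \<le> b" using b by simp
  have "(4571 / 2500)\<^sup>2 \<le> b\<^sup>2" using bB by (intro power_mono) auto
  then have b2: "20894041 / 6250000 \<le> b\<^sup>2" by (simp add: power2_eq_square)
  have sixty: "C 20 = 1 / 2" unfolding C_def by (rule cos_2pi_div_6) simp_all
  let ?R = "[1, 32 / 25, 163 / 100, 4571 / 2500] :: real list" and ?T = "[[(20, 44), (17, 35), (12, 28), (8, 24)], [(17, 35), (16, 30), (13, 25), (11, 23)], [(12, 28), (13, 25), (12, 22), (11, 21)], [(8, 24), (11, 23), (11, 21), (11, 20)]]"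
  have "ring_coloring 120 6 ?T (\<lambda>i a. if i < length ?R then c (pt (?R ! i) (2 * pi * real_of_int a / real_of_int 120)) else 0)"
  proof (rule ring_coloring_of_annulus[OF c])
    fix i j assume "i < length ?R" "j < length ?R"
    then have "i \<in> {0, 1, 2, 3}" "j \<in> {0, 1, 2, 3}" by auto
    then show "case ?T ! i ! j of (lo, hi) \<Rightarrow> 0 \<le> lo \<and> 2 * hi \<le> 120 \<and>
        1 \<le> (?R ! i)\<^sup>2 + (?R ! j)\<^sup>2 - 2 * ?R ! i * ?R ! j * cos (2 * pi * real_of_int lo / real_of_int 120) \<and>
        (?R ! i)\<^sup>2 + (?R ! j)\<^sup>2 - 2 * ?R ! i * ?R ! j * cos (2 * pi * real_of_int hi / real_of_int 120) \<le> b\<^sup>2"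
      unfolding C_def[symmetric] insert_iff empty_iff
      using upper lower b2 sixty by (elim disjE; simp add: power2_eq_square)
  qed (use bB in auto)
  then have "ring_coloring 120 (Suc 5) ?T (\<lambda>i a. if i < length ?R then c (pt (?R ! i) (2 * pi * real_of_int a / real_of_int 120)) else 0)" by simp
  note saturate_sound[OF saturate_seven_1 this]
  note saturate_sound[OF saturate_seven_2 this]
  note saturate_sound[OF saturate_seven_3 this]
  note saturate_sound[OF saturate_seven_4 this]
  note saturate_sound[OF saturate_seven_5 this]
  note saturate_sound[OF saturate_seven_6 this]
  note saturate_sound[OF saturate_seven_7 this]
  note saturate_sound[OF saturate_seven_8 this]
  note saturate_sound[OF saturate_seven_9 this]
  note saturate_sound[OF saturate_seven_10 this]
  then show False using check_empty_sound[OF check_seven] by simp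
qed

section \<open>The chromatic number of the annulus\<close>

theorem proposition4p1:
  fixes b :: real
  assumes "b > 1"
  defines "chi \<equiv> chromatic_number (induced_subgraph (interval_distance_graph b) (closed_annulus b))"
  shows
    "(b \<in> {1 <.. sqrt (2 - 2 * sin (pi / 18))} \<longrightarrow> chi = 3) \<and>
     (b \<in> {sqrt (2 - 2 * sin (pi / 18)) <.. sqrt (2 - 2 * sin (18 * pi / 325))} \<longrightarrow> chi \<in> {3, 4}) \<and>
     (b \<in> {sqrt (2 - 2 * sin (18 * pi / 325)) <.. sqrt 2} \<longrightarrow> chi = 4) \<and>
     (b \<in> {sqrt 2 <.. sqrt (2 + 2 * sin (pi / 38))} \<longrightarrow> chi \<in> {4, 5}) \<and>
     (b \<in> {sqrt (2 + 2 * sin (pi / 38)) <.. sqrt (3 / 2 + sqrt 5 / 2)} \<longrightarrow> chi = 5) \<and>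
     (b \<in> {sqrt (3 / 2 + sqrt 5 / 2) <.. sqrt (2 + 2 * sin (7 * pi / 45))} \<longrightarrow> chi \<in> {5, 6}) \<and>
     (b \<in> {sqrt (2 + 2 * sin (7 * pi / 45)) <.. sqrt 3} \<longrightarrow> chi = 6) \<and>
     (b \<in> {sqrt 3 <.. 2 * cos (pi / 7)} \<longrightarrow> chi \<in> {6, 7}) \<and>
     (b \<in> {2 * cos (pi / 7) <.. 2 * sqrt 2 - 1} \<longrightarrow> chi \<in> {6, 7, 8}) \<and>
     (b \<in> {2 * sqrt 2 - 1 <.. sqrt (2 + sqrt 2)} \<longrightarrow> chi \<in> {7, 8})"
proof -
  define t1 t2 t4 t6 where "t1 = sqrt (2 - 2 * sin (pi / 18))" and "t2 = sqrt (2 - 2 * sin (18 * pi / 325))"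
    and "t4 = sqrt (2 + 2 * sin (pi / 38))" and "t6 = sqrt (2 + 2 * sin (7 * pi / 45))"
  \<comment> \<open>Both sides are the golden ratio, which satisfies z^2 = z + 1.\<close>
  have pentagon: "sqrt (3 / 2 + sqrt 5 / 2) = 2 * cos (pi / 5)"
  proof (rule real_sqrt_unique)
    have "(2 * cos (pi / 5))\<^sup>2 = 2 * cos (pi / 5) + 1" using cos_pi_5 by (simp add: power_mult_distrib)
    also have "\<dots> = 3 / 2 + sqrt 5 / 2" unfolding cos_pi_5_eq by (simp add: field_simps)
    finally show "(2 * cos (pi / 5))\<^sup>2 = 3 / 2 + sqrt 5 / 2" .
    show "0 \<le> 2 * cos (pi / 5)" unfolding cos_pi_5_eq by simp
  qed
  have octagon: "sqrt (2 + sqrt 2) = 2 * cos (pi / 8)"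
  proof (rule real_sqrt_unique)
    have "cos (pi / 4) = 2 * (cos (pi / 8))\<^sup>2 - 1" using cos_double_cos[of "pi / 8"] by simp
    then show "(2 * cos (pi / 8))\<^sup>2 = 2 + sqrt 2" by (simp add: cos_45 power_mult_distrib)
    show "0 \<le> 2 * cos (pi / 8)" using cos_gt_zero[of "pi / 8"] by simp
  qed
  have hexagon: "sqrt 3 = 2 * cos (pi / 6)" by (simp add: cos_30)
  have "0 \<le> sin (18 * pi / 325)" by (intro sin_ge_zero) auto
  then have t2: "t2 \<le> sqrt 2" unfolding t2_def by (intro real_sqrt_le_mono) simp
  have "sin (pi / 38) \<le> pi / 38" by (intro sin_x_le_x) simp
  moreover have "pi / 38 \<le> 1 / 4" using pi_less_4 by simp
  moreover have "2 \<le> sqrt 5" by (rule real_le_rsqrt) simp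
  ultimately have t4: "t4 \<le> 2 * cos (pi / 5)"
    unfolding t4_def pentagon[symmetric] by (intro real_sqrt_le_mono) simp
  \<comment> \<open>The angle 7 \<pi> / 45 is 28 degrees, just below the 30 degrees that correspond
    to sqrt 3.\<close>
  have "- (pi / 2) \<le> 7 * pi / 45" by (rule order_trans[of _ 0]) auto
  then have "sin (7 * pi / 45) \<le> sin (pi / 6)" by (intro sin_monotone_2pi_le) auto
  then have t6: "t6 \<le> sqrt 3" unfolding t6_def by (intro real_sqrt_le_mono) (simp add: sin_30)
  have cos67: "sqrt 3 \<le> 2 * cos (pi / 7)"
    unfolding hexagon using cos_monotone_0_pi_le[of "pi / 7" "pi / 6"] by simp
  have s2: "sqrt 2 \<le> 283 / 200" by (rule real_le_lsqrt) (simp_all add: power2_eq_square)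
  have s2': "7 / 5 \<le> sqrt 2" by (rule real_le_rsqrt) (simp add: power2_eq_square)
  \<comment> \<open>The bound sqrt 2 \<le> 283 / 200 makes 2 sqrt 2 - 1 at most 183 / 100, so this
    number separates the two thresholds.\<close>
  have "183 / 100 \<le> sqrt (2 + sqrt 2)"
    using s2' by (intro real_le_rsqrt) (simp add: power2_eq_square)
  then have oct: "2 * sqrt 2 - 1 \<le> sqrt (2 + sqrt 2)" using s2 by simp
  have ge3: "3 \<le> chi"
    using chromatic_number_annulus_ge[OF no_two_coloring[OF assms(1)]] by (simp add: chi_def numeral_eq_enat)
  have ge4: "4 \<le> chi" if "t2 < b"
    using chromatic_number_annulus_ge[OF no_three_coloring] that by (simp add: chi_def t2_def numeral_eq_enat)
  have ge5: "5 \<le> chi" if "t4 < b"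
    using chromatic_number_annulus_ge[OF no_four_coloring] that by (simp add: chi_def t4_def numeral_eq_enat)
  have ge6: "6 \<le> chi" if "t6 < b"
    using chromatic_number_annulus_ge[OF no_five_coloring] that by (simp add: chi_def t6_def numeral_eq_enat)
  have ge7: "7 \<le> chi" if "2 * sqrt 2 - 1 < b"
    using chromatic_number_annulus_ge[OF no_six_coloring] that by (simp add: chi_def numeral_eq_enat)
  have le: "chi \<le> enat k" if "\<exists>c. annulus_coloring b k c" for k
    using that chromatic_number_annulus_le unfolding chi_def by blast
  have b1: "1 \<le> b" using assms(1) by simp
  have le3: "chi \<le> 3" if "b \<le> t1"
    using le[OF three_coloring[OF b1 that[unfolded t1_def]]] by (simp add: numeral_eq_enat)
  have le4: "chi \<le> 4" if "b \<le> sqrt 2"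
    using le[OF four_coloring[OF b1 that]] by (simp add: numeral_eq_enat)
  have le5: "chi \<le> 5" if "b \<le> 2 * cos (pi / 5)"
    using le[OF opposite_sector_coloring[of 5, OF _ b1]] that by (simp add: numeral_eq_enat)
  have le6: "chi \<le> 6" if "b \<le> sqrt 3"
    using le[OF opposite_sector_coloring[of 6, OF _ b1]] that hexagon by (simp add: numeral_eq_enat)
  have le7: "chi \<le> 7" if "b \<le> 2 * cos (pi / 7)"
    using le[OF opposite_sector_coloring[of 7, OF _ b1]] that by (simp add: numeral_eq_enat)
  have le8: "chi \<le> 8" if "b \<le> sqrt (2 + sqrt 2)"
    using le[OF opposite_sector_coloring[of 8, OF _ b1]] that octagon by (simp add: numeral_eq_enat)
  \<comment> \<open>Lower bounds persist for larger b and upper bounds for smaller b. Each interval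
    combines the nearest ones, and the order of the thresholds established above makes them
    applicable.\<close>
  have r1: "chi = 3" if "b \<le> t1"
    using ge3 le3 that by (cases chi) (auto simp: numeral_eq_enat)
  have r2: "chi \<in> {3, 4}" if "b \<le> t2"
    using ge3 le4 that t2 by (cases chi) (auto simp: numeral_eq_enat)
  have r3: "chi = 4" if "t2 < b" "b \<le> sqrt 2"
    using ge4 le4 that by (cases chi) (auto simp: numeral_eq_enat)
  have r4: "chi \<in> {4, 5}" if "sqrt 2 < b" "b \<le> t4"
    using ge4 le5 that t2 t4 by (cases chi) (auto simp: numeral_eq_enat)
  have r5: "chi = 5" if "t4 < b" "b \<le> 2 * cos (pi / 5)"
    using ge5 le5 that by (cases chi) (auto simp: numeral_eq_enat)
  have r6: "chi \<in> {5, 6}" if "2 * cos (pi / 5) < b" "b \<le> t6"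
    using ge5 le6 that t4 t6 by (cases chi) (auto simp: numeral_eq_enat)
  have r7: "chi = 6" if "t6 < b" "b \<le> sqrt 3"
    using ge6 le6 that by (cases chi) (auto simp: numeral_eq_enat)
  have r8: "chi \<in> {6, 7}" if "sqrt 3 < b" "b \<le> 2 * cos (pi / 7)"
    using ge6 le7 that t6 by (cases chi) (auto simp: numeral_eq_enat)
  have r9: "chi \<in> {6, 7, 8}" if "2 * cos (pi / 7) < b" "b \<le> 2 * sqrt 2 - 1"
    using ge6 le8 that t6 cos67 oct by (cases chi) (auto simp: numeral_eq_enat)
  have r10: "chi \<in> {7, 8}" if "2 * sqrt 2 - 1 < b" "b \<le> sqrt (2 + sqrt 2)"
    using ge7 le8 that by (cases chi) (auto simp: numeral_eq_enat)
  show ?thesis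
    unfolding pentagon t1_def[symmetric] t2_def[symmetric] t4_def[symmetric] t6_def[symmetric]
      greaterThanAtMost_iff
    by (intro conjI impI; elim conjE; rule r1 r2 r3 r4 r5 r6 r7 r8 r9 r10; assumption)
qed

end
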